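(* The nonsymmetric operad $\mathcal{A}\mathsf{gd}$ (the AsGDer operad) is Koszul.
   Context: $\Bbbk$ is a field of characteristic zero. The AsGDer operad $\mathcal{A}\mathsf{gd}=\mathcal{F}(E)/(R)$ is the $\Bbbk$-linear nonsymmetric quadratic operad with generators $E(1)=\Bbbk h\oplus\Bbbk\delta$, $E(2)=\Bbbk\mu$, $E(n)=0$ for $n\ne1,2$ (all in degree $0$), where $\mathcal{F}(E)$ is the free nonsymmetric operad on $E$ and $(R)$ is the operadic ideal generated by the space $R\subset\mathcal{F}(E)^{(2)}$ (weight $2$ part) spanned by $$\mu\circ_1\mu-\mu\circ_2\mu,\qquad h\circ_1\mu-\mu\circ_1h-\mu\circ_2h,\qquad\delta\circ_1\mu-\mu\circ_1\delta-\mu\circ_2h.$$ Koszul is meant in the usual sense for quadratic (nonsymmetric) operads: the Koszul complex $\mathcal{P}^{¡}\circ_\kappa\mathcal{P}$ is acyclic, where $\mathcal{P}^{¡}=\mathcal{C}(sE,s^2R)$ is the Koszul dual cooperad. *)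

theory Defs
  imports Complex_Main "HOL-Library.Poly_Mapping"
begin

section \<open>Free vector spaces\<close>

text \<open>The vector space with basis \<open>'a\<close> over the field \<open>'k\<close> is the type \<open>'a \<Rightarrow>\<^sub>0 'k\<close>.\<close>

definition fscale :: "'k::field \<Rightarrow> ('a \<Rightarrow>\<^sub>0 'k) \<Rightarrow> ('a \<Rightarrow>\<^sub>0 'k)" where
  "fscale c x = Poly_Mapping.map ((*) c) x"

lemma lookup_fscale: "Poly_Mapping.lookup (fscale c x) a = c * Poly_Mapping.lookup x a"
  by (simp add: fscale_def Poly_Mapping.map.rep_eq when_def)

global_interpretation fs: vector_space "fscale :: 'k::field \<Rightarrow> ('a \<Rightarrow>\<^sub>0 'k) \<Rightarrow> ('a \<Rightarrow>\<^sub>0 'k)"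
  by unfold_locales
    (auto intro!: poly_mapping_eqI simp: lookup_fscale lookup_add algebra_simps)

abbreviation bas :: "'a \<Rightarrow> ('a \<Rightarrow>\<^sub>0 'k::field)" where
  "bas a \<equiv> Poly_Mapping.single a 1"

text \<open>Linear and bilinear extension of maps given on basis elements.\<close>

definition lift :: "('a \<Rightarrow> ('b \<Rightarrow>\<^sub>0 'k)) \<Rightarrow> ('a \<Rightarrow>\<^sub>0 'k) \<Rightarrow> ('b \<Rightarrow>\<^sub>0 'k::field)" where
  "lift f x = (\<Sum>a\<in>Poly_Mapping.keys x. fscale (Poly_Mapping.lookup x a) (f a))"

definition lift2 ::
  "('a \<Rightarrow> 'b \<Rightarrow> ('c \<Rightarrow>\<^sub>0 'k)) \<Rightarrow> ('a \<Rightarrow>\<^sub>0 'k) \<Rightarrow> ('b \<Rightarrow>\<^sub>0 'k) \<Rightarrow> ('c \<Rightarrow>\<^sub>0 'k::field)" where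
  "lift2 f x y = lift (\<lambda>a. lift (\<lambda>b. f a b) y) x"

section \<open>The free nonsymmetric operad\<close>

text \<open>A generating collection \<open>E\<close> (in degree 0) is given by a basis \<open>'g\<close> with an arity function
  \<open>ar\<close>: \<open>E(n)\<close> has basis \<open>{g. ar g = n}\<close>.  Planar trees with vertices labelled by \<open>'g\<close>, each vertex
  having as many inputs as the arity of its label, form a basis of the free nonsymmetric operad.
  \<open>Leaf\<close> is the operadic identity.\<close>

datatype 'g tree = Leaf | Node 'g "'g tree list"

fun leaves :: "'g tree \<Rightarrow> nat" where
  "leaves Leaf = 1"
| "leaves (Node g ts) = sum_list (map leaves ts)"

fun weight :: "'g tree \<Rightarrow> nat" where
  "weight Leaf = 0"
| "weight (Node g ts) = Suc (sum_list (map weight ts))"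

definition weights :: "'g tree list \<Rightarrow> nat" where
  "weights ts = sum_list (map weight ts)"

fun wf_tree :: "('g \<Rightarrow> nat) \<Rightarrow> 'g tree \<Rightarrow> bool" where
  "wf_tree ar Leaf = True"
| "wf_tree ar (Node g ts) = (length ts = ar g \<and> (\<forall>t\<in>set ts. wf_tree ar t))"

definition Free :: "('g \<Rightarrow> nat) \<Rightarrow> nat \<Rightarrow> ('g tree \<Rightarrow>\<^sub>0 'k::field) set" where
  "Free ar n = {x. \<forall>t\<in>Poly_Mapping.keys x. wf_tree ar t \<and> leaves t = n}"

definition Free_w :: "('g \<Rightarrow> nat) \<Rightarrow> nat \<Rightarrow> nat \<Rightarrow> ('g tree \<Rightarrow>\<^sub>0 'k::field) set" where
  "Free_w ar n w = {x \<in> Free ar n. \<forall>t\<in>Poly_Mapping.keys x. weight t = w}"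

text \<open>\<open>graft t ps\<close> grafts the trees \<open>ps\<close> onto the leaves of \<open>t\<close>, from left to right;
  \<open>graft_list us ps\<close> does so for a forest \<open>us\<close>.  (Meaningful if the length of \<open>ps\<close> is the number of
  leaves.)\<close>

fun graft :: "'g tree \<Rightarrow> 'g tree list \<Rightarrow> 'g tree"
  and graft_list :: "'g tree list \<Rightarrow> 'g tree list \<Rightarrow> 'g tree list" where
  "graft Leaf ps = hd ps"
| "graft (Node g us) ps = Node g (graft_list us ps)"
| "graft_list [] ps = []"
| "graft_list (u # us) ps =
     graft u (take (leaves u) ps) # graft_list us (drop (leaves u) ps)"

text \<open>Partial composition \<open>x \<circ>\<^sub>i y\<close>, with inputs numbered from 1.\<close>

definition pcomp_tree :: "'g tree \<Rightarrow> nat \<Rightarrow> 'g tree \<Rightarrow> 'g tree" where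
  "pcomp_tree t i u = graft t (replicate (i - 1) Leaf @ u # replicate (leaves t - i) Leaf)"

definition pcomp :: "('g tree \<Rightarrow>\<^sub>0 'k) \<Rightarrow> nat \<Rightarrow> ('g tree \<Rightarrow>\<^sub>0 'k) \<Rightarrow> ('g tree \<Rightarrow>\<^sub>0 'k::field)" where
  "pcomp x i y = lift2 (\<lambda>t u. bas (pcomp_tree t i u)) x y"

definition gen :: "('g \<Rightarrow> nat) \<Rightarrow> 'g \<Rightarrow> ('g tree \<Rightarrow>\<^sub>0 'k::field)" where
  "gen ar g = bas (Node g (replicate (ar g) Leaf))"

definition operadic_ideal :: "('g \<Rightarrow> nat) \<Rightarrow> (nat \<Rightarrow> ('g tree \<Rightarrow>\<^sub>0 'k::field) set) \<Rightarrow> bool" where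
  "operadic_ideal ar I \<longleftrightarrow>
     (\<forall>n. fs.subspace (I n) \<and> I n \<subseteq> Free ar n) \<and>
     (\<forall>m n i x y. x \<in> Free ar m \<longrightarrow> y \<in> Free ar n \<longrightarrow> 1 \<le> i \<longrightarrow> i \<le> m \<longrightarrow>
        x \<in> I m \<or> y \<in> I n \<longrightarrow> pcomp x i y \<in> I (m + n - 1))"

text \<open>The ideal \<open>(R)\<close>.  Here and below a space of relations \<open>R\<close> is a subspace of the weight 2 part of
  the free operad, spanned by elements homogeneous in the arity; its arity \<open>n\<close> part is
  \<open>R \<inter> Free ar n\<close>.  The quadratic operad is \<open>P(n) = Free ar n / ideal_gen ar R n\<close>.\<close>

definition ideal_gen ::
  "('g \<Rightarrow> nat) \<Rightarrow> ('g tree \<Rightarrow>\<^sub>0 'k::field) set \<Rightarrow> nat \<Rightarrow> ('g tree \<Rightarrow>\<^sub>0 'k) set" where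
  "ideal_gen ar R n = \<Inter>{I n | I. operadic_ideal ar I \<and> (\<forall>m. R \<inter> Free ar m \<subseteq> I m)}"

section \<open>The Koszul dual cooperad\<close>

text \<open>The cofree conilpotent cooperad on \<open>sE\<close> has the same basis of trees; now each vertex has
  homological degree 1, so that the degree of a tree is its weight.  A tree stands for the tensor of
  its vertex labels \<open>s g\<close> in depth-first order (a vertex precedes its subtrees, which are read from
  left to right); with this choice \<open>s\<^sup>2R\<close> has the same coordinates as \<open>R\<close>.

  \<open>tensor x [y\<^sub>1, \<dots>, y\<^sub>k]\<close> is the element \<open>(x; y\<^sub>1, \<dots>, y\<^sub>k)\<close> of the nonsymmetric composite product,
  which has as basis the pairs of a tree with \<open>k\<close> leaves and a list of \<open>k\<close> trees.\<close>

fun tensor_list :: "('g tree \<Rightarrow>\<^sub>0 'k) list \<Rightarrow> ('g tree list \<Rightarrow>\<^sub>0 'k::field)" where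
  "tensor_list [] = bas []"
| "tensor_list (y # ys) = lift2 (\<lambda>t ts. bas (t # ts)) y (tensor_list ys)"

definition tensor ::
  "('g tree \<Rightarrow>\<^sub>0 'k) \<Rightarrow> ('g tree \<Rightarrow>\<^sub>0 'k) list \<Rightarrow> ('g tree \<times> 'g tree list \<Rightarrow>\<^sub>0 'k::field)" where
  "tensor x ys = lift2 (\<lambda>t ts. bas (t, ts)) x (tensor_list ys)"

text \<open>The composite product of two collections graded by arity and degree.\<close>

definition composite ::
  "(nat \<Rightarrow> nat \<Rightarrow> ('g tree \<Rightarrow>\<^sub>0 'k) set) \<Rightarrow> (nat \<Rightarrow> nat \<Rightarrow> ('g tree \<Rightarrow>\<^sub>0 'k) set) \<Rightarrow>
     nat \<Rightarrow> nat \<Rightarrow> ('g tree \<times> 'g tree list \<Rightarrow>\<^sub>0 'k::field) set" where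
  "composite C D n d = fs.span {tensor x ys | x ys k e ns es.
     x \<in> C k e \<and> length ys = k \<and> length ns = k \<and> length es = k \<and>
     (\<forall>j<k. ys ! j \<in> D (ns ! j) (es ! j)) \<and> sum_list ns = n \<and> e + sum_list es = d}"

text \<open>The decomposition map \<open>\<Delta>\<close> of the cofree cooperad: the sum over all two-level cuts of a tree
  into a bottom tree and the list of trees sitting on its leaves.  The sign is the Koszul sign of
  reordering the vertices (all of degree 1) from the order of the given tree to that of the bottom
  tree followed by the top trees.  For a forest this moves the top part \<open>ts\<close> of the first tree past
  the bottom part \<open>bs\<close> of the remaining ones.\<close>

fun decomp :: "'g tree \<Rightarrow> ('g tree \<times> 'g tree list \<Rightarrow>\<^sub>0 'k::field)"
  and decomp_list :: "'g tree list \<Rightarrow> ('g tree list \<times> 'g tree list \<Rightarrow>\<^sub>0 'k::field)" where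
  "decomp Leaf = bas (Leaf, [Leaf])"
| "decomp (Node g us) =
     bas (Leaf, [Node g us]) + lift (\<lambda>(bs, ts). bas (Node g bs, ts)) (decomp_list us)"
| "decomp_list [] = bas ([], [])"
| "decomp_list (u # us) =
     lift2 (\<lambda>(b, ts) (bs, ts'). fscale ((- 1) ^ (weights ts * weights bs)) (bas (b # bs, ts @ ts')))
       (decomp u) (decomp_list us)"

definition sub_cooperad ::
  "('g \<Rightarrow> nat) \<Rightarrow> (nat \<Rightarrow> nat \<Rightarrow> ('g tree \<Rightarrow>\<^sub>0 'k::field) set) \<Rightarrow> bool" where
  "sub_cooperad ar C \<longleftrightarrow>
     (\<forall>n d. fs.subspace (C n d) \<and> C n d \<subseteq> Free_w ar n d \<and>
        (\<forall>x\<in>C n d. lift decomp x \<in> composite C C n d))"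

text \<open>The quadratic cooperad \<open>C(sE, s\<^sup>2R)\<close>, in arity \<open>n\<close> and degree \<open>d\<close>: the largest sub-cooperad (i.e.
  the sum of all of them) \<open>C\<close> of the cofree cooperad for which the composite of the inclusion with
  the projection onto the weight 2 part modulo \<open>s\<^sup>2R\<close> vanishes.\<close>

definition koszul_dual ::
  "('g \<Rightarrow> nat) \<Rightarrow> ('g tree \<Rightarrow>\<^sub>0 'k::field) set \<Rightarrow> nat \<Rightarrow> nat \<Rightarrow> ('g tree \<Rightarrow>\<^sub>0 'k) set" where
  "koszul_dual ar R n d =
     fs.span (\<Union>{C n d | C. sub_cooperad ar C \<and> (\<forall>m. C m 2 \<subseteq> R)})"

section \<open>The Koszul complex\<close>

text \<open>Since \<open>P = Free / (R)\<close>, the composite product of the Koszul dual cooperad with \<open>P\<close> in arity \<open>n\<close>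
  and degree \<open>d\<close> is the quotient \<open>kc_num ar R n d / kc_den ar R n d\<close>; the tensor product being right
  exact, the denominator is spanned by the tensors having some factor in \<open>(R)\<close>.\<close>

definition kc_num :: "('g \<Rightarrow> nat) \<Rightarrow> ('g tree \<Rightarrow>\<^sub>0 'k::field) set \<Rightarrow> nat \<Rightarrow> nat \<Rightarrow>
    ('g tree \<times> 'g tree list \<Rightarrow>\<^sub>0 'k) set" where
  "kc_num ar R n d = fs.span {tensor x ys | x ys k ns.
     x \<in> koszul_dual ar R k d \<and> length ys = k \<and> length ns = k \<and>
     (\<forall>j<k. ys ! j \<in> Free ar (ns ! j)) \<and> sum_list ns = n}"

definition kc_den :: "('g \<Rightarrow> nat) \<Rightarrow> ('g tree \<Rightarrow>\<^sub>0 'k::field) set \<Rightarrow> nat \<Rightarrow> nat \<Rightarrow>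
    ('g tree \<times> 'g tree list \<Rightarrow>\<^sub>0 'k) set" where
  "kc_den ar R n d = fs.span {tensor x ys | x ys k ns.
     x \<in> koszul_dual ar R k d \<and> length ys = k \<and> length ns = k \<and>
     (\<forall>j<k. ys ! j \<in> Free ar (ns ! j)) \<and> (\<exists>j<k. ys ! j \<in> ideal_gen ar R (ns ! j)) \<and>
     sum_list ns = n}"

text \<open>The differential \<open>d\<^sub>\<kappa>\<close> on a basis element \<open>(t; p\<^sub>1, \<dots>, p\<^sub>k)\<close>: decompose \<open>t\<close> infinitesimally, apply
  the twisting morphism \<open>\<kappa>\<close> (which sends \<open>s g\<close> to \<open>g\<close> and vanishes outside weight 1) to the upper
  factor, and compose the result with the corresponding \<open>p\<^sub>j\<close>.  Only the terms \<open>(b; us)\<close> of \<open>\<Delta>(t)\<close> with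
  exactly one non-identity upper factor contribute, that factor being a single vertex; these are the
  terms in which \<open>us\<close> has total weight 1.  The sign \<open>(-1)\<^sup>|\<^sup>b\<^sup>|\<close> arises from moving \<open>\<kappa>\<close>, of degree
  \<open>-1\<close>, past \<open>b\<close>.\<close>

definition kdiff_bas :: "'g tree \<times> 'g tree list \<Rightarrow> ('g tree \<times> 'g tree list \<Rightarrow>\<^sub>0 'k::field)" where
  "kdiff_bas = (\<lambda>(t, ps).
     lift (\<lambda>(b, us). if weights us = 1 then fscale ((- 1) ^ weight b) (bas (b, graft_list us ps)) else 0)
       (decomp t))"

definition kdiff ::
  "('g tree \<times> 'g tree list \<Rightarrow>\<^sub>0 'k::field) \<Rightarrow> ('g tree \<times> 'g tree list \<Rightarrow>\<^sub>0 'k)" where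
  "kdiff = lift kdiff_bas"

text \<open>Cycles and boundaries are taken modulo \<open>kc_den\<close>.  In degree 0 the differential vanishes, so the
  truncated subtraction is harmless.\<close>

definition kc_cycles :: "('g \<Rightarrow> nat) \<Rightarrow> ('g tree \<Rightarrow>\<^sub>0 'k::field) set \<Rightarrow> nat \<Rightarrow> nat \<Rightarrow>
    ('g tree \<times> 'g tree list \<Rightarrow>\<^sub>0 'k) set" where
  "kc_cycles ar R n d = {x \<in> kc_num ar R n d. kdiff x \<in> kc_den ar R n (d - 1)}"

definition kc_boundaries :: "('g \<Rightarrow> nat) \<Rightarrow> ('g tree \<Rightarrow>\<^sub>0 'k::field) set \<Rightarrow> nat \<Rightarrow> nat \<Rightarrow>
    ('g tree \<times> 'g tree list \<Rightarrow>\<^sub>0 'k) set" where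
  "kc_boundaries ar R n d = {kdiff y + z | y z. y \<in> kc_num ar R n (d + 1) \<and> z \<in> kc_den ar R n d}"

text \<open>The augmentation onto the unit \<open>I\<close>, i.e. the coefficient of \<open>(id; id)\<close>.  Acyclicity of an
  augmented complex means that the kernel of the augmentation has no homology (equivalently, that the
  homology is \<open>I\<close>).\<close>

definition kc_aug :: "('g tree \<times> 'g tree list \<Rightarrow>\<^sub>0 'k::field) \<Rightarrow> 'k" where
  "kc_aug x = Poly_Mapping.lookup x (Leaf, [Leaf])"

definition koszul :: "('g \<Rightarrow> nat) \<Rightarrow> ('g tree \<Rightarrow>\<^sub>0 'k::field) set \<Rightarrow> bool" where
  "koszul ar R \<longleftrightarrow>
     (\<forall>n d. \<forall>x\<in>kc_cycles ar R n d. kc_aug x = 0 \<longrightarrow> x \<in> kc_boundaries ar R n d)"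

section \<open>The operad AsGDer\<close>

datatype agd_gen = H | Delta | Mu

fun agd_ar :: "agd_gen \<Rightarrow> nat" where
  "agd_ar H = 1"
| "agd_ar Delta = 1"
| "agd_ar Mu = 2"

definition agd_rel :: "(agd_gen tree \<Rightarrow>\<^sub>0 'k::field) set" where
  "agd_rel =
    (let h = gen agd_ar H; \<delta> = gen agd_ar Delta; \<mu> = gen agd_ar Mu in
     fs.span
      {pcomp \<mu> 1 \<mu> - pcomp \<mu> 2 \<mu>,
       pcomp h 1 \<mu> - pcomp \<mu> 1 h - pcomp \<mu> 2 h,
       pcomp \<delta> 1 \<mu> - pcomp \<mu> 1 \<delta> - pcomp \<mu> 2 h})"

end

theory Submission
  imports Defs
begin

text \<open>
  As a collection, \<open>P(n)\<close> is the \<open>n\<close>-th tensor power of \<open>V\<close>, with \<open>V\<close> the free algebra on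
  \<open>h, \<delta>\<close>, and the Koszul dual cooperad is tiny: it is spanned in arity \<open>n\<close> by a class \<open>\<nu>\<^sub>n\<close> of degree \<open>n - 1\<close> (a signed sum of all binary trees) and two
  classes \<open>h\<^sub>n\<close>, \<open>\<delta>\<^sub>n\<close> of degree \<open>n\<close>, obtained by inserting one unary vertex into such trees.  It cannot
  be larger, because the weight 2 condition rewrites every coefficient to coefficients of right combs,
  possibly with one unary vertex at the root.

  Hence the Koszul complex consists of the bar complex of the nonunital free algebra \<open>A\<close> on words in
  \<open>h, \<delta>\<close> and two shifted copies of it, which map to it by the actions of \<open>h\<close> and \<open>\<delta>\<close>.  The homology of the
  bar complex is the space of words, and \<open>(c, w) \<mapsto> c w\<close> is a bijection from two copies of it onto the
  nonempty words; only the empty word, the unit, survives.  An explicit contracting homotopy combines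
  splitting off the first word of a product with \<open>c w \<mapsto> (c, w)\<close>.
\<close>

section \<open>Linear extension\<close>

text \<open>Everything is decided on coefficients at trees: a coefficient of the decomposition of
  \<open>x\<close> at a cut is, up to a Koszul sign, the coefficient of \<open>x\<close> at the
  uncut tree. The weight 2 condition, read with fixed trees above the cut and fixed contexts below,
  thus becomes linear equations between coefficients of trees that differ in one place. On this dual
  side unary vertices travel to the root, whereas in the operad the same relations distribute them
  to the leaves.

  Independence of the monomials in \<open>P\<close> is not proved by confluence but by an action on
  a free algebra. It has to be nonunital: an empty left factor in the rule for \<open>Delta\<close>
  would identify the actions of \<open>Delta\<close> and \<open>H\<close>.

  The quotient defining the Koszul complex is never formed. Linear maps \<open>to_model\<close> and
  \<open>of_model\<close> between the tree spaces and the complex on normal forms are compared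
  instead: \<open>to_model\<close> kills \<open>kc_den\<close>, and on \<open>kc_num\<close> the
  round trip differs from the identity by an element of \<open>kc_den\<close>. The homotopy needs no
  correction terms, because splitting off the first word commutes strictly with the actions of
  \<open>h\<close> and \<open>\<delta>\<close>.\<close>

lemma lift_superset:
  assumes "finite A" "Poly_Mapping.keys x \<subseteq> A"
  shows "lift f x = (\<Sum>a\<in>A. fscale (Poly_Mapping.lookup x a) (f a))"
  unfolding lift_def using assms
  by (intro sum.mono_neutral_left) (auto simp: in_keys_iff)

lemma lift_zero [simp]: "lift f 0 = 0"
  by (simp add: lift_def)

lemma lift_single: "lift f (Poly_Mapping.single a c) = fscale c (f a)"
  by (cases "c = 0") (simp_all add: lift_def)

lemma lift_bas [simp]: "lift f (bas a) = f a"
  by (simp add: lift_single)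

lemma lift_add: "lift f (x + y) = lift f x + lift f y"
proof -
  let ?A = "Poly_Mapping.keys x \<union> Poly_Mapping.keys y"
  have "Poly_Mapping.keys (x + y) \<subseteq> ?A"
    by (rule Poly_Mapping.keys_add)
  then show ?thesis
    by (simp add: lift_superset[of ?A] lookup_add fs.scale_left_distrib sum.distrib)
qed

lemma lift_scale: "lift f (fscale c x) = fscale c (lift f x)"
proof -
  have "Poly_Mapping.keys (fscale c x) \<subseteq> Poly_Mapping.keys x"
    by (auto simp: in_keys_iff lookup_fscale)
  then show ?thesis
    by (simp add: lift_superset[of "Poly_Mapping.keys x"] lookup_fscale fs.scale_sum_right)
qed

lemma lift_uminus: "lift f (- x) = - lift f x"
  using lift_scale[of f "-1" x] by simp

lemma lift_diff: "lift f (x - y) = lift f x - lift f y"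
  using lift_add[of f x "- y"] by (simp add: lift_uminus)

lemma lift_sum: "lift f (sum g A) = (\<Sum>i\<in>A. lift f (g i))"
  by (induction A rule: infinite_finite_induct) (simp_all add: lift_add)

lemmas lift_linear = lift_add lift_scale lift_uminus lift_diff lift_sum

lemma lift_cong: "(\<And>a. a \<in> Poly_Mapping.keys x \<Longrightarrow> f a = g a) \<Longrightarrow> lift f x = lift g x"
  by (simp add: lift_def)

lemma lift_lift: "lift f (lift g x) = lift (\<lambda>a. lift f (g a)) x"
  unfolding lift_def[of g] lift_def[of "\<lambda>a. lift f (g a)"] by (simp add: lift_linear)

lemma lift_fun_zero [simp]: "lift (\<lambda>a. 0) x = 0"
  by (simp add: lift_def)

lemma lift_fun_add: "lift (\<lambda>a. f a + g a) x = lift f x + lift g x"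
  by (simp add: lift_def fs.scale_right_distrib sum.distrib)

lemma lift_fun_scale: "lift (\<lambda>a. fscale c (f a)) x = fscale c (lift f x)"
  by (simp add: lift_def fs.scale_sum_right mult.commute)

lemma lift_fun_uminus: "lift (\<lambda>a. - f a) x = - lift f x"
  by (simp add: lift_def sum_negf)

lemma lift_fun_diff: "lift (\<lambda>a. f a - g a) x = lift f x - lift g x"
  by (simp add: lift_def fs.scale_right_diff_distrib sum_subtractf)

lemma lift_fun_sum: "lift (\<lambda>a. \<Sum>i\<in>I. f i a) x = (\<Sum>i\<in>I. lift (f i) x)"
  by (simp add: lift_def fs.scale_sum_right sum.swap[of _ "Poly_Mapping.keys x"])

lemmas lift_fun_linear = lift_fun_add lift_fun_scale lift_fun_uminus lift_fun_diff lift_fun_sum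

lemma lift_swap: "lift (\<lambda>a. lift (\<lambda>b. f a b) y) x = lift (\<lambda>b. lift (\<lambda>a. f a b) x) y"
  unfolding lift_def[of _ y] by (simp add: lift_fun_linear)

lemma lookup_lift:
  "Poly_Mapping.lookup (lift f x) b =
     (\<Sum>a\<in>Poly_Mapping.keys x. Poly_Mapping.lookup x a * Poly_Mapping.lookup (f a) b)"
  by (simp add: lift_def lookup_sum lookup_fscale)

text \<open>The standard device for extracting coefficients: if at most one basis element
  \<open>a0\<close> can contribute, the sum collapses to one product. If \<open>a0\<close> lies
  outside the support, both sides vanish.\<close>

lemma lookup_lift_unique:
  assumes "\<And>a. a \<noteq> a0 \<Longrightarrow> a \<in> Poly_Mapping.keys x \<Longrightarrow> Poly_Mapping.lookup (f a) b = 0"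
  shows "Poly_Mapping.lookup (lift f x) b =
    Poly_Mapping.lookup x a0 * Poly_Mapping.lookup (f a0) b"
proof -
  have "Poly_Mapping.lookup (lift f x) b = (\<Sum>a\<in>Poly_Mapping.keys x. if a = a0 then
      Poly_Mapping.lookup x a * Poly_Mapping.lookup (f a) b else 0)"
    unfolding lookup_lift using assms by (intro sum.cong) auto
  then show ?thesis by (auto simp: in_keys_iff)
qed

lemma lookup_lift_zero:
  assumes "\<And>a. a \<in> Poly_Mapping.keys x \<Longrightarrow> Poly_Mapping.lookup (f a) b = 0"
  shows "Poly_Mapping.lookup (lift f x) b = 0"
  using assms by (simp add: lookup_lift)

lemma lift_bas_self [simp]: "lift bas x = x"
proof (rule poly_mapping_eqI)
  fix b
  show "Poly_Mapping.lookup (lift bas x) b = Poly_Mapping.lookup x b"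
    by (subst lookup_lift_unique[of b]) (simp_all add: lookup_single)
qed

lemma lift_in_subspace:
  assumes "fs.subspace S" "\<And>a. a \<in> Poly_Mapping.keys x \<Longrightarrow> f a \<in> S"
  shows "lift f x \<in> S"
  unfolding lift_def using assms by (intro fs.subspace_sum fs.subspace_scale) auto

lemma span_image_in_subspace:
  assumes "x \<in> fs.span S" "fs.subspace V"
    and "\<And>s. s \<in> S \<Longrightarrow> lift f s \<in> V"
  shows "lift f x \<in> V"
  using assms(1)
proof (induction rule: fs.span_induct_alt)
  case base
  then show ?case using assms(2) by (simp add: fs.subspace_0)
next
  case (step c s y)
  then show ?case using assms by (simp add: lift_linear fs.subspace_add fs.subspace_scale)
qed

lemma span_eq_on:
  assumes "x \<in> fs.span S" "\<And>s. s \<in> S \<Longrightarrow> lift f s = lift g s"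
  shows "lift f x = lift g x"
  using assms(1)
proof (induction rule: fs.span_induct_alt)
  case base
  then show ?case by simp
next
  case (step c s y)
  then show ?case using assms(2) by (simp add: lift_linear)
qed

lemma lift2_bas [simp]: "lift2 f (bas a) (bas b) = f a b"
  by (simp add: lift2_def)

lemma lift2_zero [simp]: "lift2 f 0 y = 0" "lift2 f x 0 = 0"
  by (simp_all add: lift2_def)

lemma lift2_linear_left:
  "lift2 f (x + x') y = lift2 f x y + lift2 f x' y"
  "lift2 f (fscale c x) y = fscale c (lift2 f x y)"
  "lift2 f (- x) y = - lift2 f x y"
  "lift2 f (x - x') y = lift2 f x y - lift2 f x' y"
  "lift2 f (sum h A) y = (\<Sum>i\<in>A. lift2 f (h i) y)"
  "lift2 f (lift g z) y = lift (\<lambda>a. lift2 f (g a) y) z"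
  by (simp_all add: lift2_def lift_linear lift_lift)

lemma lift2_linear_right:
  "lift2 f x (y + y') = lift2 f x y + lift2 f x y'"
  "lift2 f x (fscale c y) = fscale c (lift2 f x y)"
  "lift2 f x (- y) = - lift2 f x y"
  "lift2 f x (y - y') = lift2 f x y - lift2 f x y'"
  "lift2 f x (sum h A) = (\<Sum>i\<in>A. lift2 f x (h i))"
  "lift2 f x (lift g z) = lift (\<lambda>a. lift2 f x (g a)) z"
       apply (simp_all add: lift2_def lift_linear lift_fun_linear lift_lift)
  by (rule lift_swap)

lemmas lift2_linear = lift2_linear_left lift2_linear_right

lemma lift2_bas_left: "lift2 f (bas a) y = lift (f a) y"
  by (simp add: lift2_def)

lemma lift2_bas_right: "lift2 f x (bas b) = lift (\<lambda>a. f a b) x"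
  by (simp add: lift2_def)

lemma lift2_in_subspace:
  assumes "fs.subspace S"
    "\<And>a b. a \<in> Poly_Mapping.keys x \<Longrightarrow> b \<in> Poly_Mapping.keys y \<Longrightarrow> f a b \<in> S"
  shows "lift2 f x y \<in> S"
  unfolding lift2_def using assms by (intro lift_in_subspace) auto

lemma lookup_lift2_unique:
  assumes "\<And>a b. a \<in> Poly_Mapping.keys x \<Longrightarrow> b \<in> Poly_Mapping.keys y \<Longrightarrow>
      (a, b) \<noteq> (a0, b0) \<Longrightarrow> Poly_Mapping.lookup (f a b) c = 0"
  shows "Poly_Mapping.lookup (lift2 f x y) c =
    Poly_Mapping.lookup x a0 * (Poly_Mapping.lookup y b0 * Poly_Mapping.lookup (f a0 b0) c)"
proof (cases "a0 \<in> Poly_Mapping.keys x")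
  case True
  have "Poly_Mapping.lookup (lift2 f x y) c =
      Poly_Mapping.lookup x a0 * Poly_Mapping.lookup (lift (f a0) y) c"
    unfolding lift2_def by (rule lookup_lift_unique) (auto intro!: lookup_lift_zero assms)
  also have "Poly_Mapping.lookup (lift (f a0) y) c =
      Poly_Mapping.lookup y b0 * Poly_Mapping.lookup (f a0 b0) c"
    by (rule lookup_lift_unique) (auto intro!: assms True)
  finally show ?thesis .
next
  case False
  then show ?thesis
    by (auto simp: lift2_def in_keys_iff intro!: lookup_lift_zero assms)
qed

lemma keys_lift:
  "Poly_Mapping.keys (lift f x) \<subseteq> (\<Union>a\<in>Poly_Mapping.keys x. Poly_Mapping.keys (f a))"
proof
  fix b assume "b \<in> Poly_Mapping.keys (lift f x)"
  then have "Poly_Mapping.lookup (lift f x) b \<noteq> 0" by (simp add: in_keys_iff)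
  then obtain a where "a \<in> Poly_Mapping.keys x" "Poly_Mapping.lookup (f a) b \<noteq> 0"
    by (metis lookup_lift_zero)
  then show "b \<in> (\<Union>a\<in>Poly_Mapping.keys x. Poly_Mapping.keys (f a))"
    by (auto simp: in_keys_iff)
qed

section \<open>Grafting and the decomposition map\<close>

abbreviation lkp :: "('a \<Rightarrow>\<^sub>0 'k::zero) \<Rightarrow> 'a \<Rightarrow> 'k" where
  "lkp \<equiv> Poly_Mapping.lookup"

lemma weights_simps [simp]:
  "weights [] = 0" "weights (t # ts) = weight t + weights ts"
  "weights (ts @ us) = weights ts + weights us"
  by (simp_all add: weights_def)

lemma weights_replicate_Leaf [simp]: "weights (replicate n Leaf) = 0"
  by (induction n) simp_all

lemma weight_eq_0_iff [simp]: "weight t = 0 \<longleftrightarrow> t = Leaf"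
  by (cases t) auto

lemma length_graft_list [simp]: "length (graft_list us ps) = length us"
  by (induction us arbitrary: ps) auto

lemma sum_list_map_take_drop:
  "sum_list (map f (take n xs)) + sum_list (map f (drop n xs)) = (sum_list (map f xs) :: nat)"
  by (metis append_take_drop_id map_append sum_list_append)

lemma weights_take_drop: "weights (take n ts) + weights (drop n ts) = weights ts"
  unfolding weights_def by (rule sum_list_map_take_drop)

lemma graft_leaves_weight:
  "length ps = leaves t \<Longrightarrow> leaves (graft t ps) = sum_list (map leaves ps)"
  "length ps = sum_list (map leaves us) \<Longrightarrow>
     sum_list (map leaves (graft_list us ps)) = sum_list (map leaves ps)"
proof (induction t ps and us ps rule: graft_graft_list.induct)
  case (1 ps)
  then show ?case by (cases ps) auto
next
  case (4 u us ps)
  then show ?case by (simp add: sum_list_map_take_drop)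
qed auto

lemma weight_graft:
  "length ps = leaves t \<Longrightarrow> weight (graft t ps) = weight t + weights ps"
  "length ps = sum_list (map leaves us) \<Longrightarrow>
     weights (graft_list us ps) = weights us + weights ps"
proof (induction t ps and us ps rule: graft_graft_list.induct)
  case (1 ps)
  then show ?case by (cases ps) auto
next
  case (2 g us ps)
  then show ?case by (simp add: weights_def)
next
  case (4 u us ps)
  then show ?case using weights_take_drop[of "leaves u" ps] by simp
qed auto

lemma wf_graft:
  "length ps = leaves t \<Longrightarrow> wf_tree ar t \<Longrightarrow> list_all (wf_tree ar) ps \<Longrightarrow> wf_tree ar (graft t ps)"
  "length ps = sum_list (map leaves us) \<Longrightarrow> list_all (wf_tree ar) us \<Longrightarrow>
     list_all (wf_tree ar) ps \<Longrightarrow> list_all (wf_tree ar) (graft_list us ps)"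
proof (induction t ps and us ps rule: graft_graft_list.induct)
  case (1 ps)
  then show ?case by (cases ps) simp_all
next
  case (2 g us ps)
  then show ?case by (simp add: list_all_iff)
next
  case (3 ps)
  then show ?case by simp
next
  case (4 u us ps)
  have "list_all (wf_tree ar) (take (leaves u) ps)" "list_all (wf_tree ar) (drop (leaves u) ps)"
    using 4(5) by (auto simp: list_all_iff dest: in_set_takeD in_set_dropD)
  then show ?case using 4(1,2,3,4) by simp
qed

lemma graft_replicate_leaves [simp]:
  fixes t :: "'g tree" and us :: "'g tree list"
  shows "graft t (replicate (leaves t) Leaf) = t"
    and "graft_list us (replicate (sum_list (map leaves us)) Leaf) = us"
proof (induction t and us rule: decomp_decomp_list.induct)
  case (4 u us)
  then show ?case by (simp add: take_replicate drop_replicate)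
qed simp_all

lemma graft_list_replicate_Leaf [simp]:
  "length ps = n \<Longrightarrow> graft_list (replicate n Leaf) ps = ps"
proof (induction n arbitrary: ps)
  case (Suc n)
  then show ?case by (cases ps) auto
qed simp

lemma leaves_pos: "wf_tree ar t \<Longrightarrow> (\<And>g. ar g > 0) \<Longrightarrow> leaves t > 0"
proof (induction t)
  case (Node g ts)
  then have "length ts > 0" by simp
  then obtain u us where "ts = u # us" by (cases ts) auto
  then show ?case using Node by simp
qed simp

text \<open>The Koszul sign of the cut of \<open>graft b ts\<close> into \<open>b\<close> and \<open>ts\<close>.\<close>

fun cut_sign :: "'g tree \<Rightarrow> 'g tree list \<Rightarrow> 'k::field"
  and cut_sign_list :: "'g tree list \<Rightarrow> 'g tree list \<Rightarrow> 'k" where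
  "cut_sign Leaf ts = 1"
| "cut_sign (Node g us) ts = cut_sign_list us ts"
| "cut_sign_list [] ts = 1"
| "cut_sign_list (u # us) ts =
     (-1) ^ (weights (take (leaves u) ts) * weights us) *
     (cut_sign u (take (leaves u) ts) * cut_sign_list us (drop (leaves u) ts))"

text \<open>Grafting undoes cutting: a pair \<open>(b, ts)\<close> of matching length is a cut of
  exactly one tree, \<open>graft b ts\<close>. Hence terms never accumulate, and every coefficient
  is 0 or a single Koszul sign.\<close>

lemma lookup_decomp:
  fixes t :: "'g tree" and us :: "'g tree list"
  shows "lkp (decomp t) (b, ts) =
    (if length ts = leaves b \<and> graft b ts = t then cut_sign b ts else (0 :: 'k::field))"
   and "lkp (decomp_list us) (bs, ts) =
    (if length ts = sum_list (map leaves bs) \<and> graft_list bs ts = us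
     then cut_sign_list bs ts else (0 :: 'k))"
proof (induction t and us arbitrary: b ts and bs ts rule: decomp_decomp_list.induct)
  case 1
  show ?case
  proof (cases b)
    case Leaf
    then show ?thesis
      by (cases ts) (auto simp: lookup_single when_def)
  next
    case (Node g us)
    then show ?thesis by (auto simp: lookup_single when_def)
  qed
next
  case (2 g us)
  show ?case
  proof (cases b)
    case Leaf
    have "lkp (lift (\<lambda>(bs, ts). bas (Node g bs, ts)) (decomp_list us)) (Leaf, ts) = (0 :: 'k)"
      by (rule lookup_lift_zero) (auto simp: lookup_single)
    then show ?thesis using Leaf
      by (cases ts) (auto simp: lookup_single lookup_add when_def)
  next
    case (Node g' bs)
    have "lkp (lift (\<lambda>(bs, ts). bas (Node g bs, ts)) (decomp_list us)) (Node g' bs, ts) =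
        lkp (decomp_list us) (bs, ts) *
        lkp ((\<lambda>(bs, ts). bas (Node g bs, ts)) (bs, ts)) (Node g' bs, ts :: 'g tree list)"
      by (rule lookup_lift_unique) (auto simp: lookup_single when_def split: if_splits)
    then show ?thesis using Node 2
      by (auto simp: lookup_single lookup_add when_def)
  qed
next
  case 3
  show ?case
  proof (cases bs)
    case (Cons b bs')
    then show ?thesis by (auto simp: lookup_single)
  qed (auto simp: lookup_single when_def)
next
  case (4 u us)
  let ?f = "\<lambda>(b, ts) (bs, ts'). fscale ((- 1) ^ (weights ts * weights bs)) (bas (b # bs, ts @ ts'))
    :: 'g tree list \<times> 'g tree list \<Rightarrow>\<^sub>0 'k"
  show ?case
  proof (cases bs)
    case Nil
    have "lkp (lift2 ?f (decomp u) (decomp_list us)) ([], ts) = 0"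
      unfolding lift2_def
      by (intro lookup_lift_zero) (auto simp: lookup_single lookup_fscale)
    then show ?thesis using Nil by simp
  next
    case (Cons b bs')
    let ?k = "leaves b"
    have len: "length ts1 = leaves b1" if "(b1, ts1) \<in> Poly_Mapping.keys (decomp u :: _ \<Rightarrow>\<^sub>0 'k)" for b1 ts1
      using that 4(1)[of b1 ts1] by (auto simp: in_keys_iff split: if_splits)
    have "lkp (lift2 ?f (decomp u) (decomp_list us)) (b # bs', ts) =
      lkp (decomp u) (b, take ?k ts) * (lkp (decomp_list us) (bs', drop ?k ts) *
        lkp (?f (b, take ?k ts) (bs', drop ?k ts)) (b # bs', ts))"
      by (rule lookup_lift2_unique) (auto simp: lookup_single lookup_fscale when_def dest!: len split: if_splits)
    then show ?thesis using Cons 4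
      by (auto simp: lookup_single lookup_fscale when_def)
  qed
qed

section \<open>The elements spanning the Koszul dual cooperad\<close>

text \<open>The generator acting on the second factor of a product when \<open>c\<close> acts on the product:
  \<open>h(ab) = h(a)b + a h(b)\<close> and \<open>\<delta>(ab) = \<delta>(a)b + a h(b)\<close>.\<close>

fun nxt :: "agd_gen \<Rightarrow> agd_gen" where
  "nxt Mu = Mu"
| "nxt H = H"
| "nxt Delta = H"

text \<open>\<open>acoef\<close> gives the coefficients of \<open>\<nu>\<^sub>n\<close>, and \<open>dcoef H\<close>, \<open>dcoef Delta\<close> those of \<open>h\<^sub>n\<close>, \<open>\<delta>\<^sub>n\<close>; the signs are
  forced by the weight 2 condition.  \<open>dcoef Mu\<close> vanishes.\<close>

fun acoef :: "agd_gen tree \<Rightarrow> 'k::field" where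
  "acoef Leaf = 1"
| "acoef (Node Mu [a, b]) = (-1) ^ weight a * (acoef a * acoef b)"
| "acoef (Node Mu []) = 0"
| "acoef (Node Mu [a]) = 0"
| "acoef (Node Mu (a # b # c # ts)) = 0"
| "acoef (Node H ts) = 0"
| "acoef (Node Delta ts) = 0"

fun dcoef :: "agd_gen \<Rightarrow> agd_gen tree \<Rightarrow> 'k::field" where
  "dcoef c Leaf = 0"
| "dcoef c (Node Mu [a, b]) =
     (-1) ^ weight a * (dcoef c a * acoef b) - acoef a * dcoef (nxt c) b"
| "dcoef c (Node Mu []) = 0"
| "dcoef c (Node Mu [a]) = 0"
| "dcoef c (Node Mu (a # b # d # ts)) = 0"
| "dcoef c (Node H []) = 0"
| "dcoef c (Node H [a]) = (if c = H then acoef a else 0)"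
| "dcoef c (Node H (a # b # ts)) = 0"
| "dcoef c (Node Delta []) = 0"
| "dcoef c (Node Delta [a]) = (if c = Delta then acoef a else 0)"
| "dcoef c (Node Delta (a # b # ts)) = 0"

fun acoefs :: "agd_gen tree list \<Rightarrow> 'k::field" where
  "acoefs [] = 1"
| "acoefs (t # ts) = acoef t * acoefs ts"

fun dcoefs :: "agd_gen \<Rightarrow> agd_gen tree list \<Rightarrow> 'k::field" where
  "dcoefs c [] = 0"
| "dcoefs c (t # ts) = dcoef c t * acoefs ts + (-1) ^ Suc (weight t) * (acoef t * dcoefs (nxt c) ts)"

fun eps :: "'g tree list \<Rightarrow> 'k::field" where
  "eps [] = 1"
| "eps (t # ts) = (-1) ^ (weight t * length ts) * eps ts"

lemma nxt_nxt [simp]: "nxt (nxt c) = nxt c"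
  by (cases c) simp_all

lemma nxt_eq_Mu_iff [simp]: "nxt c = Mu \<longleftrightarrow> c = Mu"
  by (cases c) simp_all

lemma acoef_nonzero:
  "acoef t \<noteq> (0 :: 'k::field) \<Longrightarrow> wf_tree agd_ar t \<and> leaves t = Suc (weight t)"
  by (induction t rule: acoef.induct) auto

lemma dcoef_Mu [simp]: "dcoef Mu t = 0"
proof -
  have "c = Mu \<Longrightarrow> dcoef c t = 0" for c
    by (induction c t rule: dcoef.induct) auto
  then show ?thesis by simp
qed

lemma dcoefs_Mu [simp]: "dcoefs Mu ts = 0"
  by (induction ts) simp_all

lemma dcoef_nonzero:
  "dcoef c t \<noteq> (0 :: 'k::field) \<Longrightarrow> wf_tree agd_ar t \<and> leaves t = weight t"
proof (induction c t rule: dcoef.induct)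
  case (2 c a b)
  then have "(dcoef c a \<noteq> (0::'k) \<and> acoef b \<noteq> (0::'k)) \<or> (acoef a \<noteq> (0::'k) \<and> dcoef (nxt c) b \<noteq> (0::'k))"
    by auto
  then show ?case using 2(1,2) acoef_nonzero[of a, where 'k='k] acoef_nonzero[of b, where 'k='k]
    by auto
qed (use acoef_nonzero[where 'k='k] in \<open>auto split: if_splits\<close>)

lemma acoefs_append: "acoefs (ts @ us) = acoefs ts * acoefs us"
  by (induction ts) simp_all

text \<open>Passing \<open>ts\<close> collects one sign for each vertex and each tree of it. Since
  \<open>nxt\<close> is idempotent, the generator reaching \<open>us\<close> is \<open>nxt c\<close>
  however long \<open>ts\<close> is, provided it is nonempty.\<close>

lemma dcoefs_append:
  "ts \<noteq> [] \<Longrightarrow> dcoefs c (ts @ us) = dcoefs c ts * acoefs us +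
     (-1) ^ (weights ts + length ts) * (acoefs ts * dcoefs (nxt c) us)"
proof (induction ts arbitrary: c)
  case (Cons t ts)
  show ?case
  proof (cases "ts = []")
    case False
    then show ?thesis using Cons
      by (simp add: acoefs_append power_add algebra_simps)
  qed (simp add: algebra_simps)
qed simp

lemma eps_append:
  "eps (ts @ us) = (-1) ^ (weights ts * length us) * (eps ts * eps us)"
  by (induction ts) (simp_all add: power_add algebra_simps)

text \<open>Parities have to agree only where the factor survives. So identities between weight and
  number of leaves that hold for nonzero coefficients may be used to compare signs.\<close>

lemma minus_one_power_cancel:
  "(-1) ^ m * x = (-1) ^ n * (x :: 'k::field)" if "x \<noteq> 0 \<Longrightarrow> even (m + n)"
  using that by (cases "x = 0") (auto simp: minus_one_power_iff)

lemma Node_Mu_cut: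
  assumes "length ts = leaves (Node Mu [a, b])"
  obtains ts1 ts2 where "ts = ts1 @ ts2" "length ts1 = leaves a" "length ts2 = leaves b"
    "graft (Node Mu [a, b]) ts = Node Mu [graft a ts1, graft b ts2]"
    "cut_sign (Node Mu [a, b]) ts =
       (-1) ^ (weights ts1 * weight b) * (cut_sign a ts1 * (cut_sign b ts2 :: 'k::field))"
    "weight (graft a ts1) = weight a + weights ts1"
  using that[of "take (leaves a) ts" "drop (leaves a) ts"] assms
  by (auto simp: weight_graft)

text \<open>This and the next lemma compute \<open>\<Delta>\<close>: the coefficient of a cut factors, up to a sign that depends on
  the upper forest only.\<close>

lemma cut_acoef:
  "length ts = leaves b \<Longrightarrow>
     cut_sign b ts * acoef (graft b ts) = eps ts * (acoef b * acoefs ts :: 'k::field)"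
proof (induction b arbitrary: ts rule: acoef.induct)
  case 1
  then show ?case by (cases ts) auto
next
  case (2 a b)
  obtain ts1 ts2 where ts: "ts = ts1 @ ts2" "length ts1 = leaves a" "length ts2 = leaves b"
    "graft (Node Mu [a, b]) ts = Node Mu [graft a ts1, graft b ts2]"
    "cut_sign (Node Mu [a, b]) ts =
       (-1) ^ (weights ts1 * weight b) * (cut_sign a ts1 * (cut_sign b ts2 :: 'k))"
    "weight (graft a ts1) = weight a + weights ts1"
    by (rule Node_Mu_cut[OF 2(3)])
  let ?P = "eps ts1 * (acoef a * acoefs ts1) * (eps ts2 * (acoef b * acoefs ts2)) :: 'k"
  have "cut_sign (Node Mu [a, b]) ts * acoef (graft (Node Mu [a, b]) ts) =
      (-1) ^ (weights ts1 * weight b + (weight a + weights ts1)) *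
       ((cut_sign a ts1 * acoef (graft a ts1)) * (cut_sign b ts2 * acoef (graft b ts2) :: 'k))"
    using ts(4-) by (simp add: power_add)
  also have "\<dots> = (-1) ^ (weights ts1 * weight b + (weight a + weights ts1)) * ?P"
    using 2(1,2) ts by simp
  \<comment> \<open>The exponents agree because \<open>length ts2 = leaves b\<close>, which is
    \<open>weight b + 1\<close> as soon as \<open>acoef b\<close> is nonzero.\<close>
  also have "\<dots> = (-1) ^ (weights ts1 * length ts2 + weight a) * ?P"
    by (rule minus_one_power_cancel) (use ts(3) acoef_nonzero[of b, where 'k='k] in auto)
  also have "\<dots> = eps ts * (acoef (Node Mu [a, b]) * acoefs ts)"
    by (simp add: ts(1) eps_append acoefs_append power_add algebra_simps)
  finally show ?case .
next
  case (3 ts)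
  then show ?case by simp
next
  case (4 a ts)
  then show ?case by simp
next
  case (5 a b c us ts)
  then show ?case by simp
next
  case (6 us ts)
  then show ?case by simp
next
  case (7 us ts)
  then show ?case by simp
qed

lemma cut_dcoef:
  "length ts = leaves b \<Longrightarrow>
     cut_sign b ts * dcoef c (graft b ts) =
     eps ts * (dcoef c b * acoefs ts + acoef b * dcoefs c ts :: 'k::field)"
proof (induction c b arbitrary: ts rule: dcoef.induct)
  case (1 c)
  then show ?case by (cases ts) auto
next
  case (2 c a b)
  obtain ts1 ts2 where ts: "ts = ts1 @ ts2" "length ts1 = leaves a" "length ts2 = leaves b"
    "graft (Node Mu [a, b]) ts = Node Mu [graft a ts1, graft b ts2]"
    "cut_sign (Node Mu [a, b]) ts =
       (-1) ^ (weights ts1 * weight b) * (cut_sign a ts1 * (cut_sign b ts2 :: 'k))"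
    "weight (graft a ts1) = weight a + weights ts1"
    by (rule Node_Mu_cut[OF 2(3)])
  let ?p = "\<lambda>n. (-1) ^ n :: 'k"
  let ?e = "eps ts1 * eps ts2 :: 'k"
  let ?A1 = "acoefs ts1 :: 'k" let ?A2 = "acoefs ts2 :: 'k"
  have na: "acoef a \<noteq> (0::'k) \<Longrightarrow> leaves a = Suc (weight a)"
   and nb: "acoef b \<noteq> (0::'k) \<Longrightarrow> leaves b = Suc (weight b)"
   and da: "dcoef c a \<noteq> (0::'k) \<Longrightarrow> leaves a = weight a"
   and db: "dcoef (nxt c) b \<noteq> (0::'k) \<Longrightarrow> leaves b = weight b"
    using acoef_nonzero dcoef_nonzero by blast+
  have lhs: "cut_sign (Node Mu [a, b]) ts * dcoef c (graft (Node Mu [a, b]) ts) =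
      ?p (weights ts1 * weight b + (weight a + weights ts1)) *
       ((cut_sign a ts1 * dcoef c (graft a ts1)) * (cut_sign b ts2 * acoef (graft b ts2))) -
      ?p (weights ts1 * weight b) *
       ((cut_sign a ts1 * acoef (graft a ts1)) * (cut_sign b ts2 * dcoef (nxt c) (graft b ts2)))"
    using ts(4-) by (simp add: power_add algebra_simps)
  have lhs': "\<dots> =
      ?p (weights ts1 * weight b + (weight a + weights ts1)) * (?e * dcoef c a * acoef b * ?A1 * ?A2) +
      ?p (weights ts1 * weight b + (weight a + weights ts1)) * (?e * acoef a * acoef b * dcoefs c ts1 * ?A2) +
      ?p (Suc (weights ts1 * weight b)) * (?e * acoef a * dcoef (nxt c) b * ?A1 * ?A2) +
      ?p (Suc (weights ts1 * weight b)) * (?e * acoef a * acoef b * ?A1 * dcoefs (nxt c) ts2)"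
    using 2(1)[OF ts(2)] 2(2)[OF ts(3)] cut_acoef[OF ts(2), where 'k='k] cut_acoef[OF ts(3), where 'k='k]
    by (simp add: algebra_simps)
  \<comment> \<open>The unary vertex lies in \<open>a\<close>, \<open>ts1\<close>, \<open>b\<close>
    or \<open>ts2\<close>. Each sign is corrected by \<open>leaves = weight + 1\<close> where
    \<open>acoef\<close> is nonzero and \<open>leaves = weight\<close> where \<open>dcoef\<close>
    is.\<close>
  have r1: "?p (weights ts1 * weight b + (weight a + weights ts1)) * (?e * dcoef c a * acoef b * ?A1 * ?A2)
      = ?p (weights ts1 * length ts2 + weight a) * (?e * dcoef c a * acoef b * ?A1 * ?A2)"
    by (rule minus_one_power_cancel) (use ts(3) nb in auto)
  have r2: "?p (weights ts1 * weight b + (weight a + weights ts1)) * (?e * acoef a * acoef b * dcoefs c ts1 * ?A2)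
      = ?p (weights ts1 * length ts2 + weight a) * (?e * acoef a * acoef b * dcoefs c ts1 * ?A2)"
    by (rule minus_one_power_cancel) (use ts(3) nb in auto)
  have r3: "?p (Suc (weights ts1 * weight b)) * (?e * acoef a * dcoef (nxt c) b * ?A1 * ?A2)
      = ?p (Suc (weights ts1 * length ts2)) * (?e * acoef a * dcoef (nxt c) b * ?A1 * ?A2)"
    by (rule minus_one_power_cancel) (use ts(3) db in auto)
  have r4: "?p (Suc (weights ts1 * weight b)) * (?e * acoef a * acoef b * ?A1 * dcoefs (nxt c) ts2)
      = ?p (weights ts1 * length ts2 + (weight a + (weights ts1 + length ts1))) *
        (?e * acoef a * acoef b * ?A1 * dcoefs (nxt c) ts2)"
    by (rule minus_one_power_cancel) (use ts(2,3) na nb in auto)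
  have rhs: "eps ts * (dcoef c (Node Mu [a, b]) * acoefs ts + acoef (Node Mu [a, b]) * dcoefs c ts) =
      ?p (weights ts1 * length ts2 + weight a) * (?e * dcoef c a * acoef b * ?A1 * ?A2) +
      ?p (weights ts1 * length ts2 + weight a) * (?e * acoef a * acoef b * dcoefs c ts1 * ?A2) +
      ?p (Suc (weights ts1 * length ts2)) * (?e * acoef a * dcoef (nxt c) b * ?A1 * ?A2) +
      ?p (weights ts1 * length ts2 + (weight a + (weights ts1 + length ts1))) *
        (?e * acoef a * acoef b * ?A1 * dcoefs (nxt c) ts2)"
  \<comment> \<open>\<open>dcoefs_append\<close> needs a nonempty first part; an empty one means
    that \<open>a\<close> has no leaves, and then its coefficients vanish.\<close>
  proof (cases "ts1 = []")
    case True
    then have "leaves a = 0" using ts(2) by simp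
    then have "acoef a = (0::'k)" "dcoef c a = (0::'k)"
      using na da by (auto, cases a, auto)
    then show ?thesis by simp
  next
    case False
    show ?thesis
      by (simp add: ts(1) eps_append acoefs_append dcoefs_append[OF False] power_add algebra_simps)
  qed
  show ?case unfolding lhs lhs' rhs r1 r2 r3 r4 ..
next
  case (7 c a)
  then show ?case using cut_acoef[of ts a, where 'k='k] by auto
next
  case (10 c a)
  then show ?case using cut_acoef[of ts a, where 'k='k] by auto
qed simp_all

text \<open>\<open>Mu\<close> serves as the index of the classes without unary vertex. As
  \<open>dcoefs Mu\<close> vanishes, one formula for the decomposition covers all three
  families.\<close>

definition ccoef :: "agd_gen \<Rightarrow> agd_gen tree \<Rightarrow> 'k::field" where
  "ccoef c t = (if c = Mu then acoef t else dcoef c t)"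

text \<open>Truncated subtraction gives degree 0 in arity 0, which is harmless since
  \<open>cog c 0\<close> is zero.\<close>

definition dgr :: "agd_gen \<Rightarrow> nat \<Rightarrow> nat" where
  "dgr c n = (if c = Mu then n - 1 else n)"

text \<open>\<open>cog Mu n\<close>, \<open>cog H n\<close>, \<open>cog Delta n\<close> are \<open>\<nu>\<^sub>n\<close>, \<open>h\<^sub>n\<close>, \<open>\<delta>\<^sub>n\<close>, of degree \<open>dgr c n\<close>.\<close>

definition cog :: "agd_gen \<Rightarrow> nat \<Rightarrow> (agd_gen tree \<Rightarrow>\<^sub>0 'k::field)" where
  "cog c n = (\<Sum>t | wf_tree agd_ar t \<and> leaves t = n \<and> weight t \<le> n. fscale (ccoef c t) (bas t))"

definition emb :: "('a \<Rightarrow>\<^sub>0 'k) \<Rightarrow> 'b \<Rightarrow> ('a \<times> 'b \<Rightarrow>\<^sub>0 'k::field)" where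
  "emb x ps = lift (\<lambda>t. bas (t, ps)) x"

text \<open>The upper levels that matter in cuts of \<open>cog c n\<close>. Unary vertices can be
  stacked without adding leaves, so finiteness needs the bound on the weight; forests beyond it
  carry coefficient zero.\<close>

definition forests :: "nat \<Rightarrow> agd_gen tree list set" where
  "forests n = {ts. list_all (wf_tree agd_ar) ts \<and> sum_list (map leaves ts) = n \<and> weights ts \<le> n}"

lemma agd_ar_pos [simp]: "0 < agd_ar g"
  by (cases g) simp_all

lemma UNIV_agd_gen: "UNIV = {H, Delta, Mu}"
  by (auto intro: agd_gen.exhaust)

lemma finite_trees: "finite {t. wf_tree agd_ar t \<and> weight t \<le> w}"
proof (induction w)
  case 0
  have "{t. wf_tree agd_ar t \<and> weight t \<le> 0} \<subseteq> {Leaf}" by auto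
  then show ?case by (rule finite_subset) simp
next
  case (Suc w)
  let ?S = "{t. wf_tree agd_ar t \<and> weight t \<le> w}"
  let ?L = "{ts. set ts \<subseteq> ?S \<and> length ts \<le> 2}"
  have "t \<in> insert Leaf (case_prod Node ` (UNIV \<times> ?L))"
    if "wf_tree agd_ar t" "weight t \<le> Suc w" for t
  proof (cases t)
    case (Node g ts)
    have "weight u \<le> w" if "u \<in> set ts" for u
      using \<open>weight t \<le> Suc w\<close> Node member_le_sum_list[of "weight u" "map weight ts"] that by auto
    moreover have "length ts \<le> 2"
      using that Node by (cases g) auto
    ultimately have "(g, ts) \<in> UNIV \<times> ?L" using that Node by auto
    then show ?thesis using Node by force
  qed simp
  then have "{t. wf_tree agd_ar t \<and> weight t \<le> Suc w} \<subseteq> insert Leaf (case_prod Node ` (UNIV \<times> ?L))"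
    by blast
  moreover have "finite \<dots>"
    using finite_lists_length_le[OF Suc] by (simp add: UNIV_agd_gen)
  ultimately show ?case by (rule finite_subset)
qed

lemma length_le_leaves:
  "list_all (wf_tree agd_ar) ts \<Longrightarrow> length ts \<le> sum_list (map leaves ts)"
proof (induction ts)
  case (Cons t ts)
  have "0 < leaves t"
    by (rule leaves_pos[of agd_ar]) (use Cons.prems in simp_all)
  moreover have "length ts \<le> sum_list (map leaves ts)"
    using Cons by simp
  ultimately show ?case by simp
qed simp

lemma finite_forests: "finite (forests n)"
proof -
  have "set ts \<subseteq> {t. wf_tree agd_ar t \<and> weight t \<le> n} \<and> length ts \<le> n" if "ts \<in> forests n" for ts
    using that length_le_leaves[of ts] member_le_sum_list[of _ "map weight ts"]
    by (fastforce simp: forests_def list_all_iff weights_def)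
  then show ?thesis
    by (intro finite_subset[OF _ finite_lists_length_le[OF finite_trees[of n], of n]]) blast
qed

lemma ccoef_nonzero:
  assumes "ccoef c t \<noteq> (0 :: 'k::field)"
  shows "wf_tree agd_ar t" "weight t = dgr c (leaves t)" "weight t \<le> leaves t"
  using assms acoef_nonzero[of t, where 'k='k] dcoef_nonzero[of c t, where 'k='k]
  by (auto simp: ccoef_def dgr_def split: if_splits)

text \<open>The weight cutoff in the sum defining \<open>cog\<close> loses nothing, because a
  nonzero \<open>ccoef\<close> forces the weight to be at most the number of leaves.\<close>

lemma lookup_cog: "lkp (cog c n) t = (if leaves t = n then ccoef c t else (0 :: 'k::field))"
proof -
  have "finite {t. wf_tree agd_ar t \<and> leaves t = n \<and> weight t \<le> n}" (is "finite ?S")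
    by (rule finite_subset[OF _ finite_trees[of n]]) auto
  then have "lkp (cog c n) t = (\<Sum>s\<in>?S. if s = t then ccoef c t else (0 :: 'k))"
    unfolding cog_def lookup_sum
    by (intro sum.cong) (auto simp: lookup_fscale lookup_single when_def)
  also have "\<dots> = (if t \<in> ?S then ccoef c t else 0)"
    using \<open>finite ?S\<close> by simp
  also have "\<dots> = (if leaves t = n then ccoef c t else (0 :: 'k))"
    using ccoef_nonzero(1,3)[of c t, where 'k='k] by auto
  finally show ?thesis .
qed

lemma cog_Free_w: "cog c n \<in> Free_w agd_ar n (dgr c n)"
  using ccoef_nonzero[of c] by (auto simp: Free_w_def Free_def in_keys_iff lookup_cog split: if_splits)

lemma lookup_emb: "lkp (emb x ps) (t, qs) = (if qs = ps then lkp x t else 0)"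
  unfolding emb_def
  by (subst lookup_lift_unique[of t]) (auto simp: lookup_single when_def)

lemma lookup_lift2_Cons:
  "lkp (lift2 (\<lambda>t ts. bas (t # ts)) x w) (t # ts) = lkp x t * lkp w ts"
  "lkp (lift2 (\<lambda>t ts. bas (t # ts)) x w) [] = 0"
  by (subst lookup_lift2_unique[of _ _ t ts]; auto simp: lookup_single when_def split: if_splits)
     (auto simp: lift2_def lookup_single intro!: lookup_lift_zero)

lemma lookup_lift2_Pair:
  "lkp (lift2 (\<lambda>t ts. bas (t, ts)) x w) (t, ts) = lkp x t * lkp w ts"
  by (subst lookup_lift2_unique[of _ _ t ts]; auto simp: lookup_single when_def split: if_splits)

lemma acoefs_nonzero:
  "acoefs ts \<noteq> (0 :: 'k::field) \<Longrightarrow>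
     list_all (wf_tree agd_ar) ts \<and> sum_list (map leaves ts) = weights ts + length ts"
  by (induction ts) (auto dest: acoef_nonzero)

lemma dcoefs_nonzero:
  "dcoefs c ts \<noteq> (0 :: 'k::field) \<Longrightarrow>
     list_all (wf_tree agd_ar) ts \<and> Suc (sum_list (map leaves ts)) = weights ts + length ts"
proof (induction ts arbitrary: c)
  case (Cons t ts)
  show ?case
  proof (cases "dcoef c t \<noteq> (0::'k) \<and> acoefs ts \<noteq> (0::'k)")
    case True
    then show ?thesis
      using acoefs_nonzero[of ts, where 'k='k] dcoef_nonzero[of c t, where 'k='k] by simp
  next
    case False
    then have "acoef t \<noteq> (0::'k)" "dcoefs (nxt c) ts \<noteq> (0::'k)"
      using Cons.prems by auto
    then show ?thesis
      using Cons.IH[of "nxt c"] acoef_nonzero[of t, where 'k='k] by simp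
  qed
qed simp

lemma eps_nonzero [simp]: "eps ts \<noteq> (0 :: 'k::field)"
  by (induction ts) simp_all

lemma coefs_nonzero_forests:
  assumes "acoefs ts \<noteq> (0 :: 'k::field) \<or> dcoefs c ts \<noteq> (0 :: 'k)"
  shows "ts \<in> forests (sum_list (map leaves ts))"
proof -
  have "ts \<noteq> []" if "dcoefs c ts \<noteq> (0 :: 'k)" using that by auto
  then have "1 \<le> length ts" if "dcoefs c ts \<noteq> (0 :: 'k)"
    using that by (cases ts) auto
  then show ?thesis
    using assms acoefs_nonzero[of ts, where 'k='k] dcoefs_nonzero[of c ts, where 'k='k]
    by (auto simp: forests_def)
qed

lemma lookup_decomp_cog:
  "lkp (lift decomp (cog c n)) (b, ts) =
     (if length ts = leaves b \<and> sum_list (map leaves ts) = n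
      then eps ts * (ccoef c b * acoefs ts + acoef b * dcoefs c ts) else (0 :: 'k::field))"
proof -
  have "lkp (lift decomp (cog c n)) (b, ts) =
      lkp (cog c n) (graft b ts) * lkp (decomp (graft b ts)) (b, ts)"
    by (rule lookup_lift_unique) (auto simp: lookup_decomp split: if_splits)
  also have "\<dots> = (if length ts = leaves b \<and> sum_list (map leaves ts) = n
      then cut_sign b ts * ccoef c (graft b ts) else (0 :: 'k))"
    by (auto simp: lookup_decomp lookup_cog graft_leaves_weight)
  also have "\<dots> = (if length ts = leaves b \<and> sum_list (map leaves ts) = n
      then eps ts * (ccoef c b * acoefs ts + acoef b * dcoefs c ts) else (0 :: 'k))"
    by (auto simp: ccoef_def cut_acoef cut_dcoef)
  finally show ?thesis .
qed

text \<open>The form of the decomposition used for the Koszul differential, sorted by the individual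
  upper forest. The first summand has the unary vertex below the cut, the second above it; for
  \<open>c = Mu\<close> the second is zero.\<close>

lemma decomp_cog_forests:
  "lift decomp (cog c n) =
     (\<Sum>ts\<in>forests n. fscale (eps ts * acoefs ts) (emb (cog c (length ts)) ts) +
        fscale (eps ts * dcoefs c ts) (emb (cog Mu (length ts)) ts :: _ \<Rightarrow>\<^sub>0 'k::field))"
  (is "_ = ?r")
proof (rule poly_mapping_eqI, clarify)
  fix b ts
  let ?v = "(if length ts = leaves b then eps ts * (ccoef c b * acoefs ts + acoef b * dcoefs c ts)
    else (0 :: 'k))"
  have "lkp ?r (b, ts) = (\<Sum>us\<in>forests n. if us = ts then ?v else 0)"
    unfolding lookup_sum
    by (intro sum.cong)
      (auto simp: lookup_add lookup_fscale lookup_emb lookup_cog ccoef_def algebra_simps)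
  also have "\<dots> = (if ts \<in> forests n then ?v else 0)"
    using finite_forests by simp
  also have "\<dots> = lkp (lift decomp (cog c n)) (b, ts)"
  proof -
    have "sum_list (map leaves ts) = n" if "ts \<in> forests n"
      using that by (simp add: forests_def)
    moreover have "?v = 0 \<or> sum_list (map leaves ts) \<noteq> n \<or> ts \<in> forests n"
    proof (rule ccontr, goal_cases)
      case 1
      then have v: "?v \<noteq> 0" and n: "sum_list (map leaves ts) = n"
        and "ts \<notin> forests n" by auto
      have "acoefs ts \<noteq> (0 :: 'k) \<or> dcoefs c ts \<noteq> (0 :: 'k)"
        using v by (auto split: if_splits)
      then show False using coefs_nonzero_forests n \<open>ts \<notin> forests n\<close> by blast
    qed
    ultimately show ?thesis
      unfolding lookup_decomp_cog by auto
  qed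
  finally show "lkp (lift decomp (cog c n)) (b, ts) = lkp ?r (b, ts)" ..
qed

section \<open>The sub-cooperad\<close>

text \<open>The exponent is that of \<open>eps\<close>, with \<open>n - 1\<close> as the degree of
  the factor; these are the usual signs in the Koszul dual cooperad of the associative
  operad.\<close>

fun atens :: "nat list \<Rightarrow> (agd_gen tree list \<Rightarrow>\<^sub>0 'k::field)" where
  "atens [] = bas []"
| "atens (n # ns) =
     fscale ((-1) ^ ((n - 1) * length ns)) (lift2 (\<lambda>t ts. bas (t # ts)) (cog Mu n) (atens ns))"

text \<open>A sum over the place of the single unary class: passing a \<open>\<nu>\<close> factor of
  arity \<open>n\<close> costs \<open>(-1) ^ n\<close> and turns \<open>c\<close> into
  \<open>nxt c\<close>.\<close>

fun dtens :: "agd_gen \<Rightarrow> nat list \<Rightarrow> (agd_gen tree list \<Rightarrow>\<^sub>0 'k::field)" where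
  "dtens c [] = 0"
| "dtens c (n # ns) =
     fscale ((-1) ^ (n * length ns)) (lift2 (\<lambda>t ts. bas (t # ts)) (cog c n) (atens ns)) +
     fscale ((-1) ^ ((n - 1) * length ns + n))
       (lift2 (\<lambda>t ts. bas (t # ts)) (cog Mu n) (dtens (nxt c) ns))"

lemma lookup_atens:
  "lkp (atens ns) ts = (if map leaves ts = ns then eps ts * acoefs ts else (0 :: 'k::field))"
proof (induction ns arbitrary: ts)
  case Nil
  then show ?case by (auto simp: lookup_single when_def)
next
  case (Cons n ns)
  show ?case
  proof (cases ts)
    case Nil
    then show ?thesis by (simp add: lookup_fscale lookup_lift2_Cons)
  next
    case (Cons t ts')
    have "weight t = leaves t - 1" if "acoef t \<noteq> (0::'k)"
      using acoef_nonzero[OF that] by simp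
    then show ?thesis using Cons Cons.IH
      by (auto simp: lookup_fscale lookup_lift2_Cons lookup_cog ccoef_def)
  qed
qed

lemma lookup_dtens:
  "c \<noteq> Mu \<Longrightarrow>
     lkp (dtens c ns) ts = (if map leaves ts = ns then eps ts * dcoefs c ts else (0 :: 'k::field))"
proof (induction ns arbitrary: ts c)
  case Nil
  then show ?case by auto
next
  case (Cons n ns)
  show ?case
  proof (cases ts)
    case Nil
    then show ?thesis by (simp add: lookup_add lookup_fscale lookup_lift2_Cons)
  next
    case [simp]: (Cons t ts')
    have 1: "leaves t = Suc (weight t)" if "acoef t \<noteq> (0::'k)"
      using acoef_nonzero[OF that] by simp
    have 2: "leaves t = weight t" if "dcoef c t \<noteq> (0::'k)"
      using dcoef_nonzero[OF that] by simp
    have a: "(-1) ^ (leaves t * length ts') * (dcoef c t * (eps ts' * acoefs ts')) =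
        (-1) ^ (weight t * length ts') * (dcoef c t * (eps ts' * acoefs ts' :: 'k))"
      by (rule minus_one_power_cancel) (use 2 in auto)
    have b: "(-1) ^ ((leaves t - 1) * length ts' + leaves t) * (acoef t * (eps ts' * dcoefs (nxt c) ts')) =
        (-1) ^ (weight t * length ts' + Suc (weight t)) * (acoef t * (eps ts' * dcoefs (nxt c) ts' :: 'k))"
      by (rule minus_one_power_cancel) (use 1 in auto)
    have IH: "lkp (dtens (nxt c) ns) ts' =
        (if map leaves ts' = ns then eps ts' * dcoefs (nxt c) ts' else (0 :: 'k))"
      by (rule Cons.IH) (use Cons.prems in simp)
    have *: "lkp (dtens c (n # ns)) ts =
        (-1) ^ (n * length ns) * (lkp (cog c n) t * lkp (atens ns) ts') +
        (-1) ^ ((n - 1) * length ns + n) * (lkp (cog Mu n) t * lkp (dtens (nxt c) ns) ts' :: 'k)"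
      by (simp add: lookup_add lookup_fscale lookup_lift2_Cons)
    show ?thesis
    proof (cases "leaves t = n \<and> map leaves ts' = ns")
      case True
      then have n: "n = leaves t" and ns: "length ns = length ts'" by auto
      have "lkp (dtens c (n # ns)) ts =
        (-1) ^ (leaves t * length ts') * (dcoef c t * (eps ts' * acoefs ts')) +
        (-1) ^ ((leaves t - 1) * length ts' + leaves t) * (acoef t * (eps ts' * dcoefs (nxt c) ts' :: 'k))"
        unfolding * IH lookup_atens lookup_cog ns using True Cons.prems by (simp add: ccoef_def)
      also have "\<dots> = eps ts * dcoefs c ts"
        unfolding a b by (simp add: power_add algebra_simps)
      finally show ?thesis using True by simp
    next
      case False
      then show ?thesis unfolding * IH lookup_atens lookup_cog by auto
    qed
  qed
qed

text \<open>Grouping upper forests by their leaf numbers makes the decomposition a sum of tensors of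
  the classes \<open>cog\<close>, as membership in \<open>composite\<close> requires. The case
  \<open>c = Mu\<close> is set apart because \<open>dtens Mu\<close> does not represent the
  vanishing \<open>dcoefs Mu\<close>.\<close>

lemma decomp_cog_profiles:
  "lift decomp (cog c n) =
     (\<Sum>ns\<in>map leaves ` forests n. lift2 (\<lambda>t ts. bas (t, ts)) (cog c (length ns)) (atens ns) +
        (if c = Mu then 0 else lift2 (\<lambda>t ts. bas (t, ts)) (cog Mu (length ns)) (dtens c ns
          :: _ \<Rightarrow>\<^sub>0 'k::field)))"
  (is "_ = ?r")
proof (rule poly_mapping_eqI, clarify)
  fix b and ts :: "agd_gen tree list"
  let ?v = "(if length ts = leaves b then eps ts * (ccoef c b * acoefs ts + acoef b * dcoefs c ts)
    else (0 :: 'k))"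
  have "lkp ?r (b, ts) = (\<Sum>ns\<in>map leaves ` forests n. if ns = map leaves ts then ?v else 0)"
    unfolding lookup_sum
    by (intro sum.cong refl) (auto simp: lookup_add lookup_fscale lookup_lift2_Pair lookup_cog ccoef_def
        lookup_atens lookup_dtens algebra_simps dest: map_eq_imp_length_eq)
  also have "\<dots> = (if map leaves ts \<in> map leaves ` forests n then ?v else 0)"
    using finite_forests by simp
  also have "\<dots> = lkp (lift decomp (cog c n)) (b, ts)"
  proof -
    have "sum_list (map leaves ts) = n" if "map leaves ts \<in> map leaves ` forests n"
      using that by (auto simp: forests_def)
    moreover have "?v = 0 \<or> sum_list (map leaves ts) \<noteq> n \<or> map leaves ts \<in> map leaves ` forests n"
    proof (rule ccontr, goal_cases)
      case 1
      then have v: "?v \<noteq> 0" and n: "sum_list (map leaves ts) = n"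
        and "ts \<notin> forests n" by auto
      have "acoefs ts \<noteq> (0 :: 'k) \<or> dcoefs c ts \<noteq> (0 :: 'k)"
        using v by (auto split: if_splits)
      then show False using coefs_nonzero_forests n \<open>ts \<notin> forests n\<close> by blast
    qed
    ultimately show ?thesis
      unfolding lookup_decomp_cog by auto
  qed
  finally show "lkp (lift decomp (cog c n)) (b, ts) = lkp ?r (b, ts)" ..
qed

definition cogs :: "nat \<Rightarrow> nat \<Rightarrow> (agd_gen tree \<Rightarrow>\<^sub>0 'k::field) set" where
  "cogs n d = fs.span {cog c n | c. dgr c n = d}"

lemma cog_in_cogs: "dgr c n = d \<Longrightarrow> cog c n \<in> cogs n d"
  unfolding cogs_def by (intro fs.span_base) auto

text \<open>The upper level of \<open>composite\<close>, isolated so that membership can be built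
  factor by factor.\<close>

definition tensor_space ::
  "(nat \<Rightarrow> nat \<Rightarrow> ('g tree \<Rightarrow>\<^sub>0 'k) set) \<Rightarrow> nat \<Rightarrow> nat \<Rightarrow> nat \<Rightarrow> ('g tree list \<Rightarrow>\<^sub>0 'k::field) set" where
  "tensor_space C n l d = fs.span {tensor_list ys | ys ns es.
     length ys = l \<and> length ns = l \<and> length es = l \<and>
     (\<forall>j<l. ys ! j \<in> C (ns ! j) (es ! j)) \<and> sum_list ns = n \<and> sum_list es = d}"

lemma tensor_space_Nil: "bas [] \<in> tensor_space C 0 0 0"
  unfolding tensor_space_def by (intro fs.span_base) (auto intro: exI[of _ "[]"])

lemma tensor_space_Cons:
  assumes "x \<in> C n e" "w \<in> tensor_space C m l d"
  shows "lift2 (\<lambda>t ts. bas (t # ts)) x w \<in> tensor_space C (n + m) (Suc l) (e + d)"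
  using assms(2) unfolding tensor_space_def[of C m]
proof (induction rule: fs.span_induct_alt)
  case base
  then show ?case by (simp add: tensor_space_def fs.span_zero)
next
  case (step c s y)
  then obtain ys ns es where s: "s = tensor_list ys" "length ys = l" "length ns = l" "length es = l"
     "\<forall>j<l. ys ! j \<in> C (ns ! j) (es ! j)" "sum_list ns = m" "sum_list es = d"
    by auto
  have "\<forall>j<Suc l. (x # ys) ! j \<in> C ((n # ns) ! j) ((e # es) ! j)"
    using s assms(1) by (auto simp: nth_Cons split: nat.split)
  then have "tensor_list (x # ys) \<in> tensor_space C (n + m) (Suc l) (e + d)"
    unfolding tensor_space_def using s
    by (intro fs.span_base CollectI exI[of _ "x # ys"] exI[of _ "n # ns"] exI[of _ "e # es"]) auto
  then show ?case using step(2) s(1)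
    unfolding lift2_linear tensor_space_def
    by (intro fs.span_add fs.span_scale) simp_all
qed

lemma composite_Pair:
  assumes "x \<in> C k e" "w \<in> tensor_space D n k d"
  shows "lift2 (\<lambda>t ts. bas (t, ts)) x w \<in> composite C D n (e + d)"
  using assms(2) unfolding tensor_space_def
proof (induction rule: fs.span_induct_alt)
  case base
  then show ?case by (simp add: composite_def fs.span_zero)
next
  case (step c s y)
  then obtain ys ns es where s: "s = tensor_list ys" "length ys = k" "length ns = k" "length es = k"
     "\<forall>j<k. ys ! j \<in> D (ns ! j) (es ! j)" "sum_list ns = n" "sum_list es = d"
    by auto
  have "tensor x ys \<in> composite C D n (e + d)"
    unfolding composite_def using s assms(1) by (intro fs.span_base) blast
  then show ?case using step(2) s(1)
    unfolding lift2_linear composite_def tensor_def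
    by (intro fs.span_add fs.span_scale) simp_all
qed

lemma composite_subspace: "fs.subspace (composite C D n d)"
  by (simp add: composite_def)

lemma atens_in: "atens ns \<in> tensor_space cogs (sum_list ns) (length ns) (sum_list (map (\<lambda>n. n - 1) ns))"
proof (induction ns)
  case Nil
  then show ?case by (simp add: tensor_space_Nil)
next
  case (Cons n ns)
  have "cog Mu n \<in> cogs n (n - 1)"
    by (rule cog_in_cogs) (simp add: dgr_def)
  from tensor_space_Cons[OF this Cons] show ?case
    by (simp add: tensor_space_def fs.span_scale)
qed

lemma dtens_in:
  "c \<noteq> Mu \<Longrightarrow> \<forall>n\<in>set ns. 0 < n \<Longrightarrow>
     (dtens c ns :: _ \<Rightarrow>\<^sub>0 'k::field) \<in>
       tensor_space cogs (sum_list ns) (length ns) (Suc (sum_list (map (\<lambda>n. n - 1) ns)))"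
proof (induction ns arbitrary: c)
  case Nil
  then show ?case by (simp add: tensor_space_def fs.span_zero)
next
  case (Cons n ns)
  have 1: "(cog Mu n :: _ \<Rightarrow>\<^sub>0 'k) \<in> cogs n (n - 1)" and 2: "(cog c n :: _ \<Rightarrow>\<^sub>0 'k) \<in> cogs n n"
    by (rule cog_in_cogs, use Cons.prems in \<open>simp add: dgr_def\<close>)+
  have "(dtens (nxt c) ns :: _ \<Rightarrow>\<^sub>0 'k) \<in> tensor_space cogs (sum_list ns) (length ns) (Suc (sum_list (map (\<lambda>n. n - 1) ns)))"
    by (rule Cons.IH) (use Cons.prems in auto)
  from tensor_space_Cons[OF 1 this] tensor_space_Cons[OF 2 atens_in[of ns]] show ?case
    using Cons.prems by (simp add: tensor_space_def fs.span_scale fs.span_add)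
qed

lemma sum_list_pred: "\<forall>n\<in>set ns. 0 < n \<Longrightarrow> sum_list (map (\<lambda>n. n - 1) ns) + length ns = sum_list ns"
  by (induction ns) auto

lemma Free_w_subspace: "fs.subspace (Free_w ar n w :: ('a tree \<Rightarrow>\<^sub>0 'k::field) set)"
proof -
  have "t \<in> Poly_Mapping.keys x \<or> t \<in> Poly_Mapping.keys y"
    if "t \<in> Poly_Mapping.keys (x + y)" for t and x y :: "'a tree \<Rightarrow>\<^sub>0 'k"
    using that by (metis Poly_Mapping.keys_add UnE subsetD)
  moreover have "t \<in> Poly_Mapping.keys x" if "t \<in> Poly_Mapping.keys (fscale c x)"
    for t c and x :: "'a tree \<Rightarrow>\<^sub>0 'k"
    using that by (auto simp: in_keys_iff lookup_fscale)
  ultimately show ?thesis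
    unfolding fs.subspace_def Free_w_def Free_def by (auto; metis)
qed

lemma cogs_subset_Free_w: "cogs n d \<subseteq> Free_w agd_ar n d"
  unfolding cogs_def by (rule fs.span_minimal[OF _ Free_w_subspace]) (auto simp: cog_Free_w)

lemma sub_cooperad_cogs: "sub_cooperad agd_ar (cogs :: nat \<Rightarrow> nat \<Rightarrow> (agd_gen tree \<Rightarrow>\<^sub>0 'k::field) set)"
  unfolding sub_cooperad_def
proof (intro allI conjI ballI)
  fix n d
  show "fs.subspace (cogs n d)" by (simp add: cogs_def)
  show "cogs n d \<subseteq> Free_w agd_ar n d" by (rule cogs_subset_Free_w)
  fix x :: "agd_gen tree \<Rightarrow>\<^sub>0 'k"
  assume "x \<in> cogs n d"
  then show "lift decomp x \<in> composite cogs cogs n d"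
    unfolding cogs_def[of n]
  proof (rule span_image_in_subspace)
    show "fs.subspace (composite cogs cogs n d)" by (simp add: composite_def)
    fix s :: "agd_gen tree \<Rightarrow>\<^sub>0 'k"
    assume "s \<in> {cog c n |c. dgr c n = d}"
    then obtain c where c: "s = cog c n" "dgr c n = d" by blast
    have "lift2 (\<lambda>t ts. bas (t, ts)) (cog c (length ns)) (atens ns) +
        (if c = Mu then 0 else lift2 (\<lambda>t ts. bas (t, ts)) (cog Mu (length ns)) (dtens c ns))
      \<in> composite cogs cogs n d" if "ns \<in> map leaves ` forests n" for ns
    proof -
      have pos: "\<forall>n\<in>set ns. 0 < n" and sum: "sum_list ns = n"
        using that leaves_pos[of agd_ar] by (auto simp: forests_def list_all_iff)
      let ?p = "sum_list (map (\<lambda>n. n - 1) ns)"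
      have eq: "?p + length ns = n" using sum_list_pred[OF pos] sum by simp
      \<comment> \<open>Arity 0 is treated separately in the degree count, because of the truncated
        subtraction in \<open>dgr Mu 0\<close>.\<close>
      have len: "length ns = 0 \<Longrightarrow> n = 0" using sum by simp
      have "lift2 (\<lambda>t ts. bas (t, ts)) (cog c (length ns)) (atens ns)
        \<in> composite cogs cogs n (dgr c (length ns) + ?p)"
        by (rule composite_Pair[where n = n and C = cogs and D = cogs, OF cog_in_cogs[OF refl] atens_in[of ns, unfolded sum]])
      moreover have "dgr c (length ns) + ?p = d"
        using c(2) eq len by (cases "length ns") (auto simp: dgr_def)
      moreover have "lift2 (\<lambda>t ts. bas (t, ts)) (cog Mu (length ns)) (dtens c ns)
        \<in> composite cogs cogs n d" if "c \<noteq> Mu"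
      proof (cases "ns = []")
        case False
        have "lift2 (\<lambda>t ts. bas (t, ts)) (cog Mu (length ns)) (dtens c ns)
            \<in> composite cogs cogs n (dgr Mu (length ns) + Suc ?p)"
          by (rule composite_Pair[where n = n and C = cogs and D = cogs, OF cog_in_cogs[OF refl] dtens_in[OF that pos, unfolded sum]])
        moreover have "dgr Mu (length ns) + Suc ?p = d"
          using False c(2) eq that by (cases "length ns") (auto simp: dgr_def)
        ultimately show ?thesis by simp
      qed (simp add: composite_def fs.span_zero)
      ultimately show ?thesis
        using fs.subspace_add[OF composite_subspace] by (cases "c = Mu") simp_all
    qed
    then show "lift decomp s \<in> composite cogs cogs n d"
      unfolding c(1) decomp_cog_profiles by (rule fs.subspace_sum[OF composite_subspace])
  qed
qed

section \<open>The classes of degree 2 and the quadratic relations\<close>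

abbreviation Mu2 :: "agd_gen tree \<Rightarrow> agd_gen tree \<Rightarrow> agd_gen tree" where
  "Mu2 a b \<equiv> Node Mu [a, b]"

lemma agd_rel_eq:
  "(agd_rel :: (agd_gen tree \<Rightarrow>\<^sub>0 'k::field) set) = fs.span
     {bas (Mu2 (Mu2 Leaf Leaf) Leaf) - bas (Mu2 Leaf (Mu2 Leaf Leaf)),
      bas (Node H [Mu2 Leaf Leaf]) - bas (Mu2 (Node H [Leaf]) Leaf) - bas (Mu2 Leaf (Node H [Leaf])),
      bas (Node Delta [Mu2 Leaf Leaf]) - bas (Mu2 (Node Delta [Leaf]) Leaf) -
        bas (Mu2 Leaf (Node H [Leaf]))}"
  unfolding agd_rel_def by (simp add: Let_def pcomp_def gen_def pcomp_tree_def numeral_2_eq_2)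

lemma acoef_leaves_1: "acoef t \<noteq> (0 :: 'k::field) \<Longrightarrow> leaves t = 1 \<Longrightarrow> t = Leaf"
  using acoef_nonzero[of t, where 'k='k] by simp

lemma acoef_leaves_2: "acoef t \<noteq> (0 :: 'k::field) \<Longrightarrow> leaves t = 2 \<Longrightarrow> t = Mu2 Leaf Leaf"
proof (induction t rule: acoef.induct)
  case (2 a b)
  then have "acoef a \<noteq> (0 :: 'k)" "acoef b \<noteq> (0 :: 'k)" by auto
  with acoef_nonzero[OF this(1)] acoef_nonzero[OF this(2)] 2(4) show ?case
    by simp
qed simp_all

lemma acoef_leaves_3:
  "acoef t \<noteq> (0 :: 'k::field) \<Longrightarrow> leaves t = 3 \<Longrightarrow>
     t = Mu2 (Mu2 Leaf Leaf) Leaf \<or> t = Mu2 Leaf (Mu2 Leaf Leaf)"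
proof (induction t rule: acoef.induct)
  case (2 a b)
  then have nz: "acoef a \<noteq> (0 :: 'k)" "acoef b \<noteq> (0 :: 'k)" by auto
  have "leaves a \<ge> 1" "leaves b \<ge> 1" "leaves a + leaves b = 3"
    using acoef_nonzero[OF nz(1)] acoef_nonzero[OF nz(2)] 2(4) by simp_all
  then have "leaves a = 1 \<and> leaves b = 2 \<or> leaves a = 2 \<and> leaves b = 1"
    by arith
  then show ?case using nz acoef_leaves_1 acoef_leaves_2 by blast
qed simp_all

lemma dcoef_leaves_1: "dcoef c t \<noteq> (0 :: 'k::field) \<Longrightarrow> leaves t = 1 \<Longrightarrow> t = Node c [Leaf]"
proof (induction c t rule: dcoef.induct)
  case (2 c a b)
  have "0 < leaves a \<and> 0 < leaves b"
    using dcoef_nonzero[OF 2(3)] leaves_pos[of agd_ar a] leaves_pos[of agd_ar b] by auto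
  then show ?case using 2(4) by simp
qed (auto split: if_splits dest: acoef_leaves_1)

lemma dcoef_leaves_2: "dcoef c t \<noteq> (0 :: 'k::field) \<Longrightarrow> leaves t = 2 \<Longrightarrow>
   t = Node c [Mu2 Leaf Leaf] \<or> t = Mu2 (Node c [Leaf]) Leaf \<or> t = Mu2 Leaf (Node (nxt c) [Leaf])"
proof (induction c t rule: dcoef.induct)
  case (2 c a b)
  have "0 < leaves a \<and> 0 < leaves b"
    using dcoef_nonzero[OF 2(3)] leaves_pos[of agd_ar a] leaves_pos[of agd_ar b] by auto
  then have l: "leaves a = 1" "leaves b = 1" using 2(4) by simp_all
  have "(dcoef c a \<noteq> (0::'k) \<and> acoef b \<noteq> (0::'k)) \<or> (acoef a \<noteq> (0::'k) \<and> dcoef (nxt c) b \<noteq> (0::'k))"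
    using 2(3) by auto
  then show ?case
    using l acoef_leaves_1 dcoef_leaves_1 by blast
qed (auto split: if_splits dest: acoef_leaves_2)

text \<open>Degree 2 leaves only \<open>\<nu>\<^sub>3\<close>, \<open>h\<^sub>2\<close> and
  \<open>\<delta>\<^sub>2\<close>; these are the three defining relators, the associator with a
  minus sign.\<close>

lemma cogs_2_subset: "cogs m 2 \<subseteq> (agd_rel :: (agd_gen tree \<Rightarrow>\<^sub>0 'k::field) set)"
proof -
  have 1: "cog Mu 3 = - (bas (Mu2 (Mu2 Leaf Leaf) Leaf) - bas (Mu2 Leaf (Mu2 Leaf Leaf)) ::
      agd_gen tree \<Rightarrow>\<^sub>0 'k)"
    by (rule poly_mapping_eqI)
      (auto simp: lookup_cog ccoef_def lookup_minus lookup_single when_def dest: acoef_leaves_3)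
  have 2: "cog c 2 = (bas (Node c [Mu2 Leaf Leaf]) - bas (Mu2 (Node c [Leaf]) Leaf) -
      bas (Mu2 Leaf (Node H [Leaf])) :: agd_gen tree \<Rightarrow>\<^sub>0 'k)" if "c \<noteq> Mu" for c
    using that by (cases c; intro poly_mapping_eqI)
      (auto simp: lookup_cog ccoef_def lookup_minus lookup_single when_def dest: dcoef_leaves_2[of H, simplified] dcoef_leaves_2[of Delta, simplified])
  have "cog c m \<in> (agd_rel :: (agd_gen tree \<Rightarrow>\<^sub>0 'k::field) set)" if "dgr c m = 2" for c
  proof (cases "c = Mu")
    case True
    then have "m = 3" using that by (simp add: dgr_def)
    show ?thesis unfolding True agd_rel_eq \<open>m = 3\<close> 1
      by (intro fs.span_neg fs.span_base) simp
  next
    case False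
    then have "m = 2" using that by (simp add: dgr_def)
    then show ?thesis using False 2[of c] unfolding agd_rel_eq
      by (cases c) (auto intro!: fs.span_base)
  qed
  then show ?thesis
    unfolding cogs_def by (intro fs.span_minimal) (auto simp: agd_rel_def Let_def)
qed

lemma cogs_subset_koszul_dual: "cogs n d \<subseteq> koszul_dual agd_ar agd_rel n d"
  unfolding koszul_dual_def using sub_cooperad_cogs cogs_2_subset
  by (intro subsetI fs.span_base) blast

section \<open>The Koszul dual cooperad\<close>

lemma composite_mono:
  assumes "\<And>n d. C n d \<subseteq> C' n d" "\<And>n d. D n d \<subseteq> D' n d"
  shows "composite C D n d \<subseteq> composite C' D' n d"
  unfolding composite_def using assms by (intro fs.span_mono) blast

text \<open>Decompositions in an admissible cooperad lie in its own composite, hence by monotonicity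
  in the composite of the sum. So the sum is itself a sub-cooperad, and arguments about a single one
  apply to \<open>koszul_dual\<close>.\<close>

lemma sub_cooperad_koszul_dual:
  "sub_cooperad ar (koszul_dual ar R :: nat \<Rightarrow> nat \<Rightarrow> ('g tree \<Rightarrow>\<^sub>0 'k::field) set)"
  unfolding sub_cooperad_def
proof (intro allI conjI ballI)
  fix n d
  let ?K = "koszul_dual ar R :: nat \<Rightarrow> nat \<Rightarrow> ('g tree \<Rightarrow>\<^sub>0 'k::field) set"
  show "fs.subspace (?K n d)" by (simp add: koszul_dual_def)
  show "?K n d \<subseteq> Free_w ar n d"
    unfolding koszul_dual_def
    by (rule fs.span_minimal[OF _ Free_w_subspace]) (auto simp: sub_cooperad_def)
  fix x assume "x \<in> ?K n d"
  then show "lift decomp x \<in> composite ?K ?K n d"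
    unfolding koszul_dual_def[of ar R n]
  proof (rule span_image_in_subspace[OF _ composite_subspace])
    fix s
    assume "s \<in> \<Union>{C n d |C. sub_cooperad ar C \<and> (\<forall>m. C m 2 \<subseteq> R)}"
    then obtain C where C: "s \<in> C n d" "sub_cooperad ar C" "\<forall>m. C m 2 \<subseteq> R" by blast
    have "C n d \<subseteq> ?K n d" for n d
      unfolding koszul_dual_def using C(2,3) by (intro subsetI fs.span_base) blast
    moreover have "lift decomp s \<in> composite C C n d"
      using C(1,2) by (auto simp: sub_cooperad_def)
    ultimately show "lift decomp s \<in> composite ?K ?K n d"
      using composite_mono[of C ?K C ?K] by blast
  qed
qed

lemma koszul_dual_2_subset: "fs.subspace R \<Longrightarrow> koszul_dual ar R m 2 \<subseteq> R"
  unfolding koszul_dual_def by (intro fs.span_minimal) auto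

section \<open>Contractions of the composite product and equations between coefficients\<close>

lemma tensor_list_nonzero:
  "lkp (tensor_list ys) ts \<noteq> 0 \<Longrightarrow> list_all2 (\<lambda>y t. t \<in> Poly_Mapping.keys y) ys ts"
proof (induction ys arbitrary: ts)
  case Nil
  then show ?case by (auto simp: lookup_single when_def split: if_splits)
next
  case (Cons y ys)
  then show ?case by (cases ts) (auto simp: lookup_lift2_Cons in_keys_iff)
qed

lemma Free_w_lookup:
  "x \<in> Free_w ar n d \<Longrightarrow> lkp x t \<noteq> 0 \<Longrightarrow> wf_tree ar t \<and> leaves t = n \<and> weight t = d"
  unfolding Free_w_def Free_def using in_keys_iff by force

lemma Free_w_degrees:
  assumes "list_all2 (\<lambda>y t. t \<in> Poly_Mapping.keys y) ys ts" "length ns = length ys" "length es = length ys"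
    "\<forall>j<length ys. ys ! j \<in> Free_w ar (ns ! j) (es ! j)"
  shows "map leaves ts = ns \<and> map weight ts = es"
  using assms
  by (auto simp: list_eq_iff_nth_eq list_all2_conv_all_nth Free_w_def Free_def)

lemma lookup_tensor: "lkp (tensor x ys) (b, ts) = lkp x b * lkp (tensor_list ys) ts"
  by (simp add: tensor_def lookup_lift2_Pair)

lemma lookup_tensor_list_append:
  "length ys = length ps \<Longrightarrow>
     lkp (tensor_list (ys @ zs)) (ps @ qs) = lkp (tensor_list ys) ps * lkp (tensor_list zs) qs"
  by (induction ys ps rule: list_induct2) (simp_all add: lookup_lift2_Cons lookup_single)

text \<open>Contraction with the dual basis vector of the upper forest \<open>ts\<close>; the lower
  tree remains.\<close>

definition bottom_slice :: "'b \<Rightarrow> ('a \<times> 'b) \<Rightarrow> ('a \<Rightarrow>\<^sub>0 'k::field)" where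
  "bottom_slice ts = (\<lambda>(b, us). if us = ts then bas b else 0)"

lemma lookup_bottom_slice: "lkp (lift (bottom_slice ts) z) b = lkp z (b, ts)"
  by (subst lookup_lift_unique[of "(b, ts)"])
    (auto simp: bottom_slice_def lookup_single when_def split: if_splits)

text \<open>Contraction with the dual basis vectors of the lower tree and of all upper trees but
  one.\<close>

definition top_slice :: "'a \<Rightarrow> 'b list \<Rightarrow> 'b list \<Rightarrow> ('a \<times> 'b list) \<Rightarrow> ('b \<Rightarrow>\<^sub>0 'k::field)" where
  "top_slice b0 pre post = (\<lambda>(b, us). if b = b0 \<and> (\<exists>u. us = pre @ u # post) then bas (us ! length pre) else 0)"

lemma lookup_top_slice: "lkp (lift (top_slice b0 pre post) z) u = lkp z (b0, pre @ u # post)"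
  by (subst lookup_lift_unique[of "(b0, pre @ u # post)"])
    (auto simp: top_slice_def lookup_single when_def split: if_splits)

text \<open>Contracting a pure tensor gives a multiple of its lower factor. The degree is right
  because a nonzero multiple forces the degrees of the upper factors to be the weights of
  \<open>ts\<close>.\<close>

lemma composite_bottom_slice:
  assumes C: "\<And>n d. fs.subspace (C n d)" "\<And>n d. C n d \<subseteq> Free_w ar n d"
    and z: "z \<in> composite C C n d"
  shows "lift (bottom_slice ts) z \<in> C (length ts) (d - weights ts)"
  using z unfolding composite_def
proof (rule span_image_in_subspace[OF _ C(1)], safe)
  fix x ys ns es k e
  assume x: "x \<in> C (length ys) e" and ns: "length ns = length ys" "length es = length ys"
    and ys: "\<forall>j<length ys. ys ! j \<in> C (ns ! j) (es ! j)"
  have eq: "lift (bottom_slice ts) (tensor x ys) = fscale (lkp (tensor_list ys) ts) x"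
    by (rule poly_mapping_eqI) (simp add: lookup_bottom_slice lookup_tensor lookup_fscale)
  show "lift (bottom_slice ts) (tensor x ys) \<in> C (length ts) (e + sum_list es - weights ts)"
  proof (cases "lkp (tensor_list ys) ts = 0")
    case True
    then show ?thesis unfolding eq using fs.subspace_0[OF C(1)] by simp
  next
    case False
    then have l: "list_all2 (\<lambda>y t. t \<in> Poly_Mapping.keys y) ys ts"
      by (rule tensor_list_nonzero)
    have "map weight ts = es"
      using Free_w_degrees[OF l ns] ys C(2) by blast
    then have "sum_list es = weights ts" by (simp add: weights_def)
    moreover have "length ts = length ys" using l by (simp add: list_all2_lengthD)
    ultimately show ?thesis unfolding eq using x by (simp add: fs.subspace_scale[OF C(1)])
  qed
qed

lemma composite_top_slice:
  assumes C: "\<And>n d. fs.subspace (C n d)" "\<And>n d. C n d \<subseteq> Free_w ar n d"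
    and z: "z \<in> composite C C n d"
  shows "lift (top_slice b0 pre post) z \<in>
    C (n - sum_list (map leaves (pre @ post))) (d - weight b0 - weights (pre @ post))"
  using z unfolding composite_def
proof (rule span_image_in_subspace[OF _ C(1)], safe)
  fix x ys ns es k e
  assume x: "x \<in> C (length ys) e" and ns: "length ns = length ys" "length es = length ys"
    and ys: "\<forall>j<length ys. ys ! j \<in> C (ns ! j) (es ! j)"
  let ?n = "sum_list ns - sum_list (map leaves (pre @ post))"
  let ?d = "e + sum_list es - weight b0 - weights (pre @ post)"
  show "lift (top_slice b0 pre post) (tensor x ys) \<in> C ?n ?d"
  proof (cases "lift (top_slice b0 pre post) (tensor x ys) = 0")
    case True
    then show ?thesis using fs.subspace_0[OF C(1)] by simp
  next
    case False
    then obtain u where "lkp (lift (top_slice b0 pre post) (tensor x ys)) u \<noteq> 0"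
      by (metis poly_mapping_eqI lookup_zero)
    then have b0: "lkp x b0 \<noteq> 0" and nz: "lkp (tensor_list ys) (pre @ u # post) \<noteq> 0"
      by (auto simp: lookup_top_slice lookup_tensor)
    have l: "list_all2 (\<lambda>y t. t \<in> Poly_Mapping.keys y) ys (pre @ u # post)"
      by (rule tensor_list_nonzero[OF nz])
    have deg: "map leaves (pre @ u # post) = ns \<and> map weight (pre @ u # post) = es"
      using Free_w_degrees[OF l ns] ys C(2) by blast
    have len: "length pre < length ys" using list_all2_lengthD[OF l] by simp
    have "ns ! length pre = leaves u" "es ! length pre = weight u"
      using deg by (auto simp: nth_append)
    moreover have "sum_list ns = leaves u + sum_list (map leaves (pre @ post))"
      and "sum_list es = weight u + weights (pre @ post)"
      using deg by (auto simp: weights_def)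
    moreover have "weight b0 = e"
      using b0 x C(2)[of "length ys" e] by (auto simp: Free_w_def in_keys_iff)
    ultimately have y: "ys ! length pre \<in> C ?n ?d"
      using ys len by auto
    have ysplit: "ys = take (length pre) ys @ ys ! length pre # drop (Suc (length pre)) ys"
      using len by (rule id_take_nth_drop)
    have "lkp (tensor_list ys) (pre @ v # post) = lkp (tensor_list (take (length pre) ys)) pre *
       (lkp (ys ! length pre) v * lkp (tensor_list (drop (Suc (length pre)) ys)) post)" for v
      using len by (subst ysplit, subst lookup_tensor_list_append) (simp_all add: lookup_lift2_Cons)
    then have "lift (top_slice b0 pre post) (tensor x ys) =
        fscale (lkp x b0 * (lkp (tensor_list (take (length pre) ys)) pre *
          lkp (tensor_list (drop (Suc (length pre)) ys)) post)) (ys ! length pre)"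
      by (intro poly_mapping_eqI) (simp add: lookup_top_slice lookup_tensor lookup_fscale)
    then show ?thesis using y by (simp add: fs.subspace_scale[OF C(1)])
  qed
qed

lemma lookup_lift_decomp:
  "lkp (lift decomp x) (b, ts) =
     (if length ts = leaves b then cut_sign b ts * lkp x (graft b ts) else 0)"
  by (subst lookup_lift_unique[of "graft b ts"]) (auto simp: lookup_decomp)

locale cooperad_in_free =
  fixes ar :: "'g \<Rightarrow> nat" and C :: "nat \<Rightarrow> nat \<Rightarrow> ('g tree \<Rightarrow>\<^sub>0 'k::field) set"
  assumes sub: "sub_cooperad ar C"
begin

lemma C_subspace: "fs.subspace (C n d)" and C_Free_w: "C n d \<subseteq> Free_w ar n d"
  using sub by (auto simp: sub_cooperad_def)

text \<open>Arity and degree are forgotten on purpose: fixing part of a tree changes both, and the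
  set is closed under fixing a root and all but one of its subtrees.\<close>

definition coefs :: "('g tree \<Rightarrow> 'k) set" where
  "coefs = {lkp x | x n d. x \<in> C n d}"

text \<open>With the trees \<open>ts\<close> fixed above the cut, \<open>f\<close> becomes, up to
  the cut sign, a coefficient function in the lower tree, coming again from \<open>C\<close>. For
  \<open>w = 2\<close> and degree 2 part inside \<open>R\<close>, the relations can thus be read at
  arbitrary subtrees.\<close>

lemma coefs_bottom:
  assumes "f \<in> coefs"
  obtains y where "y \<in> C (length ts) w"
    "\<And>b. length ts = leaves b \<Longrightarrow> weight b = w \<Longrightarrow> lkp y b = cut_sign b ts * f (graft b ts)"
proof -
  obtain x n d where x: "x \<in> C n d" "f = lkp x" using assms by (auto simp: coefs_def)
  have "lift decomp x \<in> composite C C n d" using sub x(1) by (auto simp: sub_cooperad_def)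
  from composite_bottom_slice[OF C_subspace C_Free_w this]
  have y: "lift (bottom_slice ts) (lift decomp x) \<in> C (length ts) (d - weights ts)" .
  show thesis
  proof (cases "d - weights ts = w \<and> weights ts \<le> d")
    case True
    then show thesis
      using y by (intro that) (auto simp: lookup_bottom_slice lookup_lift_decomp x(2))
  next
    case False
    \<comment> \<open>Elements of \<open>C n d\<close> are homogeneous: for any other weight all
      values in question vanish, and 0 is a suitable \<open>y\<close>.\<close>
    have "f (graft b ts) = 0" if "length ts = leaves b" "weight b = w" for b
    proof -
      have "weight (graft b ts) \<noteq> d" using that False by (auto simp: weight_graft)
      moreover have "x \<in> Free_w ar n d" using x(1) C_Free_w by blast
      ultimately show ?thesis
        by (auto simp: Free_w_def in_keys_iff x(2))
    qed
    then show thesis by (intro that[of 0]) (simp_all add: fs.subspace_0[OF C_subspace])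
  qed
qed

text \<open>The cut is made right above the root \<open>g\<close>. Its sign is 1, since below the
  cut no vertex other than the root remains.\<close>

lemma coefs_Node: 
  assumes "f \<in> coefs"
  shows "(\<lambda>u. f (Node g (pre @ u # post))) \<in> coefs"
proof -
  obtain x n d where x: "x \<in> C n d" "f = lkp x" using assms by (auto simp: coefs_def)
  have "lift decomp x \<in> composite C C n d" using sub x(1) by (auto simp: sub_cooperad_def)
  note y = composite_top_slice[OF C_subspace C_Free_w this,
      of "Node g (replicate (ar g) Leaf)" pre post]
  have cs: "cut_sign_list (replicate m Leaf) ts = (1 :: 'k)" for m and ts :: "'g tree list"
    by (induction m arbitrary: ts) simp_all
  have "x \<in> Free_w ar n d" using x(1) C_Free_w by blast
  have nz: "length (pre @ u # post) = ar g" if "lkp x (Node g (pre @ u # post)) \<noteq> 0" for u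
  proof -
    have "wf_tree ar (Node g (pre @ u # post))"
      using Free_w_lookup[OF \<open>x \<in> Free_w ar n d\<close> that] by blast
    then show ?thesis by simp
  qed
  have "f (Node g (pre @ u # post)) =
      lkp (lift (top_slice (Node g (replicate (ar g) Leaf)) pre post) (lift decomp x)) u" for u
    using nz[of u] by (auto simp: lookup_top_slice lookup_lift_decomp x(2) cs sum_list_replicate)
  then show ?thesis using y unfolding coefs_def by (intro CollectI exI conjI) auto
qed

end

text \<open>Linear equations for \<open>R\<close>, checked on its generators. The coefficient at
  \<open>Mu2 Leaf (Node H [Leaf])\<close> involves two others because that tree occurs in both
  Leibniz relations.\<close>

lemma agd_rel_coefs:
  assumes "z \<in> (agd_rel :: (agd_gen tree \<Rightarrow>\<^sub>0 'k::field) set)"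
  shows "lkp z (Mu2 (Mu2 Leaf Leaf) Leaf) = - lkp z (Mu2 Leaf (Mu2 Leaf Leaf))"
    "lkp z (Mu2 (Node H [Leaf]) Leaf) = - lkp z (Node H [Mu2 Leaf Leaf])"
    "lkp z (Mu2 (Node Delta [Leaf]) Leaf) = - lkp z (Node Delta [Mu2 Leaf Leaf])"
    "lkp z (Mu2 Leaf (Node H [Leaf])) =
       - lkp z (Node H [Mu2 Leaf Leaf]) - lkp z (Node Delta [Mu2 Leaf Leaf])"
    "lkp z (Mu2 Leaf (Node Delta [Leaf])) = 0"
    "lkp z (Node g [Node g' [Leaf]]) = 0"
proof -
  have "lkp z (Mu2 (Mu2 Leaf Leaf) Leaf) = - lkp z (Mu2 Leaf (Mu2 Leaf Leaf)) \<and>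
    lkp z (Mu2 (Node H [Leaf]) Leaf) = - lkp z (Node H [Mu2 Leaf Leaf]) \<and>
    lkp z (Mu2 (Node Delta [Leaf]) Leaf) = - lkp z (Node Delta [Mu2 Leaf Leaf]) \<and>
    lkp z (Mu2 Leaf (Node H [Leaf])) =
       - lkp z (Node H [Mu2 Leaf Leaf]) - lkp z (Node Delta [Mu2 Leaf Leaf]) \<and>
    lkp z (Mu2 Leaf (Node Delta [Leaf])) = 0 \<and>
    lkp z (Node g [Node g' [Leaf]]) = 0"
    using assms unfolding agd_rel_eq
  proof (induction rule: fs.span_induct_alt)
    case base
    show ?case by simp
  next
    case (step c s y)
    have "lkp s (Mu2 (Mu2 Leaf Leaf) Leaf) = - lkp s (Mu2 Leaf (Mu2 Leaf Leaf)) \<and>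
      lkp s (Mu2 (Node H [Leaf]) Leaf) = - lkp s (Node H [Mu2 Leaf Leaf]) \<and>
      lkp s (Mu2 (Node Delta [Leaf]) Leaf) = - lkp s (Node Delta [Mu2 Leaf Leaf]) \<and>
      lkp s (Mu2 Leaf (Node H [Leaf])) =
         - lkp s (Node H [Mu2 Leaf Leaf]) - lkp s (Node Delta [Mu2 Leaf Leaf]) \<and>
      lkp s (Mu2 Leaf (Node Delta [Leaf])) = 0 \<and>
      lkp s (Node g [Node g' [Leaf]]) = 0"
      using step(1) by (elim insertE emptyE) (simp_all add: lookup_minus lookup_single when_def)
    then show ?case using step(2)
      by (simp add: lookup_add lookup_fscale) (simp add: algebra_simps)
  qed
  then show "lkp z (Mu2 (Mu2 Leaf Leaf) Leaf) = - lkp z (Mu2 Leaf (Mu2 Leaf Leaf))"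
    "lkp z (Mu2 (Node H [Leaf]) Leaf) = - lkp z (Node H [Mu2 Leaf Leaf])"
    "lkp z (Mu2 (Node Delta [Leaf]) Leaf) = - lkp z (Node Delta [Mu2 Leaf Leaf])"
    "lkp z (Mu2 Leaf (Node H [Leaf])) =
       - lkp z (Node H [Mu2 Leaf Leaf]) - lkp z (Node Delta [Mu2 Leaf Leaf])"
    "lkp z (Mu2 Leaf (Node Delta [Leaf])) = 0"
    "lkp z (Node g [Node g' [Leaf]]) = 0"
    by blast+
qed

context
  fixes C :: "nat \<Rightarrow> nat \<Rightarrow> (agd_gen tree \<Rightarrow>\<^sub>0 'k::field) set"
  assumes C: "sub_cooperad agd_ar C" "\<And>m. C m 2 \<subseteq> agd_rel"
begin

interpretation cooperad_in_free agd_ar C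
  by unfold_locales (rule C)

text \<open>The equations of \<open>R\<close> transported by \<open>coefs_bottom\<close>. The sign
  \<open>(-1) ^ weight a\<close> is the Koszul sign of moving \<open>a\<close> past the second
  vertex of the lower tree.\<close>

lemma coefs_relations:
  assumes "f \<in> coefs"
  shows "f (Mu2 (Mu2 a b) c) = - ((-1) ^ weight a * f (Mu2 a (Mu2 b c)))"
    and "f (Mu2 (Node H [a]) b) = - f (Node H [Mu2 a b])"
    and "f (Mu2 (Node Delta [a]) b) = - f (Node Delta [Mu2 a b])"
    and "(-1) ^ weight a * f (Mu2 a (Node H [b])) = - f (Node H [Mu2 a b]) - f (Node Delta [Mu2 a b])"
    and "f (Mu2 a (Node Delta [b])) = 0"
    and "f (Node g [Node g' [a]]) = 0"
proof -
  obtain y where y: "y \<in> C (length [a, b, c]) 2" "\<And>s. length [a, b, c] = leaves s \<Longrightarrow>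
      weight s = 2 \<Longrightarrow> lkp y s = cut_sign s [a, b, c] * f (graft s [a, b, c])"
    by (rule coefs_bottom[OF assms, where ts = "[a, b, c]" and w = 2]) (rule that)
  have "y \<in> agd_rel" using y(1) C(2) by auto
  from agd_rel_coefs(1)[OF this]
  show "f (Mu2 (Mu2 a b) c) = - ((-1) ^ weight a * f (Mu2 a (Mu2 b c)))"
    by (simp add: y(2))
next
  obtain y where y: "y \<in> C (length [a, b]) 2" "\<And>s. length [a, b] = leaves s \<Longrightarrow>
      weight s = 2 \<Longrightarrow> lkp y s = cut_sign s [a, b] * f (graft s [a, b])"
    by (rule coefs_bottom[OF assms, where ts = "[a, b]" and w = 2]) (rule that)
  have "y \<in> agd_rel" using y(1) C(2) by auto
  from agd_rel_coefs(2-5)[OF this]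
  show "f (Mu2 (Node H [a]) b) = - f (Node H [Mu2 a b])"
    and "f (Mu2 (Node Delta [a]) b) = - f (Node Delta [Mu2 a b])"
    and "(-1) ^ weight a * f (Mu2 a (Node H [b])) = - f (Node H [Mu2 a b]) - f (Node Delta [Mu2 a b])"
    and "f (Mu2 a (Node Delta [b])) = 0"
    by (simp_all add: y(2))
next
  obtain y where y: "y \<in> C (length [a]) 2" "\<And>s. length [a] = leaves s \<Longrightarrow>
      weight s = 2 \<Longrightarrow> lkp y s = cut_sign s [a] * f (graft s [a])"
    by (rule coefs_bottom[OF assms, where ts = "[a]" and w = 2]) (rule that)
  have "y \<in> agd_rel" using y(1) C(2) by auto
  from agd_rel_coefs(6)[OF this, of g g'] show "f (Node g [Node g' [a]]) = 0"
    by (simp add: y(2))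
qed

end

section \<open>Rewriting coefficients to combs\<close>

fun rcomb :: "nat \<Rightarrow> agd_gen tree" where
  "rcomb 0 = Leaf"
| "rcomb (Suc k) = Mu2 Leaf (rcomb k)"

text \<open>A dual basis for the classes: on \<open>ncomb c k\<close>, which has
  \<open>k + 1\<close> leaves, the class of index \<open>c\<close> and that arity has coefficient 1,
  the other two have 0.\<close>

definition ncomb :: "agd_gen \<Rightarrow> nat \<Rightarrow> agd_gen tree" where
  "ncomb c k = (if c = Mu then rcomb k else Node c [rcomb k])"

inductive_set contexts :: "(agd_gen tree \<Rightarrow> agd_gen tree) set" where
  hole: "(\<lambda>t. t) \<in> contexts"
| unary: "X \<in> contexts \<Longrightarrow> g \<noteq> Mu \<Longrightarrow> (\<lambda>t. Node g [X t]) \<in> contexts"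
| left: "X \<in> contexts \<Longrightarrow> (\<lambda>t. Mu2 (X t) b) \<in> contexts"
| right: "X \<in> contexts \<Longrightarrow> (\<lambda>t. Mu2 a (X t)) \<in> contexts"

text \<open>A measure that decreases when products are reassociated to the right and unary vertices are moved
  towards the root.\<close>

fun meas :: "agd_gen tree \<Rightarrow> nat" where
  "meas (Node Mu [a, b]) = meas a ^ 2 * meas b"
| "meas (Node g [a]) = Suc (meas a)"
| "meas _ = 2"

lemma meas_ge_2: "2 \<le> meas t"
proof (induction t rule: meas.induct)
  case (1 a b)
  have "2 * 1 \<le> meas b * meas a ^ 2"
    using 1 by (intro mult_mono) auto
  then show ?case by (simp add: mult.commute)
qed auto

lemma meas_context: "X \<in> contexts \<Longrightarrow> meas s < meas s' \<Longrightarrow> meas (X s) < meas (X s')"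
proof (induction rule: contexts.induct)
  case (unary X g)
  then show ?case by (cases g) auto
next
  case (left X b)
  have "0 < meas b" using meas_ge_2[of b] by simp
  then show ?case using left by (simp add: power_strict_mono)
next
  case (right X a)
  have "0 < meas a" using meas_ge_2[of a] by simp
  then show ?case using right by simp
qed simp

text \<open>Writing \<open>a\<close>, \<open>b\<close>, \<open>c\<close> for the measures, all at
  least 2, reassociation lowers \<open>a^4 * b^2 * c\<close> to \<open>a^2 * b^2 * c\<close>. A
  unary vertex adds 1 on top of a product, but more than 1 when it sits on a factor.\<close>

lemma meas_rules:
  "meas (Mu2 a (Mu2 b c)) < meas (Mu2 (Mu2 a b) c)"
  "g \<noteq> Mu \<Longrightarrow> g' \<noteq> Mu \<Longrightarrow> meas (Node g [Mu2 a b]) < meas (Mu2 (Node g' [a]) b)"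
  "g \<noteq> Mu \<Longrightarrow> g' \<noteq> Mu \<Longrightarrow> meas (Node g [Mu2 a b]) < meas (Mu2 a (Node g' [b]))"
proof -
  have ge: "2 \<le> meas a" "2 \<le> meas b" "2 \<le> meas c"
    by (rule meas_ge_2)+
  let ?P = "(meas a)\<^sup>2 * ((meas b)\<^sup>2 * meas c)"
  have "1 < (meas a)\<^sup>2"
    using ge(1) by (intro one_less_power) simp_all
  then have "?P * 1 < ?P * (meas a)\<^sup>2"
    using ge by (intro mult_strict_left_mono) auto
  then show "meas (Mu2 a (Mu2 b c)) < meas (Mu2 (Mu2 a b) c)"
    by (simp add: power_mult_distrib power2_eq_square mult_ac)
  obtain x y where eq: "meas a = x + 2" "meas b = y + 2"
    using ge by (metis le_add_diff_inverse2)
  show "g \<noteq> Mu \<Longrightarrow> g' \<noteq> Mu \<Longrightarrow> meas (Node g [Mu2 a b]) < meas (Mu2 (Node g' [a]) b)"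
    by (cases g; cases g') (simp_all add: eq power2_eq_square algebra_simps)
  show "g \<noteq> Mu \<Longrightarrow> g' \<noteq> Mu \<Longrightarrow> meas (Node g [Mu2 a b]) < meas (Mu2 a (Node g' [b]))"
    by (cases g; cases g') (simp_all add: eq power2_eq_square algebra_simps)
qed

text \<open>The trees at which \<open>coefs_relations\<close> expresses the coefficient by smaller
  trees or makes it vanish.\<close>

inductive redex :: "agd_gen tree \<Rightarrow> bool" where
  "redex (Mu2 (Mu2 a b) c)"
| "g \<noteq> Mu \<Longrightarrow> redex (Mu2 (Node g [a]) b)"
| "g \<noteq> Mu \<Longrightarrow> redex (Mu2 a (Node g [b]))"
| "g \<noteq> Mu \<Longrightarrow> g' \<noteq> Mu \<Longrightarrow> redex (Node g [Node g' [a]])"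

text \<open>Without a redex a product has no product on the left and no unary child, so products
  form right combs; a unary vertex has no unary child either and can only be the root.\<close>

lemma ncomb_or_redex:
  "wf_tree agd_ar t \<Longrightarrow> (\<exists>c k. t = ncomb c k) \<or> (\<exists>X s. X \<in> contexts \<and> redex s \<and> t = X s)"
proof (induction t)
  case Leaf
  have "Leaf = ncomb Mu 0" by (simp add: ncomb_def)
  then show ?case by blast
next
  case (Node g ts)
  show ?case
  proof (cases "g = Mu")
    case False
    then obtain u where ts: "ts = [u]"
      using Node.prems by (cases g) (auto simp: length_Suc_conv)
    then have "(\<exists>c k. u = ncomb c k) \<or> (\<exists>X s. X \<in> contexts \<and> redex s \<and> u = X s)"
      using Node by simp
    then show ?thesis
    proof (elim disjE exE conjE)
      fix c k assume u: "u = ncomb c k"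
      show ?thesis
      proof (cases "c = Mu")
        case True
        then have "Node g ts = ncomb g k" using False ts u by (simp add: ncomb_def)
        then show ?thesis by blast
      next
        case c: False
        have "redex (Node g ts)"
          using redex.intros(4)[OF False c, of "rcomb k"] c ts u by (simp add: ncomb_def)
        then show ?thesis using contexts.hole by blast
      qed
    next
      fix X s assume X: "X \<in> contexts" "redex s" "u = X s"
      then show ?thesis using contexts.unary[OF X(1) False] ts by fast
    qed
  next
    case True
    then obtain a b where ts: "ts = [a, b]"
      using Node.prems by (auto simp: length_Suc_conv numeral_2_eq_2)
    then have IH: "(\<exists>c k. a = ncomb c k) \<or> (\<exists>X s. X \<in> contexts \<and> redex s \<and> a = X s)"
      "(\<exists>c k. b = ncomb c k) \<or> (\<exists>X s. X \<in> contexts \<and> redex s \<and> b = X s)"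
      using Node by auto
    show ?thesis
    proof (cases "(\<exists>X s. X \<in> contexts \<and> redex s \<and> a = X s) \<or> (\<exists>X s. X \<in> contexts \<and> redex s \<and> b = X s)")
      case ex: True
      then show ?thesis
        unfolding ts True using contexts.left contexts.right by fast
    next
      case False
      then obtain c k c' k' where ab: "a = ncomb c k" "b = ncomb c' k'"
        using IH by blast
      consider "c \<noteq> Mu" | "c' \<noteq> Mu" | "c = Mu" "c' = Mu" "k = 0" | j where "c = Mu" "k = Suc j"
        by (cases k) auto
      then show ?thesis
      proof cases
        case 1
        then have "redex (Node g ts)"
          unfolding True ts ab ncomb_def[of c] by (simp add: redex.intros)
        then show ?thesis using contexts.hole by blast
      next
        case 2
        then have "redex (Node g ts)"
          unfolding True ts ab ncomb_def[of c'] by (simp add: redex.intros)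
        then show ?thesis using contexts.hole by blast
      next
        case 3
        then have "Node g ts = ncomb Mu (Suc k')"
          unfolding True ts ab by (simp add: ncomb_def)
        then show ?thesis by blast
      next
        case 4
        then have "redex (Node g ts)"
          unfolding True ts ab by (simp add: ncomb_def redex.intros)
        then show ?thesis using contexts.hole by blast
      qed
    qed
  qed
qed

context
  fixes C :: "nat \<Rightarrow> nat \<Rightarrow> (agd_gen tree \<Rightarrow>\<^sub>0 'k::field) set"
  assumes C: "sub_cooperad agd_ar C" "\<And>m. C m 2 \<subseteq> agd_rel"
begin

interpretation cooperad_in_free agd_ar C
  by unfold_locales (rule C)

lemma coefs_context: "X \<in> contexts \<Longrightarrow> f \<in> coefs \<Longrightarrow> (\<lambda>t. f (X t)) \<in> coefs"
proof (induction arbitrary: f rule: contexts.induct)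
  case (unary X g)
  then show ?case using coefs_Node[of f g "[]" "[]"] by simp
next
  case (left X b)
  then show ?case using coefs_Node[of f Mu "[]" "[b]"] by simp
next
  case (right X a)
  then show ?case using coefs_Node[of f Mu "[a]" "[]"] by simp
qed simp

text \<open>Induction on \<open>meas\<close>: at a redex the coefficient is a combination of
  coefficients at smaller trees, or zero. This is the upper bound on the dual cooperad.\<close>

lemma coefs_vanish:
  assumes f: "f \<in> coefs" and comb: "\<And>c k. f (ncomb c k) = 0"
  shows "f t = 0"
proof (induction t rule: measure_induct_rule[of meas])
  case (less t)
  show ?case
  proof (cases "wf_tree agd_ar t")
    case False
    obtain x n d where "x \<in> C n d" "f = lkp x" using f by (auto simp: coefs_def)
    then show ?thesis using False C_Free_w Free_w_lookup by blast
  next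
    case True
    consider c k where "t = ncomb c k" | X s where "X \<in> contexts" "redex s" "t = X s"
      using ncomb_or_redex[OF True] by blast
    then show ?thesis
    proof cases
      case 1
      then show ?thesis by (simp add: comb)
    next
      case 2
      have z: "f (X u) = 0" if "meas u < meas s" for u
        using less meas_context[OF 2(1) that] 2(3) by simp
      note rel = coefs_relations[OF C coefs_context[OF 2(1) f]]
      have sgn: "(-1) ^ n * x = 0 \<Longrightarrow> x = 0" for n and x :: 'k by simp
      have gd: "g = H \<or> g = Delta" if "g \<noteq> Mu" for g using that by (cases g) auto
      show ?thesis using 2(2)
      proof cases
        case (1 a b c)
        then show ?thesis using rel(1)[of a b c] z[of "Mu2 a (Mu2 b c)"] meas_rules(1) 2(3) by simp
      next
        case (2 g a b)
        then show ?thesis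
          using rel(2,3)[of a b] z[of "Node g [Mu2 a b]"] meas_rules(2)[of g g a b] \<open>t = X s\<close> gd[of g]
          by auto
      next
        case (3 g a b)
        \<comment> \<open>For \<open>g = H\<close> the coefficient is, up to sign, the sum of these
          two; for \<open>g = Delta\<close> it is zero by itself.\<close>
        have "f (X (Node H [Mu2 a b])) = 0" "f (X (Node Delta [Mu2 a b])) = 0"
          using z 3 meas_rules(3)[of _ g a b] by simp_all
        then show ?thesis
          using rel(4,5)[of a b] 3 \<open>t = X s\<close> gd[of g] by auto
      next
        case (4 g g' a)
        then show ?thesis using rel(6) \<open>t = X s\<close> by simp
      qed
    qed
  qed
qed

end

lemma ncomb_props [simp]:
  "leaves (rcomb k) = Suc k" "weight (rcomb k) = k" "acoef (rcomb k) = (1 :: 'k::field)"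
  "dcoef c (rcomb k) = (0 :: 'k)"
  "leaves (ncomb c k) = Suc k" "weight (ncomb c k) = dgr c (Suc k)"
  "ccoef c' (ncomb c k) = (if c' = c then 1 else (0 :: 'k))"
proof -
  show *: "leaves (rcomb k) = Suc k" "weight (rcomb k) = k" "acoef (rcomb k) = (1 :: 'k)"
    by (induction k) simp_all
  show **: "dcoef c (rcomb k) = (0 :: 'k)" for c
    by (induction k arbitrary: c) simp_all
  show "leaves (ncomb c k) = Suc k" "weight (ncomb c k) = dgr c (Suc k)"
    using * by (simp_all add: ncomb_def dgr_def)
  show "ccoef c' (ncomb c k) = (if c' = c then 1 else (0 :: 'k))"
    using * ** by (cases c; cases c') (auto simp: ncomb_def ccoef_def)
qed

lemma koszul_dual_eq:
  "koszul_dual agd_ar (agd_rel :: (agd_gen tree \<Rightarrow>\<^sub>0 'k::field) set) n d = cogs n d"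
proof
  let ?K = "koszul_dual agd_ar (agd_rel :: (agd_gen tree \<Rightarrow>\<^sub>0 'k) set)"
  have K: "sub_cooperad agd_ar ?K" "\<And>m. ?K m 2 \<subseteq> agd_rel"
    by (simp_all add: sub_cooperad_koszul_dual koszul_dual_2_subset agd_rel_def Let_def)
  show "?K n d \<subseteq> cogs n d"
  proof
    fix x assume x: "x \<in> ?K n d"
    \<comment> \<open>The combination of classes that agrees with \<open>x\<close> on all combs; the
      index \<open>n - 1\<close> is due to \<open>ncomb c k\<close> having \<open>k + 1\<close>
      leaves. The difference vanishes on combs, hence everywhere.\<close>
    define x' where "x' = (\<Sum>c | dgr c n = d. fscale (lkp x (ncomb c (n - 1))) (cog c n))"
    have fin: "finite {c. dgr c n = d}"
      using UNIV_agd_gen by (metis finite.emptyI finite.insertI finite_subset subset_UNIV)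
    have x': "x' \<in> cogs n d"
      unfolding x'_def cogs_def by (intro fs.span_sum fs.span_scale fs.span_base) auto
    have sK: "fs.subspace (?K n d)" by (simp add: koszul_dual_def)
    have y: "x - x' \<in> ?K n d"
      using x x' cogs_subset_koszul_dual by (intro fs.subspace_diff[OF sK]) blast+
    have yF: "x - x' \<in> Free_w agd_ar n d"
      using y K(1) by (auto simp: sub_cooperad_def)
    have "lkp (x - x') (ncomb c k) = 0" for c k
    proof (cases "Suc k = n \<and> dgr c n = d")
      case False
      then show ?thesis using Free_w_lookup[OF yF, of "ncomb c k"] by auto
    next
      case True
      have "lkp x' (ncomb c k) = (\<Sum>c' | dgr c' n = d. if c' = c then lkp x (ncomb c k) else 0)"
        unfolding x'_def lookup_sum
        using True by (intro sum.cong) (auto simp: lookup_fscale lookup_cog)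
      also have "\<dots> = lkp x (ncomb c k)"
        using fin True by simp
      finally show ?thesis by (simp add: lookup_minus)
    qed
    moreover have "lkp (x - x') \<in> cooperad_in_free.coefs ?K"
      unfolding cooperad_in_free.coefs_def[OF cooperad_in_free.intro[OF K(1)]] using y by blast
    ultimately have "lkp (x - x') t = 0" for t
      using coefs_vanish[OF K] by blast
    then have "x - x' = 0" by (intro poly_mapping_eqI) simp
    then show "x \<in> cogs n d" using x' by simp
  qed
qed (rule cogs_subset_koszul_dual)

section \<open>Normal forms in the operad\<close>

definition mul :: "('a list \<Rightarrow>\<^sub>0 'k) \<Rightarrow> ('a list \<Rightarrow>\<^sub>0 'k) \<Rightarrow> ('a list \<Rightarrow>\<^sub>0 'k::field)" where
  "mul = lift2 (\<lambda>u v. bas (u @ v))"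

text \<open>A monomial is a list of words, each a string of operators on one generator of the free
  algebra. Only the first word sees \<open>c\<close> itself, later ones see
  \<open>nxt c\<close>.\<close>

fun der_bas :: "agd_gen \<Rightarrow> agd_gen list list \<Rightarrow> (agd_gen list list \<Rightarrow>\<^sub>0 'k::field)" where
  "der_bas c [] = 0"
| "der_bas c (w # v) = bas ((c # w) # v) + lift (\<lambda>v'. bas (w # v')) (der_bas (nxt c) v)"

abbreviation der :: "agd_gen \<Rightarrow> (agd_gen list list \<Rightarrow>\<^sub>0 'k) \<Rightarrow> (agd_gen list list \<Rightarrow>\<^sub>0 'k::field)" where
  "der c \<equiv> lift (der_bas c)"

lemma mul_assoc: "mul (mul x y) z = mul x (mul y z)"
  by (simp add: mul_def lift2_def lift_lift)

lemma der_bas_append: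
  "u \<noteq> [] \<Longrightarrow> der_bas c (u @ v) = lift (\<lambda>u'. bas (u' @ v)) (der_bas c u) +
     (lift (\<lambda>v'. bas (u @ v')) (der_bas (nxt c) v) :: _ \<Rightarrow>\<^sub>0 'k::field)"
proof (induction u arbitrary: c)
  case (Cons w u)
  show ?case
  proof (cases "u = []")
    case False
    then show ?thesis using Cons.IH[OF False, of "nxt c"]
      by (simp add: lift_linear lift_lift)
  qed (simp add: lift_linear)
qed simp

text \<open>The empty monomial must be excluded: for it the left side is \<open>der c y\<close>,
  while the right side has \<open>der (nxt c) y\<close>. This is the source of all conditions on
  nonempty support.\<close>

lemma der_mul:
  assumes "[] \<notin> Poly_Mapping.keys x"
  shows "der c (mul x y) = mul (der c x) y + mul x (der (nxt c) y)"
proof -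
  have "der c (mul x y) = lift (\<lambda>u. lift (\<lambda>v. der_bas c (u @ v)) y) x"
    by (simp add: mul_def lift2_def lift_lift)
  also have "\<dots> = lift (\<lambda>u. lift (\<lambda>v. lift (\<lambda>u'. bas (u' @ v)) (der_bas c u) +
     lift (\<lambda>v'. bas (u @ v')) (der_bas (nxt c) v)) y) x"
    using assms by (intro lift_cong der_bas_append) auto
  also have "\<dots> = lift (\<lambda>u. lift (\<lambda>v. lift (\<lambda>u'. bas (u' @ v)) (der_bas c u)) y) x +
      lift (\<lambda>u. lift (\<lambda>v. lift (\<lambda>v'. bas (u @ v')) (der_bas (nxt c) v)) y) x"
    by (simp only: lift_fun_add)
  also have "(\<lambda>u. lift (\<lambda>v. lift (\<lambda>u'. bas (u' @ v)) (der_bas c u)) y) =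
      (\<lambda>u. lift (\<lambda>u'. lift (\<lambda>v. bas (u' @ v)) y) (der_bas c u))"
    by (rule ext) (rule lift_swap)
  also have "lift \<dots> x + lift (\<lambda>u. lift (\<lambda>v. lift (\<lambda>v'. bas (u @ v')) (der_bas (nxt c) v)) y) x =
      mul (der c x) y + mul x (der (nxt c) y)"
    by (simp only: mul_def lift2_def lift_lift)
  finally show ?thesis .
qed

section \<open>The free algebra as a representation of the operad\<close>

fun ev :: "agd_gen tree \<Rightarrow> (agd_gen list list \<Rightarrow>\<^sub>0 'k) list \<Rightarrow> (agd_gen list list \<Rightarrow>\<^sub>0 'k::field)" where
  "ev Leaf as = hd as"
| "ev (Node Mu [a, b]) as = mul (ev a (take (leaves a) as)) (ev b (drop (leaves a) as))"
| "ev (Node Mu []) as = 0"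
| "ev (Node Mu [a]) as = 0"
| "ev (Node Mu (a # b # d # ts)) as = 0"
| "ev (Node H []) as = 0"
| "ev (Node H [a]) as = der H (ev a as)"
| "ev (Node H (a # b # ts)) as = 0"
| "ev (Node Delta []) as = 0"
| "ev (Node Delta [a]) as = der Delta (ev a as)"
| "ev (Node Delta (a # b # ts)) as = 0"

fun evs :: "agd_gen tree list \<Rightarrow> (agd_gen list list \<Rightarrow>\<^sub>0 'k) list \<Rightarrow>
    (agd_gen list list \<Rightarrow>\<^sub>0 'k::field) list" where
  "evs [] as = []"
| "evs (t # ts) as = ev t (take (leaves t) as) # evs ts (drop (leaves t) as)"

lemma length_evs [simp]: "length (evs ts as) = length ts"
  by (induction ts arbitrary: as) simp_all

lemma evs_append: "evs (ts @ us) as = evs ts as @ evs us (drop (sum_list (map leaves ts)) as)"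
  by (induction ts arbitrary: as) (simp_all add: add.commute)

lemma evs_take: "evs ts (take (sum_list (map leaves ts)) as) = evs ts as"
  by (induction ts arbitrary: as) (simp_all add: drop_take)

lemma agd_tree_induct [case_names Leaf Mu2 Unary Other]:
  assumes "P Leaf" "\<And>a b. P a \<Longrightarrow> P b \<Longrightarrow> P (Mu2 a b)"
    "\<And>g a. g \<noteq> Mu \<Longrightarrow> P a \<Longrightarrow> P (Node g [a])"
    "\<And>g ts. length ts \<noteq> agd_ar g \<Longrightarrow> P (Node g ts)"
  shows "P t"
proof (induction t)
  case (Node g ts)
  show ?case
  proof (cases "length ts = agd_ar g")
    case True
    then consider a b where "g = Mu" "ts = [a, b]" | a where "g \<noteq> Mu" "ts = [a]"
      by (cases g) (auto simp: length_Suc_conv numeral_2_eq_2)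
    then show ?thesis using assms(2,3) Node by cases simp_all
  qed (rule assms(4))
qed (rule assms(1))

lemma ev_Unary: "g \<noteq> Mu \<Longrightarrow> ev (Node g [a]) as = der g (ev a as)"
  by (cases g) simp_all

lemma ev_Other: "length ts \<noteq> agd_ar g \<Longrightarrow> ev (Node g ts) as = 0"
  by (cases "(Node g ts, as)" rule: ev.cases) auto

text \<open>Grafting becomes composition of operations, so evaluation is an operad morphism to the
  endomorphism operad of the free algebra.\<close>

lemma ev_graft: "length ps = leaves t \<Longrightarrow> length as = sum_list (map leaves ps) \<Longrightarrow>
   ev (graft t ps) as = ev t (evs ps as)"
proof (induction t arbitrary: ps as rule: agd_tree_induct)
  case Leaf
  then show ?case by (cases ps) auto
next
  case (Mu2 a b)
  define ps1 where "ps1 = take (leaves a) ps"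
  define ps2 where "ps2 = drop (leaves a) ps"
  let ?l = "sum_list (map leaves ps1)"
  have ps: "ps = ps1 @ ps2" "length ps1 = leaves a" "length ps2 = leaves b"
    using Mu2(3) by (simp_all add: ps1_def ps2_def)
  have l: "leaves (graft a ps1) = ?l"
    using ps by (simp add: graft_leaves_weight)
  have "ev (graft a ps1) (take ?l as) = ev a (evs ps1 (take ?l as))"
    by (rule Mu2.IH) (use ps Mu2.prems in simp_all)
  moreover have "ev (graft b ps2) (drop ?l as) = ev b (evs ps2 (drop ?l as))"
    by (rule Mu2.IH) (use ps Mu2.prems in simp_all)
  ultimately show ?case
    using ps by (simp add: l evs_append evs_take)
next
  case (Unary g a)
  then show ?case by (simp add: ev_Unary)
next
  case (Other g ts)
  then show ?case by (simp add: ev_Other)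
qed

lemma evs_replicate_Leaf: "length as = k \<Longrightarrow> evs (replicate k Leaf) as = as"
proof (induction k arbitrary: as)
  case (Suc k)
  then show ?case by (cases as) auto
qed simp

lemma ev_pcomp_tree:
  assumes "length pre + Suc (length post) = leaves t" "length mid = leaves u"
  shows "ev (pcomp_tree t (Suc (length pre)) u) (pre @ mid @ post) = ev t (pre @ ev u mid # post)"
proof -
  have "leaves t - Suc (length pre) = length post" using assms(1) by simp
  then have "pcomp_tree t (Suc (length pre)) u =
      graft t (replicate (length pre) Leaf @ u # replicate (length post) Leaf)"
    by (simp add: pcomp_tree_def)
  also have "ev \<dots> (pre @ mid @ post) =
      ev t (evs (replicate (length pre) Leaf @ u # replicate (length post) Leaf) (pre @ mid @ post))"
    using assms by (intro ev_graft) (simp_all add: sum_list_replicate)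
  also have "evs (replicate (length pre) Leaf @ u # replicate (length post) Leaf) (pre @ mid @ post) =
      evs (replicate (length pre) Leaf) (take (sum_list (map leaves (replicate (length pre) (Leaf :: agd_gen tree)))) (pre @ mid @ post)) @
      ev u mid # post"
    unfolding evs_take using assms
    by (simp add: evs_append evs_replicate_Leaf sum_list_replicate)
  also have "\<dots> = pre @ ev u mid # post"
    by (simp add: sum_list_replicate evs_replicate_Leaf)
  finally show ?thesis .
qed

text \<open>Linearity in one slot; it is what makes a partial composite vanish when its upper factor
  lies in the kernel.\<close>

lemma ev_multilinear:
  "length pre + Suc (length post) = leaves t \<Longrightarrow>
     ev t (pre @ lift f z # post) = lift (\<lambda>a. ev t (pre @ f a # post)) z"
proof (induction t arbitrary: pre post rule: agd_tree_induct)
  case (Mu2 a b)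
  show ?case
  proof (cases "length pre < leaves a")
    case True
    let ?p = "take (leaves a - Suc (length pre)) post"
    have t: "take (leaves a) (pre @ x # post) = pre @ x # ?p" for x
      using True by (simp add: take_Cons')
    have d: "drop (leaves a) (pre @ x # post) = drop (leaves a - Suc (length pre)) post" for x
      using True by (simp add: drop_Cons')
    have "ev a (pre @ lift f z # ?p) = lift (\<lambda>x. ev a (pre @ f x # ?p)) z"
      by (rule Mu2.IH) (use True Mu2.prems in auto)
    then show ?thesis
      by (simp only: ev.simps t d mul_def lift2_linear_left)
  next
    case False
    let ?p = "drop (leaves a) pre"
    have t: "take (leaves a) (pre @ x # post) = take (leaves a) pre" for x
      using False by simp
    have d: "drop (leaves a) (pre @ x # post) = ?p @ x # post" for x
      using False by simp
    have "ev b (?p @ lift f z # post) = lift (\<lambda>x. ev b (?p @ f x # post)) z"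
      by (rule Mu2.IH) (use False Mu2.prems in auto)
    then show ?thesis
      by (simp only: ev.simps t d mul_def lift2_linear_right)
  qed
next
  case (Unary g a)
  then show ?case by (simp add: ev_Unary lift_lift)
next
  case (Other g ts)
  then show ?case by (simp add: ev_Other)
qed simp

text \<open>A monomial is a product of words in \<open>h\<close> and \<open>\<delta>\<close> applied to consecutive inputs.\<close>

definition monoms :: "nat \<Rightarrow> agd_gen list list set" where
  "monoms n = {m. m \<noteq> [] \<and> length m = n \<and> (\<forall>w\<in>set m. Mu \<notin> set w)}"

definition supp_in :: "'a set \<Rightarrow> ('a \<Rightarrow>\<^sub>0 'k::zero) \<Rightarrow> bool" where
  "supp_in A x \<longleftrightarrow> Poly_Mapping.keys x \<subseteq> A"

lemma supp_in_lift:
  "supp_in A x \<Longrightarrow> (\<And>a. a \<in> A \<Longrightarrow> supp_in B (f a)) \<Longrightarrow> supp_in B (lift f x)"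
  unfolding supp_in_def using keys_lift[of f x] by blast

lemma supp_in_bas: "a \<in> A \<Longrightarrow> supp_in A (bas a)"
  by (simp add: supp_in_def)

lemma supp_in_zero [simp]: "supp_in A 0"
  by (simp add: supp_in_def)

lemma supp_in_add: "supp_in A x \<Longrightarrow> supp_in A y \<Longrightarrow> supp_in A (x + y)"
  unfolding supp_in_def using Poly_Mapping.keys_add[of x y] by blast

lemma supp_in_mul:
  assumes "supp_in A x" "supp_in B y" "\<And>u v. u \<in> A \<Longrightarrow> v \<in> B \<Longrightarrow> u @ v \<in> D"
  shows "supp_in D (mul x y)"
  unfolding mul_def lift2_def using assms
  by (intro supp_in_lift[OF assms(1)] supp_in_lift[OF assms(2)] supp_in_bas)

lemma der_bas_nonempty: "supp_in {m. m \<noteq> []} (der_bas c m :: _ \<Rightarrow>\<^sub>0 'k::field)"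
  by (cases m) (auto intro!: supp_in_add supp_in_bas supp_in_lift[of UNIV] simp: supp_in_def[of UNIV])

lemma der_bas_monoms:
  "c \<noteq> Mu \<Longrightarrow> m \<in> monoms n \<Longrightarrow>
     supp_in (monoms n) (der_bas c m :: _ \<Rightarrow>\<^sub>0 'k::field)"
proof (induction m arbitrary: c n)
  case (Cons w v)
  have 1: "(c # w) # v \<in> monoms n"
    using Cons.prems by (auto simp: monoms_def)
  have 2: "supp_in (monoms n) (lift (\<lambda>v'. bas (w # v')) (der_bas (nxt c) v) :: _ \<Rightarrow>\<^sub>0 'k)"
  proof (cases "v = []")
    case False
    then have v: "v \<in> monoms (n - 1)" using Cons.prems by (auto simp: monoms_def)
    have "supp_in (monoms (n - 1)) (der_bas (nxt c) v :: _ \<Rightarrow>\<^sub>0 'k)"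
      by (rule Cons.IH) (use Cons.prems v in simp_all)
    then show ?thesis
      by (rule supp_in_lift) (use Cons.prems in \<open>auto intro!: supp_in_bas simp: monoms_def\<close>)
  qed simp
  show ?case using 1 2 by (simp add: supp_in_add supp_in_bas)
qed (simp add: monoms_def)

abbreviation nonempty_supp :: "('a list \<Rightarrow>\<^sub>0 'k::zero) \<Rightarrow> bool" where
  "nonempty_supp \<equiv> supp_in {m. m \<noteq> []}"

lemma ev_nonempty:
  "length as = leaves t \<Longrightarrow> \<forall>a\<in>set as. nonempty_supp a \<Longrightarrow> nonempty_supp (ev t as)"
proof (induction t arbitrary: as rule: agd_tree_induct)
  case Leaf
  then show ?case by (cases as) auto
next
  case (Mu2 a b)
  have "nonempty_supp (ev a (take (leaves a) as))"
    by (rule Mu2.IH) (use Mu2.prems in \<open>auto dest: in_set_takeD\<close>)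
  moreover have "nonempty_supp (ev b (drop (leaves a) as))"
    by (rule Mu2.IH) (use Mu2.prems in \<open>auto dest: in_set_dropD\<close>)
  ultimately show ?case by (auto intro: supp_in_mul)
next
  case (Unary g a)
  then show ?case
    by (auto simp: ev_Unary intro: supp_in_lift der_bas_nonempty)
next
  case (Other g ts)
  then show ?case by (simp add: ev_Other)
qed

text \<open>The kernel of the operad morphism to the endomorphism operad of the nonunital free algebra.\<close>

definition ev_kernel :: "nat \<Rightarrow> (agd_gen tree \<Rightarrow>\<^sub>0 'k::field) set" where
  "ev_kernel n = {x \<in> Free agd_ar n. \<forall>as. length as = n \<longrightarrow> (\<forall>a\<in>set as. nonempty_supp a) \<longrightarrow>
     lift (\<lambda>t. ev t as) x = 0}"

lemma Free_eq_span:
  "(Free ar n :: ('a tree \<Rightarrow>\<^sub>0 'k::field) set) = fs.span {bas t | t. wf_tree ar t \<and> leaves t = n}"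
proof
  show "(Free ar n :: ('a tree \<Rightarrow>\<^sub>0 'k) set) \<subseteq> fs.span {bas t | t. wf_tree ar t \<and> leaves t = n}"
  proof
    fix x :: "'a tree \<Rightarrow>\<^sub>0 'k" assume "x \<in> Free ar n"
    then have "lift bas x \<in> fs.span {bas t | t. wf_tree ar t \<and> leaves t = n}"
      by (intro lift_in_subspace fs.subspace_span fs.span_base) (auto simp: Free_def)
    then show "x \<in> fs.span {bas t | t. wf_tree ar t \<and> leaves t = n}" by simp
  qed
  show "fs.span {bas t | t. wf_tree ar t \<and> leaves t = n} \<subseteq> (Free ar n :: ('a tree \<Rightarrow>\<^sub>0 'k) set)"
  proof
    fix x :: "'a tree \<Rightarrow>\<^sub>0 'k" assume "x \<in> fs.span {bas t | t. wf_tree ar t \<and> leaves t = n}"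
    then show "x \<in> Free ar n"
    proof (induction rule: fs.span_induct_alt)
      case (step c s y)
      then obtain t where "s = bas t" "wf_tree ar t" "leaves t = n" by blast
      then show ?case using step(2) Poly_Mapping.keys_add[of "fscale c s" y]
        by (auto simp: Free_def in_keys_iff lookup_add lookup_fscale lookup_single when_def
            split: if_splits)
    qed (simp add: Free_def)
  qed
qed

lemma Free_subspace: "fs.subspace (Free ar n)"
  by (simp add: Free_eq_span)

lemma bas_Free: "wf_tree ar t \<Longrightarrow> leaves t = n \<Longrightarrow> bas t \<in> Free ar n"
  by (simp add: Free_def)

lemma supp_in_Free: "supp_in {t. wf_tree ar t \<and> leaves t = n} x \<longleftrightarrow> x \<in> Free ar n"
  by (auto simp: supp_in_def Free_def)

lemma pcomp_tree_wf:
  assumes "wf_tree ar t" "wf_tree ar u" "1 \<le> i" "i \<le> leaves t"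
  shows "wf_tree ar (pcomp_tree t i u) \<and> leaves (pcomp_tree t i u) = leaves t + leaves u - 1"
proof -
  have "length (replicate (i - 1) Leaf @ u # replicate (leaves t - i) Leaf) = leaves t"
    using assms by simp
  then show ?thesis
    using assms unfolding pcomp_tree_def
    by (auto simp: graft_leaves_weight sum_list_replicate list_all_iff intro!: wf_graft)
qed

lemma pcomp_Free:
  assumes "x \<in> Free ar m" "y \<in> Free ar n" "1 \<le> i" "i \<le> m"
  shows "pcomp x i y \<in> Free ar (m + n - 1)"
  unfolding pcomp_def using assms pcomp_tree_wf[of ar _ _ i]
  by (intro lift2_in_subspace Free_subspace bas_Free) (auto simp: Free_def)

lemma operadic_ideal_Free: "operadic_ideal ar (Free ar)"
  unfolding operadic_ideal_def using Free_subspace pcomp_Free by blast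

text \<open>Kernels of operad morphisms are ideals. Restricting to inputs of nonempty support, as
  the Leibniz rule requires, does no harm, since evaluation preserves that condition.\<close>

lemma operadic_ideal_ev_kernel: "operadic_ideal agd_ar ev_kernel"
  unfolding operadic_ideal_def
proof (intro conjI allI impI)
  fix n
  show "fs.subspace (ev_kernel n)"
    using Free_subspace[of agd_ar n]
    unfolding fs.subspace_def ev_kernel_def by (auto simp: lift_linear)
  show "ev_kernel n \<subseteq> Free agd_ar n"
    by (auto simp: ev_kernel_def)
next
  fix m n i and x y :: "agd_gen tree \<Rightarrow>\<^sub>0 'k::field"
  assume x: "x \<in> Free agd_ar m" and y: "y \<in> Free agd_ar n" and i: "1 \<le> i" "i \<le> m"
    and or: "x \<in> ev_kernel m \<or> y \<in> ev_kernel n"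
  have "lift (\<lambda>t. ev t as) (pcomp x i y) = 0"
    if as: "length as = m + n - 1" "\<forall>a\<in>set as. nonempty_supp a" for as
  proof -
    define pre where "pre = take (i - 1) as"
    define mid where "mid = take n (drop (i - 1) as)"
    define post where "post = drop (i - 1 + n) as"
    have eq: "as = pre @ mid @ post"
      unfolding pre_def mid_def post_def by (metis append_take_drop_id drop_drop add.commute)
    have len: "length pre = i - 1" "length mid = n" "length pre + Suc (length post) = m"
      using as(1) i by (auto simp: pre_def mid_def post_def)
    have supp: "\<forall>a\<in>set pre \<union> set mid \<union> set post. nonempty_supp a"
      using as(2) by (auto simp: eq)
    have "lift (\<lambda>t. ev t as) (pcomp x i y) = lift (\<lambda>t. lift (\<lambda>u. ev (pcomp_tree t i u) as) y) x"
      by (simp add: pcomp_def lift2_def lift_lift)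
    also have "\<dots> = lift (\<lambda>t. lift (\<lambda>u. ev t (pre @ ev u mid # post)) y) x"
    proof (intro lift_cong)
      fix t u assume "t \<in> Poly_Mapping.keys x" "u \<in> Poly_Mapping.keys y"
      then have "leaves t = m" "leaves u = n" using x y by (auto simp: Free_def)
      then show "ev (pcomp_tree t i u) as = ev t (pre @ ev u mid # post)"
        using ev_pcomp_tree[of pre post t mid u] len i by (simp add: eq)
    qed
    also have "\<dots> = 0"
    proof (cases "x \<in> ev_kernel m")
      case True
      have "lift (\<lambda>t. ev t (pre @ ev u mid # post)) x = 0" if "u \<in> Poly_Mapping.keys y" for u
      proof -
        have "leaves u = n" using y that by (auto simp: Free_def)
        then have "nonempty_supp (ev u mid)" using len supp by (intro ev_nonempty) auto
        then have "\<forall>a\<in>set (pre @ ev u mid # post). nonempty_supp a" "length (pre @ ev u mid # post) = m"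
          using len supp by auto
        then show ?thesis using True unfolding ev_kernel_def by blast
      qed
      then have "lift (\<lambda>u. lift (\<lambda>t. ev t (pre @ ev u mid # post)) x) y = lift (\<lambda>u. 0) y"
        by (intro lift_cong)
      then show ?thesis by (subst lift_swap) simp
    next
      case False
      then have z: "lift (\<lambda>u. ev u mid) y = 0"
        using or len supp by (auto simp: ev_kernel_def)
      have "lift (\<lambda>u. ev t (pre @ ev u mid # post)) y = 0" if "t \<in> Poly_Mapping.keys x" for t
      proof -
        have l: "length pre + Suc (length post) = leaves t"
          using x that len by (auto simp: Free_def)
        have "lift (\<lambda>u. ev t (pre @ ev u mid # post)) y = ev t (pre @ lift (\<lambda>u. ev u mid) y # post)"
          by (rule ev_multilinear[OF l, symmetric])
        \<comment> \<open>Zero is viewed as a linear extension, so that multilinearity applies to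
          the slot holding it.\<close>
        also have "\<dots> = ev t (pre @ lift (\<lambda>a. a) 0 # post)" by (simp add: z)
        also have "\<dots> = 0"
          using ev_multilinear[OF l, of "\<lambda>a :: agd_gen list list. 0" 0]
          by (simp add: z)
        finally show ?thesis .
      qed
      then have "lift (\<lambda>t. lift (\<lambda>u. ev t (pre @ ev u mid # post)) y) x = lift (\<lambda>t. 0) x"
        by (intro lift_cong)
      then show ?thesis by simp
    qed
    finally show ?thesis .
  qed
  then show "pcomp x i y \<in> ev_kernel (m + n - 1)"
    using pcomp_Free[OF x y i] by (simp add: ev_kernel_def)
qed

lemma ev_agd_rel:
  assumes "x \<in> agd_rel" "as \<noteq> []" "\<forall>a\<in>set as. nonempty_supp (a :: _ \<Rightarrow>\<^sub>0 'k::field)"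
  shows "lift (\<lambda>t. ev t as) x = 0"
proof -
  obtain a bs where as: "as = a # bs" using assms(2) by (cases as) auto
  have take1: "hd (take (Suc 0) cs) = hd cs" for cs :: "'b list"
    by (cases cs) simp_all
  have ev: "ev (Mu2 (Mu2 Leaf Leaf) Leaf) as = mul (mul a (hd bs)) (hd (drop (Suc 0) bs))"
    "ev (Mu2 Leaf (Mu2 Leaf Leaf)) as = mul a (mul (hd bs) (hd (drop (Suc 0) bs)))"
    "g \<noteq> Mu \<Longrightarrow> ev (Node g [Mu2 Leaf Leaf]) as = der g (mul a (hd bs))"
    "g \<noteq> Mu \<Longrightarrow> ev (Mu2 (Node g [Leaf]) Leaf) as = mul (der g a) (hd bs)"
    "g \<noteq> Mu \<Longrightarrow> ev (Mu2 Leaf (Node g [Leaf])) as = mul a (der g (hd bs))" for g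
    by (simp_all add: as take1 ev_Unary)
  have "[] \<notin> Poly_Mapping.keys a" using assms(3) as by (auto simp: supp_in_def)
  then have dm: "der g (mul a y) = mul (der g a) y + mul a (der (nxt g) y)" for g y
    by (rule der_mul)
  have "lift (\<lambda>t. ev t as) x = lift (\<lambda>t. 0) x"
    using assms(1) unfolding agd_rel_eq
  proof (rule span_eq_on)
    fix s assume s: "s \<in> {bas (Mu2 (Mu2 Leaf Leaf) Leaf) - bas (Mu2 Leaf (Mu2 Leaf Leaf)),
      bas (Node H [Mu2 Leaf Leaf]) - bas (Mu2 (Node H [Leaf]) Leaf) - bas (Mu2 Leaf (Node H [Leaf])),
      bas (Node Delta [Mu2 Leaf Leaf]) - bas (Mu2 (Node Delta [Leaf]) Leaf) -
        bas (Mu2 Leaf (Node H [Leaf])) :: _ \<Rightarrow>\<^sub>0 'k}"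
    show "lift (\<lambda>t. ev t as) s = lift (\<lambda>t. 0) s"
      using s by (elim insertE emptyE) (simp_all add: lift_diff ev dm mul_assoc del: ev.simps)
  qed
  then show ?thesis by simp
qed

lemma agd_rel_subset_ev_kernel: "agd_rel \<inter> Free agd_ar n \<subseteq> (ev_kernel n :: (_ \<Rightarrow>\<^sub>0 'k::field) set)"
proof
  fix x :: "_ \<Rightarrow>\<^sub>0 'k" assume x: "x \<in> agd_rel \<inter> Free agd_ar n"
  have "lift (\<lambda>t. ev t as) x = 0" if "length as = n" "\<forall>a\<in>set as. nonempty_supp a" for as
  proof (cases "n = 0")
    case True
    have "Poly_Mapping.keys x = {}"
      using x leaves_pos[of agd_ar] True by (fastforce simp: Free_def)
    then show ?thesis by simp
  next
    case False
    then show ?thesis using x that by (intro ev_agd_rel) auto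
  qed
  then show "x \<in> ev_kernel n" using x by (simp add: ev_kernel_def)
qed

text \<open>Here \<open>[[]]\<close> is a single generator with no operator applied, not the empty
  monomial. Equal inputs suffice, because the order of the words in a monomial records the
  slots.\<close>

definition nform :: "agd_gen tree \<Rightarrow> (agd_gen list list \<Rightarrow>\<^sub>0 'k::field)" where
  "nform t = ev t (replicate (leaves t) (bas [[]]))"

lemma nform_simps [simp]:
  "nform Leaf = bas [[]]"
  "nform (Mu2 a b) = mul (nform a) (nform b)"
  "g \<noteq> Mu \<Longrightarrow> nform (Node g [a]) = der g (nform a)"
  by (simp_all add: nform_def ev_Unary)

lemma nform_ideal:
  assumes "x \<in> ideal_gen agd_ar agd_rel n"
  shows "lift nform x = (0 :: _ \<Rightarrow>\<^sub>0 'k::field)"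
proof -
  have x: "x \<in> ev_kernel n"
    using assms operadic_ideal_ev_kernel agd_rel_subset_ev_kernel unfolding ideal_gen_def by blast
  have "lift nform x = lift (\<lambda>t. ev t (replicate n (bas [[]]))) x"
    using x by (intro lift_cong) (auto simp: nform_def ev_kernel_def Free_def)
  also have "\<dots> = 0"
    using x by (auto simp: ev_kernel_def supp_in_bas)
  finally show ?thesis .
qed

fun wtree :: "agd_gen list \<Rightarrow> agd_gen tree" where
  "wtree [] = Leaf"
| "wtree (c # w) = Node c [wtree w]"

text \<open>The right-bracketed representative of a monomial; the value at \<open>[]\<close> is a
  default, as monomials are nonempty.\<close>

fun nftree :: "agd_gen list list \<Rightarrow> agd_gen tree" where
  "nftree [] = Leaf"
| "nftree [w] = wtree w"
| "nftree (w # v # vs) = Mu2 (wtree w) (nftree (v # vs))"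

abbreviation J :: "nat \<Rightarrow> (agd_gen tree \<Rightarrow>\<^sub>0 'k::field) set" where
  "J \<equiv> ideal_gen agd_ar agd_rel"

text \<open>\<open>Free ar\<close> is itself an ideal containing the relations, so the intersection
  runs over a nonempty family and stays inside the free operad.\<close>

lemma operadic_ideal_ideal_gen:
  "operadic_ideal ar (ideal_gen ar (R :: ('g tree \<Rightarrow>\<^sub>0 'k::field) set))"
proof -
  let ?S = "\<lambda>I. operadic_ideal ar I \<and> (\<forall>m. R \<inter> Free ar m \<subseteq> I m)"
  have "?S (Free ar)" using operadic_ideal_Free by blast
  then have "ideal_gen ar R n \<subseteq> Free ar n" for n unfolding ideal_gen_def by blast
  moreover have "fs.subspace (ideal_gen ar R n)" for n
    unfolding ideal_gen_def by (rule fs.subspace_Inter) (auto simp: operadic_ideal_def)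
  moreover have "pcomp x i y \<in> ideal_gen ar R (m + n - 1)"
    if "x \<in> Free ar m" "y \<in> Free ar n" "1 \<le> i" "i \<le> m"
      "x \<in> ideal_gen ar R m \<or> y \<in> ideal_gen ar R n" for x y i m n
    unfolding ideal_gen_def
  proof (safe)
    fix I assume I: "operadic_ideal ar I" "\<forall>m. R \<inter> Free ar m \<subseteq> I m"
    then have "x \<in> I m \<or> y \<in> I n" using that(5) unfolding ideal_gen_def by blast
    then show "pcomp x i y \<in> I (m + n - 1)"
      using I(1) that(1-4) unfolding operadic_ideal_def by blast
  qed
  ultimately show ?thesis unfolding operadic_ideal_def by blast
qed

lemma ideal_gen_superset: "R \<inter> Free ar m \<subseteq> ideal_gen ar R m"
  unfolding ideal_gen_def by blast

lemma J_subspace: "fs.subspace (J n :: (_ \<Rightarrow>\<^sub>0 'k::field) set)"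
  and J_Free: "J n \<subseteq> (Free agd_ar n :: (_ \<Rightarrow>\<^sub>0 'k::field) set)"
  using operadic_ideal_ideal_gen[of agd_ar agd_rel] unfolding operadic_ideal_def by blast+

lemma J_pcomp_left:
  "x \<in> J m \<Longrightarrow> wf_tree agd_ar u \<Longrightarrow> 1 \<le> i \<Longrightarrow> i \<le> m \<Longrightarrow> n = m + leaves u - 1 \<Longrightarrow> pcomp x i (bas u) \<in> J n"
  using operadic_ideal_ideal_gen[of agd_ar agd_rel] J_Free bas_Free[OF _ refl, of agd_ar u]
  unfolding operadic_ideal_def by blast

lemma J_pcomp_right:
  "y \<in> J m \<Longrightarrow> wf_tree agd_ar t \<Longrightarrow> 1 \<le> i \<Longrightarrow> i \<le> leaves t \<Longrightarrow> n = leaves t + m - 1 \<Longrightarrow> pcomp (bas t) i y \<in> J n"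
  using operadic_ideal_ideal_gen[of agd_ar agd_rel] J_Free bas_Free[OF _ refl, of agd_ar t]
  unfolding operadic_ideal_def by blast

lemma J_Unary:
  assumes "z \<in> J n" "g \<noteq> Mu"
  shows "lift (\<lambda>t. bas (Node g [t])) z \<in> J n"
proof -
  have "pcomp (bas (Node g [Leaf])) 1 z \<in> J n"
    by (rule J_pcomp_right) (use assms in \<open>cases g; simp\<close>)+
  then show ?thesis by (simp add: pcomp_def lift2_bas_left pcomp_tree_def)
qed

lemma J_Mu2_left:
  assumes "z \<in> J n" "wf_tree agd_ar b"
  shows "lift (\<lambda>t. bas (Mu2 t b)) z \<in> J (n + leaves b)"
proof -
  have "pcomp (bas (Mu2 Leaf b)) 1 z \<in> J (n + leaves b)"
    by (rule J_pcomp_right) (use assms in auto)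
  then show ?thesis by (simp add: pcomp_def lift2_bas_left pcomp_tree_def)
qed

lemma J_Mu2_right:
  assumes "z \<in> J n" "wf_tree agd_ar a"
  shows "lift (\<lambda>t. bas (Mu2 a t)) z \<in> J (leaves a + n)"
proof -
  have "pcomp (bas (Mu2 a Leaf)) (Suc (leaves a)) z \<in> J (leaves a + n)"
    by (rule J_pcomp_right) (use assms in auto)
  then show ?thesis by (simp add: pcomp_def lift2_bas_left pcomp_tree_def)
qed

text \<open>Trees are composed into the relators from the last input to the first, so that the
  numbers of the inputs still open do not shift.\<close>

lemma J_relations:
  assumes wf: "wf_tree agd_ar a" "wf_tree agd_ar b" "wf_tree agd_ar c"
  shows "bas (Mu2 (Mu2 a b) c) - bas (Mu2 a (Mu2 b c)) \<in>
      (J (leaves a + leaves b + leaves c) :: (_ \<Rightarrow>\<^sub>0 'k::field) set)"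
    and "g \<noteq> Mu \<Longrightarrow> bas (Node g [Mu2 a b]) - bas (Mu2 (Node g [a]) b) - bas (Mu2 a (Node H [b]))
       \<in> (J (leaves a + leaves b) :: (_ \<Rightarrow>\<^sub>0 'k) set)"
proof -
  let ?r = "bas (Mu2 (Mu2 Leaf Leaf) Leaf) - bas (Mu2 Leaf (Mu2 Leaf Leaf)) :: _ \<Rightarrow>\<^sub>0 'k"
  have "?r \<in> agd_rel \<inter> Free agd_ar 3"
    unfolding agd_rel_eq by (intro IntI fs.span_base fs.subspace_diff[OF Free_subspace] bas_Free) auto
  then have "?r \<in> J 3" using ideal_gen_superset by blast
  then have 1: "pcomp ?r 3 (bas c) \<in> J (2 + leaves c)"
    by (rule J_pcomp_left) (use wf in auto)
  then have 2: "pcomp (pcomp ?r 3 (bas c)) 2 (bas b) \<in> J (1 + leaves b + leaves c)"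
    by (rule J_pcomp_left) (use wf in auto)
  then have "pcomp (pcomp (pcomp ?r 3 (bas c)) 2 (bas b)) 1 (bas a) \<in> J (leaves a + leaves b + leaves c)"
    by (rule J_pcomp_left) (use wf in auto)
  moreover have "pcomp (pcomp (pcomp ?r 3 (bas c)) 2 (bas b)) 1 (bas a) =
      bas (Mu2 (Mu2 a b) c) - bas (Mu2 a (Mu2 b c))"
    by (simp add: pcomp_def lift2_linear pcomp_tree_def numeral_2_eq_2 numeral_3_eq_3)
  ultimately show "bas (Mu2 (Mu2 a b) c) - bas (Mu2 a (Mu2 b c)) \<in>
      (J (leaves a + leaves b + leaves c) :: (_ \<Rightarrow>\<^sub>0 'k) set)"
    by simp
next
  assume g: "g \<noteq> Mu"
  let ?r = "bas (Node g [Mu2 Leaf Leaf]) - bas (Mu2 (Node g [Leaf]) Leaf) - bas (Mu2 Leaf (Node H [Leaf])) :: _ \<Rightarrow>\<^sub>0 'k"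
  have "?r \<in> agd_rel \<inter> Free agd_ar 2"
    unfolding agd_rel_eq using g
    by (cases g; intro IntI fs.span_base fs.subspace_diff[OF Free_subspace] bas_Free) auto
  then have "?r \<in> J 2" using ideal_gen_superset by blast
  then have "pcomp ?r 2 (bas b) \<in> J (1 + leaves b)"
    by (rule J_pcomp_left) (use wf in auto)
  then have "pcomp (pcomp ?r 2 (bas b)) 1 (bas a) \<in> J (leaves a + leaves b)"
    by (rule J_pcomp_left) (use wf in auto)
  moreover have "pcomp (pcomp ?r 2 (bas b)) 1 (bas a) =
      bas (Node g [Mu2 a b]) - bas (Mu2 (Node g [a]) b) - bas (Mu2 a (Node H [b]))"
    by (simp add: pcomp_def lift2_linear pcomp_tree_def numeral_2_eq_2)
  ultimately show "bas (Node g [Mu2 a b]) - bas (Mu2 (Node g [a]) b) - bas (Mu2 a (Node H [b]))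
       \<in> (J (leaves a + leaves b) :: (_ \<Rightarrow>\<^sub>0 'k) set)"
    by simp
qed

lemma wtree_wf: "Mu \<notin> set w \<Longrightarrow> wf_tree agd_ar (wtree w) \<and> leaves (wtree w) = 1"
proof (induction w)
  case (Cons c w)
  then show ?case by (cases c) auto
qed simp

lemma nftree_wf: "m \<in> monoms n \<Longrightarrow> wf_tree agd_ar (nftree m) \<and> leaves (nftree m) = n"
proof (induction m arbitrary: n rule: nftree.induct)
  case (3 w v vs)
  then have "v # vs \<in> monoms (n - 1)" "Mu \<notin> set w" "0 < n" by (auto simp: monoms_def)
  then show ?case using 3(1) wtree_wf[of w] by auto
qed (auto simp: monoms_def wtree_wf)

lemma nform_monoms:
  "wf_tree agd_ar t \<Longrightarrow> supp_in (monoms (leaves t)) (nform t :: _ \<Rightarrow>\<^sub>0 'k::field)"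
proof (induction t rule: agd_tree_induct)
  case Leaf
  then show ?case by (auto simp: monoms_def intro: supp_in_bas)
next
  case (Mu2 a b)
  then have "supp_in (monoms (leaves a)) (nform a :: _ \<Rightarrow>\<^sub>0 'k)"
    "supp_in (monoms (leaves b)) (nform b :: _ \<Rightarrow>\<^sub>0 'k)"
    by simp_all
  then show ?case by (auto simp: monoms_def intro!: supp_in_mul)
next
  case (Unary g a)
  then show ?case
    by (auto intro: supp_in_lift der_bas_monoms)
qed simp

section \<open>Reduction to normal forms modulo the ideal\<close>

definition Jeq :: "nat \<Rightarrow> (agd_gen tree \<Rightarrow>\<^sub>0 'k::field) \<Rightarrow> (agd_gen tree \<Rightarrow>\<^sub>0 'k) \<Rightarrow> bool" where
  "Jeq n x y \<longleftrightarrow> x - y \<in> J n"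

lemma Jeq_refl [simp]: "Jeq n x x"
  by (simp add: Jeq_def fs.subspace_0[OF J_subspace])

lemma Jeq_trans [trans]: "Jeq n x y \<Longrightarrow> Jeq n y z \<Longrightarrow> Jeq n x z"
  unfolding Jeq_def using fs.subspace_add[OF J_subspace, of "x - y" n "y - z"] by simp

lemma Jeq_add: "Jeq n x y \<Longrightarrow> Jeq n x' y' \<Longrightarrow> Jeq n (x + x') (y + y')"
  unfolding Jeq_def using fs.subspace_add[OF J_subspace, of "x - y" n "x' - y'"]
  by (simp add: algebra_simps)

lemma Jeq_lift:
  assumes "supp_in A x" "\<And>a. a \<in> A \<Longrightarrow> Jeq n (f a) (g a)"
  shows "Jeq n (lift f x) (lift g x)"
  using assms unfolding Jeq_def lift_fun_diff[symmetric] supp_in_def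
  by (intro lift_in_subspace J_subspace) auto

lemma Jeq_map:
  assumes "Jeq n x y" "\<And>z. z \<in> J n \<Longrightarrow> lift f z \<in> J m"
  shows "Jeq m (lift f x) (lift f y)"
  using assms unfolding Jeq_def by (simp add: lift_diff[symmetric])

lemma Jeq_Unary:
  "Jeq n x y \<Longrightarrow> g \<noteq> Mu \<Longrightarrow> Jeq n (lift (\<lambda>t. bas (Node g [t])) x) (lift (\<lambda>t. bas (Node g [t])) y)"
  by (rule Jeq_map[OF _ J_Unary])

lemma Jeq_Mu2_left:
  "Jeq n x y \<Longrightarrow> wf_tree agd_ar b \<Longrightarrow>
     Jeq (n + leaves b) (lift (\<lambda>t. bas (Mu2 t b)) x) (lift (\<lambda>t. bas (Mu2 t b)) y)"
  by (rule Jeq_map[OF _ J_Mu2_left])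

lemma Jeq_Mu2_right:
  "Jeq n x y \<Longrightarrow> wf_tree agd_ar a \<Longrightarrow>
     Jeq (leaves a + n) (lift (\<lambda>t. bas (Mu2 a t)) x) (lift (\<lambda>t. bas (Mu2 a t)) y)"
  by (rule Jeq_map[OF _ J_Mu2_right])

lemma nftree_Cons: "v \<noteq> [] \<Longrightarrow> nftree (w # v) = Mu2 (wtree w) (nftree v)"
  by (cases v) simp_all

lemma Jeq_nftree_append:
  "m \<in> monoms k \<Longrightarrow> m' \<in> monoms l \<Longrightarrow> 
     Jeq (k + l) (bas (Mu2 (nftree m) (nftree m'))) (bas (nftree (m @ m')) :: _ \<Rightarrow>\<^sub>0 'k::field)"
proof (induction m arbitrary: k)
  case (Cons w v)
  have m': "m' \<noteq> []" and w: "Mu \<notin> set w" using Cons.prems by (auto simp: monoms_def)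
  note wt = wtree_wf[OF w]
  show ?case
  proof (cases "v = []")
    case True
    then show ?thesis using m' by (simp add: nftree_Cons)
  next
    case False
    then have v: "v \<in> monoms (k - 1)" and k: "0 < k"
      using Cons.prems by (auto simp: monoms_def)
    note wfs = nftree_wf[OF v] nftree_wf[OF Cons.prems(2)]
    have l: "leaves (wtree w) + leaves (nftree v) + leaves (nftree m') = k + l"
      "leaves (wtree w) + (k - 1 + l) = k + l"
      using wt wfs k by simp_all
    have "Jeq (k + l) (bas (Mu2 (nftree (w # v)) (nftree m'))) (bas (Mu2 (wtree w) (Mu2 (nftree v) (nftree m'))) :: _ \<Rightarrow>\<^sub>0 'k)"
      using J_relations(1)[of "wtree w" "nftree v" "nftree m'"] wt wfs False l(1)
      by (simp add: nftree_Cons Jeq_def)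
    also have "Jeq (k + l) (bas (Mu2 (wtree w) (Mu2 (nftree v) (nftree m'))))
        (bas (Mu2 (wtree w) (nftree (v @ m'))) :: _ \<Rightarrow>\<^sub>0 'k)"
      using Jeq_Mu2_right[OF Cons.IH[OF v Cons.prems(2)], of "wtree w"] wt l(2) by simp
    also have "bas (Mu2 (wtree w) (nftree (v @ m'))) = (bas (nftree ((w # v) @ m')) :: _ \<Rightarrow>\<^sub>0 'k)"
      using False by (simp add: nftree_Cons)
    finally show ?thesis .
  qed
qed (simp add: monoms_def)

text \<open>The relation for \<open>g\<close> turns \<open>g\<close> on a product into
  \<open>g\<close> on the first word plus \<open>H\<close> on the rest. The rest is the induction
  hypothesis for \<open>H\<close>, whichever \<open>g\<close> was given.\<close>

lemma Jeq_nftree_der: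
  "m \<in> monoms n \<Longrightarrow> g \<noteq> Mu \<Longrightarrow>
     Jeq n (bas (Node g [nftree m])) (lift (\<lambda>m. bas (nftree m)) (der_bas g m) :: _ \<Rightarrow>\<^sub>0 'k::field)"
proof (induction m arbitrary: n g)
  case (Cons w v)
  have w: "Mu \<notin> set w" using Cons.prems by (auto simp: monoms_def)
  note wt = wtree_wf[OF w]
  show ?case
  proof (cases "v = []")
    case True
    then show ?thesis by simp
  next
    case False
    then have v: "v \<in> monoms (n - 1)" and n: "0 < n"
      using Cons.prems by (auto simp: monoms_def)
    have nxt: "nxt g = H" using Cons.prems by (cases g) auto
    note wfs = nftree_wf[OF v]
    have l: "leaves (wtree w) + leaves (nftree v) = n" "leaves (wtree w) + (n - 1) = n"
      using wt wfs n by simp_all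
    have "Jeq n (bas (Node g [nftree (w # v)]))
        (bas (Mu2 (Node g [wtree w]) (nftree v)) + bas (Mu2 (wtree w) (Node H [nftree v])) :: _ \<Rightarrow>\<^sub>0 'k)"
      using J_relations(2)[of "wtree w" "nftree v" Leaf g] wt wfs False l(1) Cons.prems
      by (simp add: nftree_Cons Jeq_def diff_diff_eq)
    also have "Jeq n (bas (Mu2 (Node g [wtree w]) (nftree v)) + bas (Mu2 (wtree w) (Node H [nftree v])))
        (bas (nftree ((g # w) # v)) + lift (\<lambda>m. bas (Mu2 (wtree w) (nftree m))) (der_bas H v) :: _ \<Rightarrow>\<^sub>0 'k)"
    proof (rule Jeq_add)
      have "Jeq (n - 1) (bas (Node H [nftree v])) (lift (\<lambda>m. bas (nftree m)) (der_bas H v) :: _ \<Rightarrow>\<^sub>0 'k)"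
        by (rule Cons.IH[OF v]) simp
      from Jeq_Mu2_right[OF this, of "wtree w"]
      show "Jeq n (bas (Mu2 (wtree w) (Node H [nftree v])))
          (lift (\<lambda>m. bas (Mu2 (wtree w) (nftree m))) (der_bas H v) :: _ \<Rightarrow>\<^sub>0 'k)"
        using wt l(2) by (simp add: lift_lift)
    qed (use False in \<open>simp add: nftree_Cons\<close>)
    also have "lift (\<lambda>m. bas (Mu2 (wtree w) (nftree m))) (der_bas H v) =
        lift (\<lambda>m. bas (nftree (w # m))) (der_bas H v :: _ \<Rightarrow>\<^sub>0 'k)"
      using der_bas_nonempty[of H v]
      by (intro lift_cong) (auto simp: supp_in_def nftree_Cons)
    also have "bas (nftree ((g # w) # v)) + \<dots> = lift (\<lambda>m. bas (nftree m)) (der_bas g (w # v))"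
      by (simp add: lift_add lift_lift nxt)
    finally show ?thesis .
  qed
qed (simp add: monoms_def)

text \<open>The normal form trees span the operad. They are also independent, since
  \<open>nform\<close> kills the ideal and takes the tree of a monomial back to that
  monomial.\<close>

lemma Jeq_nform:
  "wf_tree agd_ar t \<Longrightarrow>
     Jeq (leaves t) (bas t) (lift (\<lambda>m. bas (nftree m)) (nform t) :: _ \<Rightarrow>\<^sub>0 'k::field)"
proof (induction t rule: agd_tree_induct)
  case (Mu2 a b)
  then have wf: "wf_tree agd_ar a" "wf_tree agd_ar b" by simp_all
  let ?n = "leaves a + leaves b"
  have "Jeq ?n (bas (Mu2 a b)) (lift (\<lambda>m. bas (Mu2 (nftree m) b)) (nform a) :: _ \<Rightarrow>\<^sub>0 'k)"
    using Jeq_Mu2_left[OF Mu2.IH(1)[OF wf(1)] wf(2)] by (simp add: lift_lift)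
  also have "Jeq ?n \<dots> (lift (\<lambda>m. lift (\<lambda>m'. bas (Mu2 (nftree m) (nftree m'))) (nform b)) (nform a))"
  proof (rule Jeq_lift[OF nform_monoms[OF wf(1)]])
    fix m assume "m \<in> monoms (leaves a)"
    from nftree_wf[OF this] Jeq_Mu2_right[OF Mu2.IH(2)[OF wf(2)], of "nftree m"]
    show "Jeq ?n (bas (Mu2 (nftree m) b))
        (lift (\<lambda>m'. bas (Mu2 (nftree m) (nftree m'))) (nform b) :: _ \<Rightarrow>\<^sub>0 'k)"
      by (simp add: lift_lift)
  qed
  also have "Jeq ?n \<dots> (lift (\<lambda>m. lift (\<lambda>m'. bas (nftree (m @ m'))) (nform b)) (nform a))"
    by (intro Jeq_lift[OF nform_monoms[OF wf(1)]] Jeq_lift[OF nform_monoms[OF wf(2)]] Jeq_nftree_append)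
  also have "\<dots> = lift (\<lambda>m. bas (nftree m)) (nform (Mu2 a b))"
    by (simp add: mul_def lift2_def lift_lift)
  finally show ?case by simp
next
  case (Unary g a)
  then have wf: "wf_tree agd_ar a" by simp
  have "Jeq (leaves a) (bas (Node g [a])) (lift (\<lambda>m. bas (Node g [nftree m])) (nform a) :: _ \<Rightarrow>\<^sub>0 'k)"
    using Jeq_Unary[OF Unary.IH[OF wf] Unary.hyps] by (simp add: lift_lift)
  also have "Jeq (leaves a) \<dots> (lift (\<lambda>m. lift (\<lambda>m. bas (nftree m)) (der_bas g m)) (nform a))"
    by (rule Jeq_lift[OF nform_monoms[OF wf]]) (rule Jeq_nftree_der[OF _ Unary.hyps])
  also have "\<dots> = lift (\<lambda>m. bas (nftree m)) (nform (Node g [a]))"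
    using Unary.hyps by (simp add: lift_lift)
  finally show ?case by simp
qed simp_all

section \<open>The Koszul complex on normal forms\<close>

type_synonym word = "agd_gen list"

fun bar_diff :: "'a list list \<Rightarrow> ('a list list \<Rightarrow>\<^sub>0 'k::field)" where
  "bar_diff [] = 0"
| "bar_diff [m] = 0"
| "bar_diff (m # m' # ms) = bas ((m @ m') # ms) - lift (\<lambda>v. bas (m # v)) (bar_diff (m' # ms))"

fun lact :: "agd_gen \<Rightarrow> word list list \<Rightarrow> (word list list \<Rightarrow>\<^sub>0 'k::field)" where
  "lact c [] = 0"
| "lact c (m # ms) =
     lift (\<lambda>m'. bas (m' # ms)) (der_bas c m) + lift (\<lambda>v. bas (m # v)) (lact (nxt c) ms)"

fun bar_htpy :: "'a list list \<Rightarrow> ('a list list \<Rightarrow>\<^sub>0 'k::field)" where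
  "bar_htpy ((w # v) # ms) = (if v = [] then 0 else bas ([w] # v # ms))"
| "bar_htpy _ = 0"

text \<open>The inverse of \<open>(c, w) \<mapsto> c w\<close> in arity 1. The empty word is not of
  this form; it goes to 0 and survives as the unit.\<close>

fun unact :: "word list list \<Rightarrow> (agd_gen \<times> word list list \<Rightarrow>\<^sub>0 'k::field)" where
  "unact [[c # w]] = bas (c, [[w]])"
| "unact _ = 0"

definition incl :: "'c \<Rightarrow> ('b \<Rightarrow>\<^sub>0 'k) \<Rightarrow> ('c \<times> 'b \<Rightarrow>\<^sub>0 'k::field)" where
  "incl c z = lift (\<lambda>ms. bas (c, ms)) z"

text \<open>The basis element \<open>(c, [m\<^sub>1, \<dots>, m\<^sub>k])\<close> stands for \<open>(cog c k; m\<^sub>1, \<dots>, m\<^sub>k)\<close>.\<close>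

definition mdiff :: "agd_gen \<times> word list list \<Rightarrow> (agd_gen \<times> word list list \<Rightarrow>\<^sub>0 'k::field)" where
  "mdiff = (\<lambda>(c, ms). if c = Mu then incl Mu (bar_diff ms)
     else incl Mu (lact c ms) - incl c (bar_diff ms))"

text \<open>The minus sign matches that of the bar differential on the two shifted copies in
  \<open>mdiff\<close>.\<close>

definition mhtpy :: "agd_gen \<times> word list list \<Rightarrow> (agd_gen \<times> word list list \<Rightarrow>\<^sub>0 'k::field)" where
  "mhtpy = (\<lambda>(c, ms). if c = Mu then incl Mu (bar_htpy ms) + unact ms else - incl c (bar_htpy ms))"

definition confs :: "nat \<Rightarrow> nat \<Rightarrow> word list list set" where
  "confs k n = {ms. length ms = k \<and> sum_list (map length ms) = n \<and> (\<forall>m\<in>set ms. m \<in> monoms (length m))}"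

lemma confs_Cons:
  "m # ms \<in> confs k n \<longleftrightarrow> m \<in> monoms (length m) \<and> 0 < k \<and> length m \<le> n \<and> ms \<in> confs (k - 1) (n - length m)"
  by (auto simp: confs_def)

lemma supp_in_diff:
  "supp_in A x \<Longrightarrow> supp_in A y \<Longrightarrow> supp_in A (x - y :: _ \<Rightarrow>\<^sub>0 'k::field)"
  using supp_in_add[of A x "- y"] by (simp add: supp_in_def)

lemma supp_in_uminus: "supp_in A x \<Longrightarrow> supp_in A (- x :: _ \<Rightarrow>\<^sub>0 'k::field)"
  by (simp add: supp_in_def)

lemma supp_in_incl: "supp_in A z \<Longrightarrow> (\<And>ms. ms \<in> A \<Longrightarrow> (c, ms) \<in> B) \<Longrightarrow> supp_in B (incl c z)"
  unfolding incl_def by (rule supp_in_lift) (auto intro: supp_in_bas)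

lemma bar_diff_confs:
  "ms \<in> confs k n \<Longrightarrow> supp_in (confs (k - 1) n) (bar_diff ms :: _ \<Rightarrow>\<^sub>0 'k::field)"
proof (induction ms arbitrary: k n rule: bar_diff.induct)
  case (3 m m' ms)
  have "supp_in (confs (k - 1 - 1) (n - length m)) (bar_diff (m' # ms) :: _ \<Rightarrow>\<^sub>0 'k)"
    by (rule "3.IH") (use 3 in \<open>simp add: confs_Cons[of m]\<close>)
  moreover have "m # v \<in> confs (k - 1) n" if "v \<in> confs (k - 1 - 1) (n - length m)" for v
    using that 3(2) by (auto simp: confs_def)
  moreover have "(m @ m') # ms \<in> confs (k - 1) n"
    using 3(2) by (auto simp: confs_def monoms_def)
  ultimately show ?case
    by (auto intro!: supp_in_diff supp_in_bas supp_in_lift[of "confs (k - 1 - 1) (n - length m)"])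
qed simp_all

lemma lact_confs:
  "c \<noteq> Mu \<Longrightarrow> ms \<in> confs k n \<Longrightarrow> supp_in (confs k n) (lact c ms :: _ \<Rightarrow>\<^sub>0 'k::field)"
proof (induction ms arbitrary: c k n)
  case (Cons m ms)
  have "supp_in (confs (k - 1) (n - length m)) (lact (nxt c) ms :: _ \<Rightarrow>\<^sub>0 'k)"
    by (rule Cons.IH) (use Cons.prems in \<open>simp_all add: confs_Cons\<close>)
  then have 1: "supp_in (confs k n) (lift (\<lambda>v. bas (m # v)) (lact (nxt c) ms) :: _ \<Rightarrow>\<^sub>0 'k)"
    by (rule supp_in_lift) (use Cons.prems in \<open>auto simp: confs_def intro!: supp_in_bas\<close>)
  have "supp_in (monoms (length m)) (der_bas c m :: _ \<Rightarrow>\<^sub>0 'k)"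
    by (rule der_bas_monoms) (use Cons.prems in \<open>simp_all add: confs_Cons\<close>)
  then have "supp_in (confs k n) (lift (\<lambda>m'. bas (m' # ms)) (der_bas c m) :: _ \<Rightarrow>\<^sub>0 'k)"
    by (rule supp_in_lift) (use Cons.prems in \<open>auto simp: confs_def monoms_def intro!: supp_in_bas\<close>)
  then show ?case using 1 by (simp add: supp_in_add)
qed simp

lemma bar_htpy_confs: "ms \<in> confs k n \<Longrightarrow> supp_in (confs (Suc k) n) (bar_htpy ms)"
  by (cases ms rule: bar_htpy.cases) (auto simp: confs_def monoms_def intro!: supp_in_bas)

text \<open>If the first monomial has several words, splitting and then merging restores it and the
  other terms cancel. If it is one word followed by another monomial, merging and then splitting
  restores it. A single word on its own is neither split nor merged.\<close>

lemma bar_contraction: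
  assumes "ms \<in> confs k n"
  shows "lift bar_diff (bar_htpy ms) + lift bar_htpy (bar_diff ms) =
    (if k = 0 \<or> k = 1 \<and> n = 1 then 0 else bas ms :: _ \<Rightarrow>\<^sub>0 'k::field)"
proof (cases ms)
  case Nil
  then show ?thesis using assms by (simp add: confs_def)
next
  case (Cons m ms')
  then obtain w v where m: "m = w # v"
    using assms by (cases m) (auto simp: confs_def monoms_def)
  show ?thesis
  proof (cases ms')
    case Nil
    have "v = [] \<longleftrightarrow> n = 1" "k = 1" using assms Cons m Nil by (auto simp: confs_def)
    then show ?thesis using Cons m Nil by simp
  next
    case ms': (Cons m2 r)
    have "m2 \<noteq> []" "k \<noteq> 0" "k \<noteq> 1" using assms Cons ms' by (auto simp: confs_def monoms_def)
    then show ?thesis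
      using Cons m ms' by (cases "v = []") (simp_all add: lift_linear lift_lift)
  qed
qed

text \<open>Acting before or after the split reaches the first word by \<open>c\<close> and
  everything behind it by \<open>nxt c\<close>: the word becomes a separate factor, but
  \<open>nxt\<close> is idempotent, so the later factors do not notice.\<close>

lemma bar_htpy_lact:
  assumes "ms \<in> confs k n"
  shows "lift bar_htpy (lact c ms) = (lift (lact c) (bar_htpy ms) :: _ \<Rightarrow>\<^sub>0 'k::field)"
proof (cases ms)
  case (Cons m ms')
  then obtain w v where m: "m = w # v"
    using assms by (cases m) (auto simp: confs_def monoms_def)
  show ?thesis
  proof (cases "v = []")
    case True
    then show ?thesis using Cons m by (simp add: lift_linear lift_lift)
  next
    case False
    have "lift (\<lambda>v'. bar_htpy ((w # v') # ms')) (der_bas (nxt c) v) =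
        (lift (\<lambda>v'. bas ([w] # v' # ms')) (der_bas (nxt c) v) :: _ \<Rightarrow>\<^sub>0 'k)"
      using der_bas_nonempty[of "nxt c" v, where 'k='k]
      by (intro lift_cong) (auto simp: supp_in_def)
    then show ?thesis using Cons m False
      by (simp add: lift_linear lift_lift del: bar_htpy.simps add: bar_htpy.simps(1)[of w v]
          bar_htpy.simps(1)[of "c # w" v])
  qed
qed simp

lemma unact_confs: "ms \<in> confs k n \<Longrightarrow> k \<noteq> 1 \<or> n \<noteq> 1 \<Longrightarrow> unact ms = (0 :: _ \<Rightarrow>\<^sub>0 'k::field)"
  by (cases ms rule: unact.cases) (auto simp: confs_def)

lemma lift_zero_supp: "supp_in A x \<Longrightarrow> (\<And>a. a \<in> A \<Longrightarrow> f a = 0) \<Longrightarrow> lift f x = 0"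
  using lift_cong[of x f "\<lambda>_. 0"] by (auto simp: supp_in_def)

lemma confs_length_le: "ms \<in> confs k n \<Longrightarrow> k \<le> n"
proof (induction ms arbitrary: k n)
  case (Cons m ms)
  have "k - 1 \<le> n - length m"
    by (rule Cons.IH) (use Cons.prems in \<open>simp add: confs_Cons\<close>)
  moreover have "0 < length m" "length m \<le> n"
    using Cons.prems by (simp_all add: confs_Cons monoms_def)
  ultimately show ?case by arith
qed (simp add: confs_def)

lemma confs_1_1: "ms \<in> confs 1 1 \<Longrightarrow> \<exists>w. ms = [[w]] \<and> Mu \<notin> set w"
  by (auto simp: confs_def monoms_def length_Suc_conv)

lemma unact_bar_diff:
  assumes "ms \<in> confs k n"
  shows "lift unact (bar_diff ms) = (0 :: _ \<Rightarrow>\<^sub>0 'k::field)"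
  using bar_diff_confs[OF assms]
proof (rule lift_zero_supp)
  \<comment> \<open>A nonzero value needs \<open>k - 1 = 1\<close> and \<open>n = 1\<close>,
    contradicting \<open>k \<le> n\<close>.\<close>
  fix us assume "us \<in> confs (k - 1) n"
  then show "unact us = (0 :: _ \<Rightarrow>\<^sub>0 'k)"
    by (rule unact_confs) (use confs_length_le[OF assms] in linarith)
qed

lemma unact_lact:
  assumes "ms \<in> confs k n" "c \<noteq> Mu"
  shows "lift unact (lact c ms) = (if k = 1 \<and> n = 1 then bas (c, ms) else 0 :: _ \<Rightarrow>\<^sub>0 'k::field)"
proof (cases "k = 1 \<and> n = 1")
  case True
  then obtain w where "ms = [[w]]" using confs_1_1 assms by blast
  then show ?thesis using True by (simp add: lift_linear)
next
  case False
  have "lift unact (lact c ms) = (0 :: _ \<Rightarrow>\<^sub>0 'k)"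
    by (rule lift_zero_supp[OF lact_confs[OF assms(2,1)]]) (use unact_confs False in blast)
  then show ?thesis using False by auto
qed

lemma lift_incl: "lift f (incl c z) = lift (\<lambda>ms. f (c, ms)) z"
  by (simp add: incl_def lift_lift)

lemma incl_lift: "incl c (lift f z) = lift (\<lambda>a. incl c (f a)) z"
  by (simp add: incl_def lift_lift)

lemma incl_linear:
  "incl c (x + y) = incl c x + incl c y" "incl c (- x) = - incl c x" "incl c (x - y) = incl c x - incl c y"
  "incl c (fscale a x) = fscale a (incl c x)" "incl c 0 = 0" "incl c (bas ms) = bas (c, ms)"
  by (simp_all add: incl_def lift_linear)

text \<open>Both defects of \<open>bar_contraction\<close> at single words are repaired by
  \<open>unact\<close>: in the copy \<open>Mu\<close> by acting after it, in the other copies by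
  acting before it. The mixed terms cancel by \<open>bar_htpy_lact\<close>.\<close>

lemma mdiff_mhtpy:
  assumes "ms \<in> confs k n" "0 < k" "(c, ms) \<noteq> (Mu, [[[]]])"
  shows "lift mdiff (mhtpy (c, ms)) + lift mhtpy (mdiff (c, ms)) = (bas (c, ms) :: _ \<Rightarrow>\<^sub>0 'k::field)"
proof (cases "c = Mu")
  case True
  have 1: "lift mdiff (incl Mu (bar_htpy ms)) + lift mhtpy (incl Mu (bar_diff ms)) =
      incl Mu (lift bar_diff (bar_htpy ms) + lift bar_htpy (bar_diff ms)) +
      (lift unact (bar_diff ms) :: _ \<Rightarrow>\<^sub>0 'k)"
    by (simp add: lift_incl mdiff_def mhtpy_def incl_linear incl_lift lift_fun_add)
  have 2: "lift mdiff (unact ms) = (if k = 1 \<and> n = 1 then bas (Mu, ms) else 0 :: _ \<Rightarrow>\<^sub>0 'k)"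
  proof (cases "k = 1 \<and> n = 1")
    case kn: True
    then obtain w where w: "ms = [[w]]" "Mu \<notin> set w" using confs_1_1 assms(1) by blast
    then obtain c' w' where "w = c' # w'" using assms(3) True by (cases w) auto
    then show ?thesis using w kn
      by (auto simp: mdiff_def lift_linear incl_linear)
  next
    case False
    then show ?thesis using unact_confs[OF assms(1), where 'k='k] by auto
  qed
  show ?thesis
    using True 1 2 unact_bar_diff[OF assms(1), where 'k='k] bar_contraction[OF assms(1), where 'k='k] assms(2)
    by (auto simp: mdiff_def[of] mhtpy_def lift_linear incl_linear split: if_splits)
next
  case False
  have "lift mdiff (mhtpy (c, ms)) + lift mhtpy (mdiff (c, ms)) =
     incl c (lift bar_diff (bar_htpy ms) + lift bar_htpy (bar_diff ms)) +
     incl Mu (lift bar_htpy (lact c ms) - lift (lact c) (bar_htpy ms)) + (lift unact (lact c ms) :: _ \<Rightarrow>\<^sub>0 'k)"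
    using False
    by (simp add: mdiff_def mhtpy_def lift_linear lift_incl incl_linear incl_lift lift_fun_linear algebra_simps)
  then show ?thesis
    using False assms(2) bar_contraction[OF assms(1), where 'k='k] bar_htpy_lact[OF assms(1), of c, where 'k='k]
      unact_lact[OF assms(1) False, where 'k='k]
    by (auto simp: incl_linear split: if_splits)
qed

section \<open>The differential of the Koszul complex\<close>

abbreviation pair :: "('a \<Rightarrow>\<^sub>0 'k) \<Rightarrow> ('b \<Rightarrow>\<^sub>0 'k) \<Rightarrow> ('a \<times> 'b \<Rightarrow>\<^sub>0 'k::field)" where
  "pair \<equiv> lift2 (\<lambda>t ts. bas (t, ts))"

abbreviation cons2 :: "('a \<Rightarrow>\<^sub>0 'k) \<Rightarrow> ('a list \<Rightarrow>\<^sub>0 'k) \<Rightarrow> ('a list \<Rightarrow>\<^sub>0 'k::field)" where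
  "cons2 \<equiv> lift2 (\<lambda>t ts. bas (t # ts))"

fun bar_tree :: "agd_gen tree list \<Rightarrow> (agd_gen tree list \<Rightarrow>\<^sub>0 'k::field)" where
  "bar_tree [] = 0"
| "bar_tree [p] = 0"
| "bar_tree (p # q # ps) = bas (Mu2 p q # ps) - lift (\<lambda>v. bas (p # v)) (bar_tree (q # ps))"

fun lact_tree :: "agd_gen \<Rightarrow> agd_gen tree list \<Rightarrow> (agd_gen tree list \<Rightarrow>\<^sub>0 'k::field)" where
  "lact_tree c [] = 0"
| "lact_tree c (p # ps) = bas (Node c [p] # ps) + lift (\<lambda>v. bas (p # v)) (lact_tree (nxt c) ps)"

text \<open>Upper levels with exactly one vertex, the only ones on which the twisting morphism does
  not vanish.\<close>

definition forests1 :: "nat \<Rightarrow> agd_gen tree list set" where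
  "forests1 k = {ts. list_all (wf_tree agd_ar) ts \<and> sum_list (map leaves ts) = k \<and> weights ts = 1}"

lemma wf_weight_1:
  assumes "wf_tree agd_ar t" "weight t = 1"
  shows "t = Mu2 Leaf Leaf \<or> (\<exists>g. g \<noteq> Mu \<and> t = Node g [Leaf])"
proof (cases t)
  case (Node g ts)
  then show ?thesis using assms by (cases g) (auto simp: length_Suc_conv numeral_2_eq_2)
qed (use assms in simp)

lemma forest_weight_0:
  "weights ts = 0 \<Longrightarrow> sum_list (map leaves ts) = k \<Longrightarrow> ts = replicate k Leaf"
  by (induction ts arbitrary: k) auto

lemma forests1_0: "forests1 0 = {}"
proof -
  have "False" if "ts \<in> forests1 0" for ts
  proof -
    have "list_all (wf_tree agd_ar) ts" "sum_list (map leaves ts) = 0" "weights ts = 1"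
      using that unfolding forests1_def by blast+
    then have "length ts = 0" using length_le_leaves[of ts] by linarith
    then show False using \<open>weights ts = 1\<close> by simp
  qed
  then show ?thesis by blast
qed

lemma forests1_Suc:
  "forests1 (Suc k) = (#) Leaf ` forests1 k \<union>
     {Node H [Leaf] # replicate k Leaf, Node Delta [Leaf] # replicate k Leaf} \<union>
     (if k = 0 then {} else {Mu2 Leaf Leaf # replicate (k - 1) Leaf})" (is "_ = ?R")
proof
  show "forests1 (Suc k) \<subseteq> ?R"
  proof
    fix ts assume ts: "ts \<in> forests1 (Suc k)"
    then obtain t us where tu: "ts = t # us" by (cases ts) (auto simp: forests1_def)
    show "ts \<in> ?R"
    proof (cases "t = Leaf")
      case True
      then have "us \<in> forests1 k" using ts tu by (auto simp: forests1_def)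
      then show ?thesis using tu True by blast
    next
      case False
      then have w: "weight t = 1" "weights us = 0"
        using ts tu weight_eq_0_iff[of t] by (auto simp: forests1_def simp del: weight_eq_0_iff)
      consider "t = Mu2 Leaf Leaf" | g where "g \<noteq> Mu" "t = Node g [Leaf]"
        using wf_weight_1[OF _ w(1)] ts tu by (auto simp: forests1_def)
      then show ?thesis
      proof cases
        case 1
        have "0 < k"
          using ts tu 1 by (auto simp: forests1_def)
        moreover have "us = replicate (k - 1) Leaf"
          by (rule forest_weight_0[OF w(2)]) (use ts tu 1 in \<open>auto simp: forests1_def\<close>)
        ultimately show ?thesis using tu 1 by simp
      next
        case 2
        have "us = replicate k Leaf"
          by (rule forest_weight_0[OF w(2)]) (use ts tu 2 in \<open>auto simp: forests1_def\<close>)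
        then show ?thesis using tu 2 by (cases g) auto
      qed
    qed
  qed
  show "?R \<subseteq> forests1 (Suc k)"
    by (auto simp: forests1_def list_all_iff sum_list_replicate)
qed

lemma finite_forests1: "finite (forests1 k)"
  by (induction k) (simp_all add: forests1_0 forests1_Suc)

lemma sum_forests1_Suc:
  "(\<Sum>ts\<in>forests1 (Suc k). f ts) = (\<Sum>ts\<in>forests1 k. f (Leaf # ts)) +
     (f (Node H [Leaf] # replicate k Leaf) + f (Node Delta [Leaf] # replicate k Leaf)) +
     (if k = 0 then 0 else f (Mu2 Leaf Leaf # replicate (k - 1) Leaf))"
  unfolding forests1_Suc
  by (subst sum.union_disjoint; (subst sum.union_disjoint)?)
    (auto simp: finite_forests1 sum.reindex)

lemma acoefs_replicate_Leaf [simp]: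
  "acoefs (replicate k Leaf) = 1" "eps (replicate k Leaf) = 1"
  by (induction k) simp_all

lemma dcoefs_replicate_Leaf [simp]: "dcoefs c (replicate k Leaf) = 0"
  by (induction k arbitrary: c) simp_all

text \<open>Split by the first tree: a multiplication merges the first two entries with sign
  \<open>eps\<close>, while a leaf shifts the sum by one place and flips the global sign, whence the
  minus in \<open>bar_tree\<close>. Unary vertices have \<open>acoef\<close> zero.\<close>

lemma sum_forests1_bar:
  "length ps = k \<Longrightarrow>
     (\<Sum>ts\<in>forests1 k. fscale (eps ts * acoefs ts) (bas (graft_list ts ps))) =
     (fscale ((-1) ^ k) (bar_tree ps) :: _ \<Rightarrow>\<^sub>0 'k::field)"
proof (induction k arbitrary: ps)
  case 0
  then show ?case by (simp add: forests1_0)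
next
  case (Suc k)
  then obtain p ps' where ps: "ps = p # ps'" "length ps' = k" by (cases ps) auto
  let ?S = "\<Sum>ts\<in>forests1 k. fscale (eps ts * acoefs ts) (bas (graft_list ts ps')) :: _ \<Rightarrow>\<^sub>0 'k"
  have "(\<Sum>ts\<in>forests1 k. fscale (eps (Leaf # ts) * acoefs (Leaf # ts)) (bas (graft_list (Leaf # ts) ps))) =
      lift (\<lambda>v. bas (p # v)) ?S"
    by (simp add: ps lift_linear)
  also have "?S = fscale ((-1) ^ k) (bar_tree ps')" by (rule Suc.IH[OF ps(2)])
  finally have 1: "(\<Sum>ts\<in>forests1 k. fscale (eps (Leaf # ts) * acoefs (Leaf # ts)) (bas (graft_list (Leaf # ts) ps))) =
      fscale ((-1) ^ k) (lift (\<lambda>v. bas (p # v)) (bar_tree ps') :: _ \<Rightarrow>\<^sub>0 'k)"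
    by (simp add: lift_scale)
  show ?case
  proof (cases ps')
    case Nil
    then show ?thesis unfolding sum_forests1_Suc 1 using ps by simp
  next
    case (Cons q r)
    then have k: "k = Suc (length r)" using ps by simp
    show ?thesis unfolding sum_forests1_Suc 1 using ps Cons
      by (simp add: k fs.scale_right_diff_distrib)
  qed
qed

text \<open>Only a unary vertex \<open>c\<close> in the first place or \<open>nxt c\<close> further
  on contributes. The sign for passing a leaf in \<open>dcoefs\<close> offsets the change of the
  global sign, so all terms of \<open>lact_tree\<close> are positive.\<close>

lemma sum_forests1_lact:
  "length ps = Suc k \<Longrightarrow> c \<noteq> Mu \<Longrightarrow>
     (\<Sum>ts\<in>forests1 (Suc k). fscale (eps ts * dcoefs c ts) (bas (graft_list ts ps))) =
     (fscale ((-1) ^ k) (lact_tree c ps) :: _ \<Rightarrow>\<^sub>0 'k::field)"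
proof (induction k arbitrary: ps c)
  case 0
  then obtain p where "ps = [p]" by (auto simp: length_Suc_conv)
  then show ?case unfolding sum_forests1_Suc using 0 by (cases c) (simp_all add: forests1_0)
next
  case (Suc k)
  then obtain p ps' where ps: "ps = p # ps'" "length ps' = Suc k" by (cases ps) auto
  let ?S = "\<Sum>ts\<in>forests1 (Suc k). fscale (eps ts * dcoefs (nxt c) ts) (bas (graft_list ts ps')) :: _ \<Rightarrow>\<^sub>0 'k"
  have "(\<Sum>ts\<in>forests1 (Suc k). fscale (eps (Leaf # ts) * dcoefs c (Leaf # ts)) (bas (graft_list (Leaf # ts) ps))) =
      - lift (\<lambda>v. bas (p # v)) ?S"
    by (simp add: ps lift_linear sum_negf)
  also have "?S = fscale ((-1) ^ k) (lact_tree (nxt c) ps')"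
    by (rule Suc.IH[OF ps(2)]) (use Suc.prems in simp)
  finally have 1: "(\<Sum>ts\<in>forests1 (Suc k). fscale (eps (Leaf # ts) * dcoefs c (Leaf # ts)) (bas (graft_list (Leaf # ts) ps))) =
      fscale ((-1) ^ Suc k) (lift (\<lambda>v. bas (p # v)) (lact_tree (nxt c) ps') :: _ \<Rightarrow>\<^sub>0 'k)"
    by (simp add: lift_scale)
  show ?case unfolding sum_forests1_Suc[of _ "Suc k"] 1 using ps Suc.prems(2)
    by (cases c) (simp_all add: fs.scale_right_distrib del: replicate.simps power_Suc)
qed

definition kd_part :: "'g tree list \<Rightarrow> 'g tree \<times> 'g tree list \<Rightarrow> ('g tree \<times> 'g tree list \<Rightarrow>\<^sub>0 'k::field)" where
  "kd_part ps = (\<lambda>(b, us).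
     if weights us = 1 then fscale ((- 1) ^ weight b) (bas (b, graft_list us ps)) else 0)"

lemma kdiff_emb: "kdiff (emb x ps) = lift (kd_part ps) (lift decomp x)"
  by (simp add: kdiff_def emb_def lift_lift kdiff_bas_def kd_part_def)

lemma kd_part_emb:
  assumes "x \<in> Free_w ar n w"
  shows "lift (kd_part ps) (emb x ts) =
    (if weights ts = 1 then fscale ((-1) ^ w) (emb x (graft_list ts ps)) else 0)"
proof -
  have "lift (kd_part ps) (emb x ts) = lift (\<lambda>b. kd_part ps (b, ts)) x"
    by (simp add: emb_def lift_lift)
  also have "\<dots> = lift (\<lambda>b. if weights ts = 1 then fscale ((-1) ^ w) (bas (b, graft_list ts ps)) else 0) x"
    using assms by (intro lift_cong) (auto simp: kd_part_def Free_w_def)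
  also have "\<dots> = (if weights ts = 1 then fscale ((-1) ^ w) (emb x (graft_list ts ps)) else 0)"
    by (simp add: emb_def lift_fun_scale)
  finally show ?thesis .
qed

lemma emb_eq_pair: "emb x ps = pair x (bas ps)"
  by (simp add: emb_def lift2_bas_right)

text \<open>A one-vertex upper level is either a multiplication, which shortens the list and keeps
  the class, or a unary vertex, which keeps the list and leaves the class \<open>\<nu>\<close>
  below.\<close>

lemma kdiff_pair_bas:
  assumes k: "length ps = Suc k"
  shows "kdiff (pair (cog c (Suc k)) (bas ps)) =
    (if c = Mu then pair (cog Mu k) (bar_tree ps)
     else pair (cog Mu (Suc k)) (lact_tree c ps) - pair (cog c k) (bar_tree ps) :: _ \<Rightarrow>\<^sub>0 'k::field)"
proof -
  let ?F = "\<lambda>ts. fscale (eps ts * acoefs ts) (emb (cog c (length ts)) ts) +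
        fscale (eps ts * dcoefs c ts) (emb (cog Mu (length ts)) ts :: _ \<Rightarrow>\<^sub>0 'k)"
  have sub: "forests1 (Suc k) \<subseteq> forests (Suc k)" by (auto simp: forests1_def forests_def)
  have z: "lift (kd_part ps) (?F ts) = 0" if "ts \<in> forests (Suc k) - forests1 (Suc k)" for ts
  proof -
    have "weights ts \<noteq> 1" using that by (auto simp: forests_def forests1_def)
    then show ?thesis by (simp add: lift_linear kd_part_emb[OF cog_Free_w])
  qed
  have a: "length ts = k" if "ts \<in> forests1 (Suc k)" "acoefs ts \<noteq> (0::'k)" for ts
    using acoefs_nonzero[OF that(2)] that(1) by (simp add: forests1_def)
  have d: "length ts = Suc k" if "ts \<in> forests1 (Suc k)" "dcoefs c ts \<noteq> (0::'k)" for ts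
    using dcoefs_nonzero[OF that(2)] that(1) by (simp add: forests1_def)
  have "kdiff (pair (cog c (Suc k)) (bas ps)) = lift (kd_part ps) (\<Sum>ts\<in>forests (Suc k). ?F ts)"
    by (simp only: emb_eq_pair[symmetric] kdiff_emb decomp_cog_forests)
  also have "\<dots> = (\<Sum>ts\<in>forests (Suc k). lift (kd_part ps) (?F ts))"
    by (rule lift_sum)
  also have "\<dots> = (\<Sum>ts\<in>forests1 (Suc k). lift (kd_part ps) (?F ts))"
    using z sub finite_forests by (intro sum.mono_neutral_right) auto
  also have "\<dots> = (\<Sum>ts\<in>forests1 (Suc k).
      fscale ((-1) ^ dgr c k) (pair (cog c k) (fscale (eps ts * acoefs ts) (bas (graft_list ts ps)))) +
      fscale ((-1) ^ k) (pair (cog Mu (Suc k)) (fscale (eps ts * dcoefs c ts) (bas (graft_list ts ps)))))"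
  proof (intro sum.cong refl)
    fix ts assume ts: "ts \<in> forests1 (Suc k)"
    then have w: "weights ts = 1" by (simp add: forests1_def)
    have 1: "fscale (eps ts * acoefs ts) (lift (kd_part ps) (emb (cog c (length ts)) ts)) =
      fscale ((-1) ^ dgr c k) (pair (cog c k) (fscale (eps ts * acoefs ts) (bas (graft_list ts ps) :: _ \<Rightarrow>\<^sub>0 'k)))"
      using a[OF ts] w
      by (cases "acoefs ts = (0::'k)")
        (simp_all add: kd_part_emb[OF cog_Free_w] lift2_linear mult_ac flip: emb_eq_pair)
    have 2: "fscale (eps ts * dcoefs c ts) (lift (kd_part ps) (emb (cog Mu (length ts)) ts)) =
      fscale ((-1) ^ k) (pair (cog Mu (Suc k)) (fscale (eps ts * dcoefs c ts) (bas (graft_list ts ps) :: _ \<Rightarrow>\<^sub>0 'k)))"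
      using d[OF ts] w
      by (cases "dcoefs c ts = (0::'k)")
        (simp_all add: kd_part_emb[OF cog_Free_w] lift2_linear mult_ac dgr_def flip: emb_eq_pair)
    show "lift (kd_part ps) (?F ts) =
      fscale ((-1) ^ dgr c k) (pair (cog c k) (fscale (eps ts * acoefs ts) (bas (graft_list ts ps)))) +
      fscale ((-1) ^ k) (pair (cog Mu (Suc k)) (fscale (eps ts * dcoefs c ts) (bas (graft_list ts ps))))"
      by (simp only: lift_linear 1 2)
  qed
  also have "\<dots> = fscale ((-1) ^ dgr c k) (pair (cog c k)
       (\<Sum>ts\<in>forests1 (Suc k). fscale (eps ts * acoefs ts) (bas (graft_list ts ps)))) +
     fscale ((-1) ^ k) (pair (cog Mu (Suc k))
       (\<Sum>ts\<in>forests1 (Suc k). fscale (eps ts * dcoefs c ts) (bas (graft_list ts ps))))"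
    by (simp only: sum.distrib fs.scale_sum_right lift2_linear_right(5))
  also have "(\<Sum>ts\<in>forests1 (Suc k). fscale (eps ts * acoefs ts) (bas (graft_list ts ps))) =
      (fscale ((-1) ^ Suc k) (bar_tree ps) :: _ \<Rightarrow>\<^sub>0 'k)"
    by (rule sum_forests1_bar[OF k])
  also have "(\<Sum>ts\<in>forests1 (Suc k). fscale (eps ts * dcoefs c ts) (bas (graft_list ts ps))) =
      (if c = Mu then 0 else fscale ((-1) ^ k) (lact_tree c ps) :: _ \<Rightarrow>\<^sub>0 'k)"
    using sum_forests1_lact[OF k, of c, where 'k='k] by (cases "c = Mu") auto
  \<comment> \<open>For positive \<open>k\<close> the exponent \<open>dgr c k + Suc k\<close> is
    even for \<open>c = Mu\<close> and odd otherwise, while the two factors \<open>(-1) ^ k\<close>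
    cancel. For \<open>k = 0\<close> the term \<open>bar_tree ps\<close> is zero.\<close>
  finally have eq: "kdiff (pair (cog c (Suc k)) (bas ps)) =
      fscale ((-1) ^ dgr c k) (pair (cog c k) (fscale ((-1) ^ Suc k) (bar_tree ps))) +
      fscale ((-1) ^ k) (pair (cog Mu (Suc k))
        (if c = Mu then 0 else fscale ((-1) ^ k) (lact_tree c ps) :: _ \<Rightarrow>\<^sub>0 'k))" .
  have sq: "(-1) ^ k * (-1) ^ k = (1 :: 'k)" by (simp flip: power_add)
  show ?thesis
  proof (cases "c = Mu")
    case True
    show ?thesis
    proof (cases k)
      case 0
      then show ?thesis using eq True k by (auto simp: length_Suc_conv)
    next
      case (Suc j)
      have "(-1) ^ j * (-1) ^ j = (1 :: 'k)" by (simp flip: power_add)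
      then show ?thesis using eq True Suc by (simp add: lift2_linear dgr_def)
    qed
  next
    case False
    then show ?thesis using eq sq by (simp add: lift2_linear dgr_def)
  qed
qed

section \<open>Comparison with the complex on normal forms\<close>

fun nforms :: "agd_gen tree list \<Rightarrow> (word list list \<Rightarrow>\<^sub>0 'k::field)" where
  "nforms [] = bas []"
| "nforms (p # ps) = cons2 (nform p) (nforms ps)"

text \<open>Joining two trees by \<open>Mu\<close> concatenates their normal forms. Together with
  \<open>nforms_lact_tree\<close> this makes the passage to normal forms a chain map.\<close>

lemma nforms_bar_tree:
  "lift nforms (bar_tree ps) = (lift bar_diff (nforms ps) :: _ \<Rightarrow>\<^sub>0 'k::field)"
proof (induction ps rule: bar_tree.induct)
  case (2 p)
  show ?case by (simp add: lift2_def lift_lift)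
next
  case (3 p q r)
  have 1: "nforms (Mu2 p q # r) =
      (lift (\<lambda>m1. lift (\<lambda>m2. lift (\<lambda>u. bas ((m1 @ m2) # u)) (nforms r)) (nform q)) (nform p) :: _ \<Rightarrow>\<^sub>0 'k)"
    by (simp add: mul_def lift2_def lift_lift)
  have "lift nforms (bar_tree (p # q # r)) =
      nforms (Mu2 p q # r) - cons2 (nform p) (lift nforms (bar_tree (q # r)) :: _ \<Rightarrow>\<^sub>0 'k)"
    by (simp add: lift_linear lift_lift lift2_linear_right del: nforms.simps add: nforms.simps(2)[of p])
  also have "\<dots> = nforms (Mu2 p q # r) - cons2 (nform p) (lift bar_diff (nforms (q # r)))"
    by (simp only: 3)
  also have "\<dots> = lift bar_diff (nforms (p # q # r))"
    unfolding 1 by (simp add: lift2_def lift_lift lift_fun_diff)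
  finally show ?case .
qed simp

lemma nforms_lact_tree:
  "c \<noteq> Mu \<Longrightarrow> lift nforms (lact_tree c ps) = (lift (lact c) (nforms ps) :: _ \<Rightarrow>\<^sub>0 'k::field)"
proof (induction ps arbitrary: c)
  case (Cons p ps)
  have "lift nforms (lact_tree c (p # ps)) =
      nforms (Node c [p] # ps) + cons2 (nform p) (lift nforms (lact_tree (nxt c) ps) :: _ \<Rightarrow>\<^sub>0 'k)"
    by (simp add: lift_linear lift_lift lift2_linear_right)
  also have "lift nforms (lact_tree (nxt c) ps) = lift (lact (nxt c)) (nforms ps :: _ \<Rightarrow>\<^sub>0 'k)"
    by (rule Cons.IH) (use Cons.prems in simp)
  also have "nforms (Node c [p] # ps) =
      (lift (\<lambda>m. lift (\<lambda>u. lift (\<lambda>m'. bas (m' # u)) (der_bas c m)) (nforms ps)) (nform p) :: _ \<Rightarrow>\<^sub>0 'k)"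
  proof -
    have "(\<lambda>m. lift (\<lambda>u. lift (\<lambda>m'. bas (m' # u)) (der_bas c m)) (nforms ps)) =
      (\<lambda>m. lift (\<lambda>m'. lift (\<lambda>u. bas (m' # u)) (nforms ps)) (der_bas c m) :: _ \<Rightarrow>\<^sub>0 'k)"
      by (rule ext) (rule lift_swap)
    then show ?thesis using Cons.prems by (simp add: lift2_def lift_lift)
  qed
  also have "\<dots> + cons2 (nform p) (lift (lact (nxt c)) (nforms ps)) = lift (lact c) (nforms (p # ps))"
    by (simp add: lift2_def lift_lift lift_fun_add)
  finally show ?case .
qed simp

text \<open>The component in a class is read off as the coefficient at its comb, which gives a
  linear map on all pairs of trees without writing the lower factor in the basis of classes.\<close>

definition to_model :: "agd_gen tree \<times> agd_gen tree list \<Rightarrow> (agd_gen \<times> word list list \<Rightarrow>\<^sub>0 'k::field)" where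
  "to_model = (\<lambda>(t, ps). \<Sum>c\<in>{H, Delta, Mu}. if t = ncomb c (leaves t - 1) then incl c (nforms ps) else 0)"

definition of_model :: "agd_gen \<times> word list list \<Rightarrow> (agd_gen tree \<times> agd_gen tree list \<Rightarrow>\<^sub>0 'k::field)" where
  "of_model = (\<lambda>(c, ms). pair (cog c (length ms)) (bas (map nftree ms)))"

lemma cog_0: "cog c 0 = 0"
proof (rule poly_mapping_eqI)
  fix t
  show "lkp (cog c 0) t = lkp (0 :: _ \<Rightarrow>\<^sub>0 'a) t"
  proof (cases "ccoef c t = (0 :: 'a)")
    case False
    then have "0 < leaves t" using ccoef_nonzero(1) leaves_pos[of agd_ar t] by auto
    then show ?thesis by (simp add: lookup_cog)
  qed (simp add: lookup_cog)
qed

text \<open>The assumption excludes arity 0, where \<open>cog c 0\<close> is zero but the right side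
  need not be.\<close>

lemma to_model_cog:
  assumes "0 < k \<or> z = 0"
  shows "lift to_model (pair (cog c k) z) = (incl c (lift nforms z) :: _ \<Rightarrow>\<^sub>0 'k::field)"
proof (cases "0 < k")
  case True
  have "lift to_model (pair (cog c k) (bas ps)) = (incl c (nforms ps) :: _ \<Rightarrow>\<^sub>0 'k)" for ps
  proof -
    have l: "leaves t = k" if "t \<in> Poly_Mapping.keys (cog c k :: _ \<Rightarrow>\<^sub>0 'k)" for t
      using that by (auto simp: in_keys_iff lookup_cog split: if_splits)
    have one: "lift (\<lambda>t. if t = ncomb c' (k - 1) then incl c' (nforms ps) else 0) (cog c k) =
        (if c' = c then incl c (nforms ps) else 0 :: _ \<Rightarrow>\<^sub>0 'k)" for c'
    proof (rule poly_mapping_eqI)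
      fix y
      show "lkp (lift (\<lambda>t. if t = ncomb c' (k - 1) then incl c' (nforms ps) else 0) (cog c k)) y =
          lkp (if c' = c then incl c (nforms ps) else 0 :: _ \<Rightarrow>\<^sub>0 'k) y"
        by (subst lookup_lift_unique[of "ncomb c' (k - 1)"]) (use True in \<open>auto simp: lookup_cog\<close>)
    qed
    have "lift to_model (pair (cog c k) (bas ps)) =
        lift (\<lambda>t. \<Sum>c'\<in>{H, Delta, Mu}. if t = ncomb c' (leaves t - 1) then incl c' (nforms ps) else 0) (cog c k :: _ \<Rightarrow>\<^sub>0 'k)"
      by (simp add: lift2_bas_right lift_lift to_model_def)
    also have "\<dots> = lift (\<lambda>t. \<Sum>c'\<in>{H, Delta, Mu}. if t = ncomb c' (k - 1) then incl c' (nforms ps) else 0) (cog c k)"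
      by (intro lift_cong) (simp only: l)
    also have "\<dots> = (\<Sum>c'\<in>{H, Delta, Mu}. if c' = c then incl c (nforms ps) else 0)"
      unfolding lift_fun_sum one ..
    also have "\<dots> = incl c (nforms ps)"
      by (cases c) simp_all
    finally show ?thesis .
  qed
  then have "lift (\<lambda>ps. lift to_model (pair (cog c k) (bas ps))) z = (lift (\<lambda>ps. incl c (nforms ps)) z :: _ \<Rightarrow>\<^sub>0 'k)"
    by simp
  moreover have "lift (\<lambda>ps. lift to_model (pair (cog c k) (bas ps))) z = (lift to_model (pair (cog c k) (lift bas z)) :: _ \<Rightarrow>\<^sub>0 'k)"
    by (simp only: lift2_linear_right lift_lift)
  ultimately show ?thesis by (simp add: incl_lift)
next
  case False
  then show ?thesis using assms by (simp add: cog_0 incl_linear)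
qed

definition tconfs :: "nat \<Rightarrow> nat \<Rightarrow> agd_gen tree list set" where
  "tconfs k n = {ps. length ps = k \<and> sum_list (map leaves ps) = n \<and> list_all (wf_tree agd_ar) ps}"

lemma bar_tree_tconfs:
  "ps \<in> tconfs k n \<Longrightarrow> supp_in (tconfs (k - 1) n) (bar_tree ps :: _ \<Rightarrow>\<^sub>0 'k::field)"
proof (induction ps arbitrary: k n rule: bar_tree.induct)
  case (3 p q r)
  have "supp_in (tconfs (k - 1 - 1) (n - leaves p)) (bar_tree (q # r) :: _ \<Rightarrow>\<^sub>0 'k)"
    by (rule "3.IH") (use 3(2) in \<open>auto simp: tconfs_def\<close>)
  then have "supp_in (tconfs (k - 1) n) (lift (\<lambda>v. bas (p # v)) (bar_tree (q # r)) :: _ \<Rightarrow>\<^sub>0 'k)"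
    by (rule supp_in_lift) (use 3(2) in \<open>auto simp: tconfs_def intro!: supp_in_bas\<close>)
  moreover have "Mu2 p q # r \<in> tconfs (k - 1) n"
    using 3(2) by (auto simp: tconfs_def)
  ultimately show ?case
    by (auto intro!: supp_in_diff supp_in_bas)
qed simp_all

lemma lact_tree_tconfs:
  "c \<noteq> Mu \<Longrightarrow> ps \<in> tconfs k n \<Longrightarrow> supp_in (tconfs k n) (lact_tree c ps :: _ \<Rightarrow>\<^sub>0 'k::field)"
proof (induction ps arbitrary: c k n)
  case (Cons p ps)
  have "supp_in (tconfs (k - 1) (n - leaves p)) (lact_tree (nxt c) ps :: _ \<Rightarrow>\<^sub>0 'k)"
    by (rule Cons.IH) (use Cons.prems in \<open>auto simp: tconfs_def\<close>)
  then have "supp_in (tconfs k n) (lift (\<lambda>v. bas (p # v)) (lact_tree (nxt c) ps) :: _ \<Rightarrow>\<^sub>0 'k)"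
    by (rule supp_in_lift) (use Cons.prems in \<open>auto simp: tconfs_def intro!: supp_in_bas\<close>)
  moreover have "Node c [p] # ps \<in> tconfs k n"
    using Cons.prems by (cases c) (auto simp: tconfs_def)
  ultimately show ?case
    by (auto intro!: supp_in_add supp_in_bas)
qed simp

lemma nforms_confs:
  "ps \<in> tconfs k n \<Longrightarrow> supp_in (confs k n) (nforms ps :: _ \<Rightarrow>\<^sub>0 'k::field)"
proof (induction ps arbitrary: k n)
  case Nil
  then show ?case by (auto simp: tconfs_def confs_def intro!: supp_in_bas)
next
  case (Cons p ps)
  have 1: "supp_in (monoms (leaves p)) (nform p :: _ \<Rightarrow>\<^sub>0 'k)"
    using Cons.prems by (intro nform_monoms) (simp add: tconfs_def)
  have 2: "supp_in (confs (k - 1) (n - leaves p)) (nforms ps :: _ \<Rightarrow>\<^sub>0 'k)"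
    by (rule Cons.IH) (use Cons.prems in \<open>auto simp: tconfs_def\<close>)
  have "m # ms \<in> confs k n" if "m \<in> monoms (leaves p)" "ms \<in> confs (k - 1) (n - leaves p)" for m ms
    using that Cons.prems by (auto simp: confs_def tconfs_def monoms_def)
  then show ?case
    unfolding nforms.simps lift2_def by (intro supp_in_lift[OF 1] supp_in_lift[OF 2] supp_in_bas)
qed

lemma nform_nftree: "m \<in> monoms n \<Longrightarrow> nform (nftree m) = (bas m :: _ \<Rightarrow>\<^sub>0 'k::field)"
proof -
  have w: "Mu \<notin> set w \<Longrightarrow> nform (wtree w) = (bas [w] :: _ \<Rightarrow>\<^sub>0 'k)" for w
    by (induction w) auto
  show "m \<in> monoms n \<Longrightarrow> nform (nftree m) = (bas m :: _ \<Rightarrow>\<^sub>0 'k)"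
  proof (induction m arbitrary: n rule: nftree.induct)
    case (3 v1 v2 vs)
    then have "v2 # vs \<in> monoms (n - 1)" by (auto simp: monoms_def)
    then show ?case using 3 w by (auto simp: monoms_def mul_def)
  qed (auto simp: monoms_def w)
qed

lemma nforms_nftree: "ms \<in> confs k n \<Longrightarrow> nforms (map nftree ms) = (bas ms :: _ \<Rightarrow>\<^sub>0 'k::field)"
proof (induction ms arbitrary: k n)
  case (Cons m ms)
  have "ms \<in> confs (k - 1) (n - length m)" "m \<in> monoms (length m)"
    using Cons.prems by (simp_all add: confs_Cons)
  from Cons.IH[OF this(1)] nform_nftree[OF this(2), where 'k='k] show ?case by simp
qed simp

lemma map_nftree_tconfs: "ms \<in> confs k n \<Longrightarrow> map nftree ms \<in> tconfs k n"
proof (induction ms arbitrary: k n)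
  case (Cons m ms)
  have ms: "ms \<in> confs (k - 1) (n - length m)" and m: "m \<in> monoms (length m)"
    and k: "0 < k" "length m \<le> n"
    using Cons.prems by (simp_all add: confs_Cons)
  from Cons.IH[OF ms] nftree_wf[OF m] k show ?case by (auto simp: tconfs_def)
qed (simp add: tconfs_def confs_def)

section \<open>Numerator and denominator of the Koszul complex\<close>

abbreviation agd_num :: "nat \<Rightarrow> nat \<Rightarrow> (agd_gen tree \<times> agd_gen tree list \<Rightarrow>\<^sub>0 'k::field) set" where
  "agd_num \<equiv> kc_num agd_ar agd_rel"

abbreviation agd_den :: "nat \<Rightarrow> nat \<Rightarrow> (agd_gen tree \<times> agd_gen tree list \<Rightarrow>\<^sub>0 'k::field) set" where
  "agd_den \<equiv> kc_den agd_ar agd_rel"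

lemma tensor_list_bas: "tensor_list (map bas ps) = bas ps"
  by (induction ps) simp_all

lemma tensor_list_tconfs:
  "length ys = k \<Longrightarrow> length ns = k \<Longrightarrow> \<forall>j<k. ys ! j \<in> Free agd_ar (ns ! j) \<Longrightarrow>
     supp_in (tconfs k (sum_list ns)) (tensor_list ys)"
proof (induction ys arbitrary: k ns)
  case Nil
  then show ?case by (auto simp: tconfs_def intro!: supp_in_bas)
next
  case (Cons y ys)
  then obtain n ns' k' where ns: "ns = n # ns'" "k = Suc k'" "length ys = k'" by (cases ns) auto
  have 1: "supp_in {t. wf_tree agd_ar t \<and> leaves t = n} y"
    using Cons.prems(3) ns by (auto simp: supp_in_Free)
  have 2: "supp_in (tconfs k' (sum_list ns')) (tensor_list ys)"
    by (rule Cons.IH) (use Cons.prems ns in auto)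
  show ?case
    unfolding tensor_list.simps lift2_def
    by (intro supp_in_lift[OF 1] supp_in_lift[OF 2] supp_in_bas) (auto simp: tconfs_def ns)
qed

lemma pair_in_subspace:
  assumes "x \<in> fs.span S" "supp_in A z" "fs.subspace V" "\<And>s a. s \<in> S \<Longrightarrow> a \<in> A \<Longrightarrow> pair s (bas a) \<in> V"
  shows "pair x z \<in> V"
  using assms(1)
proof (induction rule: fs.span_induct_alt)
  case base
  then show ?case by (simp add: fs.subspace_0[OF assms(3)])
next
  case (step c s y)
  have "lift (\<lambda>a. pair s (bas a)) z \<in> V"
    using assms(2) assms(4)[OF step(1)] unfolding supp_in_def by (intro lift_in_subspace assms(3)) auto
  then have "pair s z \<in> V"
    by (simp flip: lift2_linear_right(6))
  then show ?case using step(2)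
    by (simp add: lift2_linear fs.subspace_add[OF assms(3)] fs.subspace_scale[OF assms(3)])
qed

lemma kc_num_subspace: "fs.subspace (kc_num ar R n d)" and kc_den_subspace: "fs.subspace (kc_den ar R n d)"
  by (simp_all add: kc_num_def kc_den_def)

lemma pair_cog_in_num:
  assumes "supp_in (tconfs k n) z" "dgr c k = d"
  shows "pair (cog c k) z \<in> agd_num n d"
proof (rule pair_in_subspace[OF fs.span_base assms(1) kc_num_subspace])
  show "cog c k \<in> {cog c k}" by simp
  fix s ps assume s: "s \<in> {cog c k}" and ps: "ps \<in> tconfs k n"
  have "tensor (cog c k) (map bas ps) \<in> agd_num n d"
    unfolding kc_num_def koszul_dual_eq
  proof (intro fs.span_base CollectI exI conjI)
    show "cog c k \<in> cogs k d" by (rule cog_in_cogs[OF assms(2)])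
    show "\<forall>j<k. map bas ps ! j \<in> Free agd_ar (map leaves ps ! j)"
      using ps by (auto simp: tconfs_def list_all_length intro!: bas_Free)
  qed (use ps in \<open>auto simp: tconfs_def\<close>)
  then show "pair s (bas ps) \<in> agd_num n d"
    using s by (simp add: tensor_def tensor_list_bas)
qed

text \<open>Rests on the determination of the dual cooperad and on bilinearity; \<open>k = 0\<close>
  can be left out because \<open>cog c 0\<close> is zero.\<close>

lemma num_induct:
  assumes "x \<in> agd_num n d" "fs.subspace V"
    and "\<And>c k ps. dgr c k = d \<Longrightarrow> ps \<in> tconfs k n \<Longrightarrow> 0 < k \<Longrightarrow> pair (cog c k) (bas ps) \<in> V"
  shows "x \<in> V"
proof -
  have "agd_num n d \<subseteq> V"
    unfolding kc_num_def koszul_dual_eq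
  proof (rule fs.span_minimal[OF _ assms(2)], safe)
    fix x :: "agd_gen tree \<Rightarrow>\<^sub>0 'a" and ys :: "(agd_gen tree \<Rightarrow>\<^sub>0 'a) list" and k ns
    assume x: "x \<in> cogs (length ys) d" and ns: "length ns = length ys"
      and ys: "\<forall>j<length ys. ys ! j \<in> Free agd_ar (ns ! j)" and "n = sum_list ns"
    have "supp_in (tconfs (length ys) n) (tensor_list ys)"
      using tensor_list_tconfs[OF refl ns ys] \<open>n = sum_list ns\<close> by simp
    then show "tensor x ys \<in> V"
      unfolding tensor_def
    proof (rule pair_in_subspace[OF x[unfolded cogs_def] _ assms(2)])
      fix s :: "agd_gen tree \<Rightarrow>\<^sub>0 'a" and ps
      assume "s \<in> {cog c (length ys) |c. dgr c (length ys) = d}" and ps: "ps \<in> tconfs (length ys) n"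
      then obtain c where c: "s = cog c (length ys)" "dgr c (length ys) = d" by blast
      show "pair s (bas ps) \<in> V"
      proof (cases "length ys = 0")
        case True
        then show ?thesis unfolding c(1) by (simp add: cog_0 fs.subspace_0[OF assms(2)])
      next
        case False
        then show ?thesis using assms(3)[OF c(2) ps] c(1) by simp
      qed
    qed
  qed
  then show ?thesis using assms(1) by blast
qed

definition den_forests :: "nat \<Rightarrow> nat \<Rightarrow> (agd_gen tree list \<Rightarrow>\<^sub>0 'k::field) set" where
  "den_forests k n = fs.span {tensor_list ys | ys ns. length ys = k \<and> length ns = k \<and>
     (\<forall>j<k. ys ! j \<in> Free agd_ar (ns ! j)) \<and> (\<exists>j<k. ys ! j \<in> J (ns ! j)) \<and> sum_list ns = n}"

lemma den_forests_subspace: "fs.subspace (den_forests k n)"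
  by (simp add: den_forests_def)

lemma den_forests_Cons:
  assumes "y \<in> Free agd_ar m" "w \<in> den_forests k n"
  shows "cons2 y w \<in> den_forests (Suc k) (m + n)"
  using assms(2) unfolding den_forests_def[of k]
proof (induction rule: fs.span_induct_alt)
  case base
  then show ?case by (simp add: fs.subspace_0[OF den_forests_subspace])
next
  case (step c s w)
  then obtain ys ns where s: "s = tensor_list ys" "length ys = k" "length ns = k"
     "\<forall>j<k. ys ! j \<in> Free agd_ar (ns ! j)" "\<exists>j<k. ys ! j \<in> J (ns ! j)" "sum_list ns = n"
    by auto
  have "\<forall>j<Suc k. (y # ys) ! j \<in> Free agd_ar ((m # ns) ! j)"
    using s assms(1) by (auto simp: nth_Cons split: nat.split)
  moreover have "\<exists>j<Suc k. (y # ys) ! j \<in> J ((m # ns) ! j)"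
    using s(5) by (metis Suc_mono nth_Cons_Suc)
  ultimately have "tensor_list (y # ys) \<in> den_forests (Suc k) (m + n)"
    unfolding den_forests_def using s
    by (intro fs.span_base CollectI exI[of _ "y # ys"] exI[of _ "m # ns"]) auto
  then show ?case using step(2) s(1)
    by (simp add: lift2_linear fs.subspace_add[OF den_forests_subspace] fs.subspace_scale[OF den_forests_subspace])
qed

lemma den_forests_hd:
  assumes "y \<in> J m" "ps \<in> tconfs k n"
  shows "cons2 y (bas ps) \<in> den_forests (Suc k) (m + n)"
proof -
  have "\<forall>j<Suc k. (y # map bas ps) ! j \<in> Free agd_ar ((m # map leaves ps) ! j)"
    using assms J_Free
    by (auto simp: nth_Cons tconfs_def list_all_length intro!: bas_Free split: nat.split)
  moreover have "\<exists>j<Suc k. (y # map bas ps) ! j \<in> J ((m # map leaves ps) ! j)"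
    using assms by (intro exI[of _ 0]) simp
  ultimately have "tensor_list (y # map bas ps) \<in> den_forests (Suc k) (m + n)"
    unfolding den_forests_def using assms(2)
    by (intro fs.span_base CollectI exI[of _ "y # map bas ps"] exI[of _ "m # map leaves ps"])
      (auto simp: tconfs_def)
  then show ?thesis by (simp add: tensor_list_bas)
qed

lemma bas_minus_nforms:
  "ps \<in> tconfs k n \<Longrightarrow>
     bas ps - lift (\<lambda>ms. bas (map nftree ms)) (nforms ps) \<in> (den_forests k n :: (_ \<Rightarrow>\<^sub>0 'k::field) set)"
proof (induction ps arbitrary: k n)
  case Nil
  then show ?case by (simp add: fs.subspace_0[OF den_forests_subspace])
next
  case (Cons p ps)
  have p: "wf_tree agd_ar p" and ps: "ps \<in> tconfs (k - 1) (n - leaves p)"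
    and k: "Suc (k - 1) = k" "leaves p + (n - leaves p) = n"
    using Cons.prems by (auto simp: tconfs_def)
  let ?X = "lift (\<lambda>m. bas (nftree m)) (nform p) :: _ \<Rightarrow>\<^sub>0 'k"
  let ?Y = "lift (\<lambda>ms. bas (map nftree ms)) (nforms ps) :: _ \<Rightarrow>\<^sub>0 'k"
  have "lift (\<lambda>ms. bas (map nftree ms)) (nforms (p # ps)) = cons2 ?X ?Y"
    by (simp add: lift2_def lift_lift)
  \<comment> \<open>Telescoping: one factor at a time is replaced by its normal form, and each
    difference has a factor in the ideal.\<close>
  then have eq: "bas (p # ps) - lift (\<lambda>ms. bas (map nftree ms)) (nforms (p # ps)) =
      cons2 (bas p - ?X) (bas ps) + cons2 ?X (bas ps - ?Y)"
    by (simp add: lift2_linear)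
  have J: "bas p - ?X \<in> J (leaves p)" using Jeq_nform[OF p, where 'k='k] by (simp add: Jeq_def)
  have "cons2 (bas p - ?X) (bas ps) \<in> den_forests k n"
    using den_forests_hd[OF J ps] k by simp
  moreover have "?X \<in> Free agd_ar (leaves p)"
    using nform_monoms[OF p, where 'k='k] nftree_wf unfolding supp_in_def
    by (intro lift_in_subspace Free_subspace bas_Free) blast+
  then have "cons2 ?X (bas ps - ?Y) \<in> den_forests k n"
    using den_forests_Cons[OF _ Cons.IH[OF ps]] k by fastforce
  ultimately show ?case
    unfolding eq by (rule fs.subspace_add[OF den_forests_subspace])
qed

lemma pair_den_forests:
  assumes "z \<in> den_forests k n" "dgr c k = d"
  shows "pair (cog c k) z \<in> agd_den n d"
  using assms(1) unfolding den_forests_def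
proof (induction rule: fs.span_induct_alt)
  case base
  then show ?case by (simp add: fs.subspace_0[OF kc_den_subspace])
next
  case (step a s y)
  then obtain ys ns where s: "s = tensor_list ys" "length ys = k" "length ns = k"
     "\<forall>j<k. ys ! j \<in> Free agd_ar (ns ! j)" "\<exists>j<k. ys ! j \<in> J (ns ! j)" "sum_list ns = n"
    by auto
  have "tensor (cog c k) ys \<in> agd_den n d"
    unfolding kc_den_def koszul_dual_eq using s cog_in_cogs[OF assms(2)]
    by (intro fs.span_base) blast
  then show ?case using step(2) s(1)
    by (simp add: lift2_linear tensor_def fs.subspace_add[OF kc_den_subspace]
        fs.subspace_scale[OF kc_den_subspace])
qed

lemma subspace_preimage:
  assumes "fs.subspace V" "\<And>x y. g (x + y) = g x + g y" "\<And>c x. g (fscale c x) = fscale c (g x)"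
  shows "fs.subspace {x. g x \<in> V}"
proof -
  have "g 0 = 0" using assms(3)[of 0 0] by simp
  then show ?thesis using assms unfolding fs.subspace_def by simp
qed

text \<open>The round trip replaces every upper tree by its normal form, which changes the element
  only by tensors with a factor in the ideal.\<close>

lemma of_model_to_model:
  assumes "x \<in> agd_num n d"
  shows "x - lift of_model (lift to_model x) \<in> (agd_den n d :: (_ \<Rightarrow>\<^sub>0 'k::field) set)"
proof -
  let ?V = "{x. x - lift of_model (lift to_model x) \<in> (agd_den n d :: (_ \<Rightarrow>\<^sub>0 'k) set)}"
  have "x \<in> ?V"
    using assms
  proof (rule num_induct)
    show "fs.subspace ?V"
      by (rule subspace_preimage[OF kc_den_subspace])
        (simp_all add: lift_linear fs.scale_right_diff_distrib)
  next
    fix c k ps assume c: "dgr c k = d" "ps \<in> tconfs k n" "0 < k"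
    have "lift of_model (lift to_model (pair (cog c k) (bas ps))) =
        lift (\<lambda>ms. of_model (c, ms)) (nforms ps :: _ \<Rightarrow>\<^sub>0 'k)"
      using c(3) by (simp add: to_model_cog lift_incl)
    also have "\<dots> = lift (\<lambda>ms. pair (cog c k) (bas (map nftree ms))) (nforms ps)"
      using nforms_confs[OF c(2), where 'k='k]
      by (intro lift_cong) (auto simp: of_model_def supp_in_def confs_def)
    also have "\<dots> = pair (cog c k) (lift (\<lambda>ms. bas (map nftree ms)) (nforms ps))"
      by (simp add: lift2_linear_right)
    finally have "pair (cog c k) (bas ps) - lift of_model (lift to_model (pair (cog c k) (bas ps))) =
        pair (cog c k) (bas ps - lift (\<lambda>ms. bas (map nftree ms)) (nforms ps) :: _ \<Rightarrow>\<^sub>0 'k)"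
      by (simp add: lift2_linear_right)
    then show "pair (cog c k) (bas ps) \<in> ?V"
      using pair_den_forests[OF bas_minus_nforms[OF c(2)] c(1)] by simp
  qed
  then show ?thesis by simp
qed

lemma nforms_tensor_list_zero:
  "\<exists>j<length ys. lift nform (ys ! j) = 0 \<Longrightarrow> lift nforms (tensor_list ys) = (0 :: _ \<Rightarrow>\<^sub>0 'k::field)"
proof (induction ys)
  case (Cons y ys)
  have eq: "lift nforms (tensor_list (y # ys)) = cons2 (lift nform y) (lift nforms (tensor_list ys) :: _ \<Rightarrow>\<^sub>0 'k)"
  proof -
    have "lift nforms (tensor_list (y # ys)) =
        lift (\<lambda>t. lift (\<lambda>ts. lift nforms (bas (t # ts))) (tensor_list ys)) y"
      by (simp only: tensor_list.simps lift2_def lift_lift)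
    then show ?thesis
      by (simp only: lift_bas nforms.simps lift2_linear(6,12)) (rule lift_swap)
  qed
  obtain j where j: "j < Suc (length ys)" "lift nform ((y # ys) ! j) = (0 :: _ \<Rightarrow>\<^sub>0 'k)"
    using Cons.prems by auto
  show ?case
  proof (cases j)
    case 0
    then show ?thesis using j by (simp only: eq) simp
  next
    case (Suc i)
    then have "lift nforms (tensor_list ys) = (0 :: _ \<Rightarrow>\<^sub>0 'k)" using Cons.IH j by auto
    then show ?thesis by (simp only: eq) simp
  qed
qed simp

text \<open>A factor in the ideal has normal form 0, and the normal form of a tensor is the tensor
  of the normal forms.\<close>

lemma to_model_den:
  assumes "x \<in> agd_den n d"
  shows "lift to_model x = (0 :: _ \<Rightarrow>\<^sub>0 'k::field)"
proof -
  have "lift to_model x = lift (\<lambda>_. 0) x"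
    using assms unfolding kc_den_def
  proof (rule span_eq_on, safe)
    fix x :: "agd_gen tree \<Rightarrow>\<^sub>0 'k" and ys :: "(agd_gen tree \<Rightarrow>\<^sub>0 'k) list" and ns j
    assume "j < length ys" "ys ! j \<in> J (ns ! j)"
    then have z: "lift nforms (tensor_list ys) = (0 :: _ \<Rightarrow>\<^sub>0 'k)"
      using nform_ideal by (intro nforms_tensor_list_zero) blast
    have "lift (\<lambda>ps. if t = ncomb c (leaves t - 1) then incl c (nforms ps) else 0) (tensor_list ys) =
        (if t = ncomb c (leaves t - 1) then incl c (lift nforms (tensor_list ys)) else 0 :: _ \<Rightarrow>\<^sub>0 'k)" for t c
      by (simp add: incl_lift)
    then have "lift (\<lambda>ps. to_model (t, ps)) (tensor_list ys) = (0 :: _ \<Rightarrow>\<^sub>0 'k)" for t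
      unfolding to_model_def prod.case lift_fun_sum z by (simp add: incl_linear)
    then show "lift to_model (tensor x ys) = lift (\<lambda>_. 0) (tensor x ys)"
      by (simp add: tensor_def lift2_def lift_lift)
  qed
  then show ?thesis by simp
qed

lemma to_model_kdiff:
  assumes "x \<in> agd_num n d"
  shows "lift to_model (kdiff x) = (lift mdiff (lift to_model x) :: _ \<Rightarrow>\<^sub>0 'k::field)"
proof -
  have "x \<in> {x. lift to_model (kdiff x) = (lift mdiff (lift to_model x) :: _ \<Rightarrow>\<^sub>0 'k)}"
    using assms
  proof (rule num_induct)
    show "fs.subspace {x. lift to_model (kdiff x) = (lift mdiff (lift to_model x) :: _ \<Rightarrow>\<^sub>0 'k)}"
      unfolding fs.subspace_def by (simp add: kdiff_def lift_linear)
  next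
    fix c k ps assume c: "dgr c k = d" "ps \<in> tconfs k n" "0 < k"
    obtain j where k: "k = Suc j" using c(3) by (cases k) auto
    have len: "length ps = Suc j" using c(2) k by (simp add: tconfs_def)
    \<comment> \<open>For a single tree the term of arity 0 is absent, so
      \<open>to_model_cog\<close> applies to the bar part as well.\<close>
    have z: "0 < j \<or> bar_tree ps = (0 :: _ \<Rightarrow>\<^sub>0 'k)"
      using len by (cases j) (auto simp: length_Suc_conv)
    show "pair (cog c k) (bas ps) \<in> {x. lift to_model (kdiff x) = (lift mdiff (lift to_model x) :: _ \<Rightarrow>\<^sub>0 'k)}"
      unfolding k mem_Collect_eq kdiff_pair_bas[OF len]
      by (cases "c = Mu")
        (simp_all add: to_model_cog[OF z] to_model_cog lift_linear lift_incl mdiff_def incl_lift[symmetric]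
          lift_fun_diff nforms_bar_tree nforms_lact_tree)
  qed
  then show ?thesis by simp
qed

text \<open>A product has at least two leaves, hence longer monomials; a unary root leaves an
  operator in some word. So only the identity contributes to the unit monomial.\<close>

lemma nform_unit:
  assumes "wf_tree agd_ar p" "p \<noteq> Leaf"
  shows "lkp (nform p) [[]] = (0 :: 'k::field)"
proof (cases p)
  case (Node g ts)
  show ?thesis
  proof (cases "g = Mu")
    case True
    then obtain a b where ts: "ts = [a, b]"
      using Node assms by (auto simp: length_Suc_conv numeral_2_eq_2)
    have "0 < leaves a" "0 < leaves b"
      using assms Node ts True by (auto intro!: leaves_pos[of agd_ar])
    then have "[[]] \<notin> monoms (leaves p)" using Node True ts by (auto simp: monoms_def)
    then show ?thesis using nform_monoms[OF assms(1), where 'k='k] by (auto simp: supp_in_def in_keys_iff)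
  next
    case False
    then obtain a where ts: "ts = [a]"
      using Node assms by (cases g) (auto simp: length_Suc_conv)
    have "lkp (der_bas g m) [[]] = (0 :: 'k)" for m
    proof (cases m)
      case (Cons w v)
      have "lkp (lift (\<lambda>v'. bas (w # v')) (der_bas (nxt g) v)) [[]] = (0 :: 'k)"
        using der_bas_nonempty[of "nxt g" v, where 'k='k]
        by (intro lookup_lift_zero) (auto simp: lookup_single when_def supp_in_def)
      then show ?thesis using Cons by (simp add: lookup_add lookup_single)
    qed simp
    then show ?thesis using Node ts False by (simp add: lookup_lift_zero)
  qed
qed (use assms in simp)

lemma lookup_incl: "lkp (incl c z) (c', ms) = (if c' = c then lkp z ms else 0)"
  unfolding incl_def by (subst lookup_lift_unique[of ms]) (auto simp: lookup_single when_def)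

lemma to_model_unit:
  assumes "x \<in> agd_num n d"
  shows "lkp (lift to_model x) (Mu, [[[]]]) = (kc_aug x :: 'k::field)"
proof -
  have "x \<in> {x. lkp (lift to_model x) (Mu, [[[]]]) = (kc_aug x :: 'k)}"
    using assms
  proof (rule num_induct)
    show "fs.subspace {x. lkp (lift to_model x) (Mu, [[[]]]) = (kc_aug x :: 'k)}"
      unfolding fs.subspace_def by (simp add: kc_aug_def lift_linear lookup_add lookup_fscale)
  next
    fix c k ps assume c: "dgr c k = d" "ps \<in> tconfs k n" "0 < k"
    have "lkp (nforms ps) [[[]]] = (if ps = [Leaf] then 1 else (0 :: 'k))"
    proof (cases "length ps = 1")
      case True
      then obtain p where p: "ps = [p]" by (auto simp: length_Suc_conv)
      then have "wf_tree agd_ar p" using c(2) by (simp add: tconfs_def)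
      then show ?thesis using p nform_unit[of p, where 'k='k]
        by (cases "p = Leaf") (simp_all add: lookup_lift2_Cons)
    next
      case False
      then have "[[[]]] \<notin> confs k n" using c(2) by (auto simp: confs_def tconfs_def)
      then show ?thesis using nforms_confs[OF c(2), where 'k='k] False
        by (auto simp: supp_in_def in_keys_iff)
    qed
    moreover have "ps = [Leaf] \<Longrightarrow> k = 1" using c(2) by (auto simp: tconfs_def)
    ultimately show "pair (cog c k) (bas ps) \<in> {x. lkp (lift to_model x) (Mu, [[[]]]) = (kc_aug x :: 'k)}"
      using c(3) by (auto simp: to_model_cog lookup_incl kc_aug_def lookup_lift2_Pair lookup_cog
          lookup_single when_def ccoef_def)
  qed
  then show ?thesis by simp
qed

definition model_confs :: "nat \<Rightarrow> nat \<Rightarrow> (agd_gen \<times> word list list) set" where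
  "model_confs n d = {(c, ms). \<exists>k>0. ms \<in> confs k n \<and> dgr c k = d}"

lemma supp_in_subspace: "fs.subspace {x :: 'a \<Rightarrow>\<^sub>0 'k::field. supp_in A x}"
proof -
  have "supp_in A (fscale c x)" if "supp_in A x" for c and x :: "'a \<Rightarrow>\<^sub>0 'k"
    using that by (auto simp: supp_in_def in_keys_iff lookup_fscale)
  then show ?thesis unfolding fs.subspace_def by (simp add: supp_in_add)
qed

lemma to_model_confs:
  assumes "x \<in> agd_num n d"
  shows "supp_in (model_confs n d) (lift to_model x :: _ \<Rightarrow>\<^sub>0 'k::field)"
proof -
  have "x \<in> {x. supp_in (model_confs n d) (lift to_model x :: _ \<Rightarrow>\<^sub>0 'k)}"
    using assms
  proof (rule num_induct)
    show "fs.subspace {x. supp_in (model_confs n d) (lift to_model x :: _ \<Rightarrow>\<^sub>0 'k)}"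
      using subspace_preimage[OF supp_in_subspace[of "model_confs n d"], of "lift to_model"]
      by (simp add: lift_linear)
  next
    fix c k ps assume c: "dgr c k = d" "ps \<in> tconfs k n" "0 < k"
    have "supp_in (model_confs n d) (incl c (nforms ps) :: _ \<Rightarrow>\<^sub>0 'k)"
      by (rule supp_in_incl[OF nforms_confs[OF c(2)]]) (use c in \<open>auto simp: model_confs_def\<close>)
    then show "pair (cog c k) (bas ps) \<in> {x. supp_in (model_confs n d) (lift to_model x :: _ \<Rightarrow>\<^sub>0 'k)}"
      using c(3) by (simp add: to_model_cog)
  qed
  then show ?thesis by simp
qed

lemma mhtpy_confs:
  assumes "a \<in> model_confs n d"
  shows "supp_in (model_confs n (d + 1)) (mhtpy a :: _ \<Rightarrow>\<^sub>0 'k::field)"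
proof -
  obtain c ms k where a: "a = (c, ms)" "0 < k" "ms \<in> confs k n" "dgr c k = d"
    using assms by (auto simp: model_confs_def)
  have 1: "supp_in (model_confs n (d + 1)) (incl c (bar_htpy ms) :: _ \<Rightarrow>\<^sub>0 'k)"
    by (rule supp_in_incl[OF bar_htpy_confs[OF a(3)]])
      (use a in \<open>auto simp: model_confs_def dgr_def intro!: exI[of _ "Suc k"]\<close>)
  have 2: "supp_in (model_confs n (d + 1)) (unact ms :: _ \<Rightarrow>\<^sub>0 'k)" if "c = Mu"
  proof (cases "k = 1 \<and> n = 1")
    case True
    then obtain w where w: "ms = [[w]]" "Mu \<notin> set w" using confs_1_1 a by blast
    show ?thesis
    proof (cases w)
      case (Cons c' w')
      have "(c', [[w']]) \<in> model_confs n (d + 1)"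
        using a True that w Cons
        by (auto simp: model_confs_def dgr_def confs_def monoms_def intro!: exI[of _ 1])
      then show ?thesis using w Cons by (simp add: supp_in_bas)
    qed (use w in simp)
  next
    case False
    then show ?thesis using unact_confs[OF a(3), where 'k='k] by auto
  qed
  show ?thesis using 1 2 by (auto simp: a(1) mhtpy_def intro: supp_in_add supp_in_uminus)
qed

lemma of_model_num:
  assumes "supp_in (model_confs n d) m"
  shows "lift of_model m \<in> (agd_num n d :: (_ \<Rightarrow>\<^sub>0 'k::field) set)"
proof (rule lift_in_subspace[OF kc_num_subspace])
  fix a assume "a \<in> Poly_Mapping.keys m"
  then obtain c ms k where a: "a = (c, ms)" "0 < k" "ms \<in> confs k n" "dgr c k = d"
    using assms by (auto simp: model_confs_def supp_in_def)
  then have "length ms = k" by (simp add: confs_def)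
  then show "of_model a \<in> (agd_num n d :: (_ \<Rightarrow>\<^sub>0 'k) set)"
    using a by (auto simp: of_model_def intro!: pair_cog_in_num supp_in_bas map_nftree_tconfs)
qed

lemma to_model_of_model:
  assumes "supp_in (model_confs n d) m"
  shows "lift to_model (lift of_model m) = (m :: _ \<Rightarrow>\<^sub>0 'k::field)"
proof -
  have "lift to_model (lift of_model m) = lift (\<lambda>a. lift to_model (of_model a)) m"
    by (rule lift_lift)
  also have "\<dots> = lift bas m"
  proof (rule lift_cong)
    fix a assume "a \<in> Poly_Mapping.keys m"
    then obtain c ms k where a: "a = (c, ms)" "0 < k" "ms \<in> confs k n" "dgr c k = d"
      using assms by (auto simp: model_confs_def supp_in_def)
    then have "length ms = k" by (simp add: confs_def)
    then show "lift to_model (of_model a) = (bas a :: _ \<Rightarrow>\<^sub>0 'k)"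
      using a nforms_nftree[OF a(3), where 'k='k]
      by (simp add: of_model_def to_model_cog incl_linear)
  qed
  finally show ?thesis by simp
qed

lemma kdiff_num:
  assumes "y \<in> agd_num n (d + 1)"
  shows "kdiff y \<in> (agd_num n d :: (_ \<Rightarrow>\<^sub>0 'k::field) set)"
proof -
  have "y \<in> {y. kdiff y \<in> (agd_num n d :: (_ \<Rightarrow>\<^sub>0 'k) set)}"
    using assms
  proof (rule num_induct)
    show "fs.subspace {y. kdiff y \<in> (agd_num n d :: (_ \<Rightarrow>\<^sub>0 'k) set)}"
      by (rule subspace_preimage[OF kc_num_subspace]) (simp_all add: kdiff_def lift_linear)
  next
    fix c k ps assume c: "dgr c k = d + 1" "ps \<in> tconfs k n" "0 < k"
    obtain j where k: "k = Suc j" using c(3) by (cases k) auto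
    have len: "length ps = Suc j" using c(2) k by (simp add: tconfs_def)
    have b: "supp_in (tconfs j n) (bar_tree ps :: _ \<Rightarrow>\<^sub>0 'k)"
      using bar_tree_tconfs[OF c(2), where 'k='k] k by simp
    show "pair (cog c k) (bas ps) \<in> {y. kdiff y \<in> (agd_num n d :: (_ \<Rightarrow>\<^sub>0 'k) set)}"
    proof (cases "c = Mu")
      case True
      then have "dgr Mu j = d" using c(1) k by (simp add: dgr_def)
      from pair_cog_in_num[OF b this] show ?thesis
        unfolding k mem_Collect_eq kdiff_pair_bas[OF len] using True by simp
    next
      case False
      then have "dgr c j = d" "dgr Mu k = d" using c(1) k by (simp_all add: dgr_def)
      from pair_cog_in_num[OF b this(1)] pair_cog_in_num[OF lact_tree_tconfs[OF False c(2), where 'k='k] this(2)]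
      show ?thesis
        unfolding k mem_Collect_eq kdiff_pair_bas[OF len] using False
        by (simp add: fs.subspace_diff[OF kc_num_subspace])
    qed
  qed
  then show ?thesis by simp
qed

theorem theorem2p2:
  shows "koszul agd_ar (agd_rel :: (agd_gen tree \<Rightarrow>\<^sub>0 'k::field_char_0) set)"
  unfolding koszul_def
proof (intro allI ballI impI)
  fix n d and x :: "agd_gen tree \<times> agd_gen tree list \<Rightarrow>\<^sub>0 'k"
  assume cyc: "x \<in> kc_cycles agd_ar agd_rel n d" and aug: "kc_aug x = 0"
  then have x: "x \<in> agd_num n d" and dx: "kdiff x \<in> agd_den n (d - 1)"
    by (auto simp: kc_cycles_def)
  define m where "m = (lift to_model x :: _ \<Rightarrow>\<^sub>0 'k)"
  have conf: "supp_in (model_confs n d) m"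
    unfolding m_def by (rule to_model_confs[OF x])
  have "lkp m (Mu, [[[]]]) = 0"
    unfolding m_def using to_model_unit[OF x] aug by simp
  then have unit: "(Mu, [[[]]]) \<notin> Poly_Mapping.keys m" by (simp add: in_keys_iff)
  have dm: "lift mdiff m = 0"
    unfolding m_def using to_model_kdiff[OF x] to_model_den[OF dx] by simp
  define m' where "m' = lift mhtpy m"
  have conf': "supp_in (model_confs n (d + 1)) m'"
    unfolding m'_def by (rule supp_in_lift[OF conf mhtpy_confs])
  \<comment> \<open>The added term is zero for a cycle. It completes the homotopy formula, which
    holds on the whole support of \<open>m\<close> because the augmentation condition removes the
    unit.\<close>
  have "lift mdiff m' = lift mdiff (lift mhtpy m) + lift mhtpy (lift mdiff m)"
    by (simp add: dm m'_def)
  also have "\<dots> = lift (\<lambda>a. lift mdiff (mhtpy a) + lift mhtpy (mdiff a)) m"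
    by (simp add: lift_lift lift_fun_add)
  also have "\<dots> = lift bas m"
  proof (rule lift_cong)
    fix a assume a: "a \<in> Poly_Mapping.keys m"
    then obtain c ms k where "a = (c, ms)" "0 < k" "ms \<in> confs k n"
      using conf by (auto simp: model_confs_def supp_in_def)
    then show "lift mdiff (mhtpy a) + lift mhtpy (mdiff a) = bas a"
      using mdiff_mhtpy[of ms k n c] unit a by auto
  qed
  finally have eq: "lift mdiff m' = m" by simp
  define y where "y = lift of_model m'"
  have y: "y \<in> agd_num n (d + 1)"
    unfolding y_def by (rule of_model_num[OF conf'])
  have "lift to_model (kdiff y) = m"
    unfolding to_model_kdiff[OF y] using to_model_of_model[OF conf'] eq by (simp add: y_def)
  then have "lift to_model (x - kdiff y) = 0"
    by (simp add: lift_diff m_def)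
  moreover have "x - kdiff y \<in> agd_num n d"
    by (rule fs.subspace_diff[OF kc_num_subspace x kdiff_num[OF y]])
  \<comment> \<open>An element of the numerator killed by \<open>to_model\<close> equals its own
    round-trip difference and so lies in the denominator.\<close>
  ultimately have "x - kdiff y \<in> agd_den n d"
    using of_model_to_model by fastforce
  then show "x \<in> kc_boundaries agd_ar agd_rel n d"
    unfolding kc_boundaries_def using y by (intro CollectI exI[of _ y] exI[of _ "x - kdiff y"]) simp
qed

end
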